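(* Assume $\mathbb E(|X_1|^\gamma)<\infty$ and $\sup_uf_\varepsilon(u\mid\mathcal F_0)\le\tau$ almost surely, for some $\gamma\ge0$ and $\tau<\infty$. Let $2<q<4$ and let $(\delta_n)$ be positive numbers with $\delta_n<1/2$ and $(\log n)^{2q/(q-2)}=O(n\delta_n)$. Further assume that for some $\mu\le1$, $$\sigma(f_\varepsilon,w_{2\gamma/q-\mu})+\sigma(f'_\varepsilon,w_{2\gamma/q+\mu})<\infty.$$ Then there is a constant $0<C<\infty$, independent of $n$ and $\delta_n$, such that for all $n\ge1$, $$\mathbb E\Big[\sup_{t\in\mathbb R}(1+|t|)^{2\gamma/q}\sup_{|s|\le\delta_n}|R_n(t+s)-R_n(t)|^2\Big]\le C\,\delta_n^{1-2/q}.$$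
   Context: Let $(\varepsilon_k)_{k\in\mathbb Z}$ be iid random variables, $\mathcal F_n=(\ldots,\varepsilon_{n-1},\varepsilon_n)$ (identified with the sigma-algebra it generates), and $X_n=J(\ldots,\varepsilon_{n-1},\varepsilon_n)$ for a measurable function $J$ such that $X_n$ is a proper random variable; $(X_n)$ is stationary with marginal distribution function $F$. Let $F_\varepsilon(x\mid\mathcal F_n)=\mathbb P(X_{n+1}\le x\mid\mathcal F_n)$; it is assumed that the conditional density $f_\varepsilon(x\mid\mathcal F_n)=\partial F_\varepsilon(x\mid\mathcal F_n)/\partial x$ exists almost surely, and $f'_\varepsilon(\theta\mid\mathcal F_n)=\partial f_\varepsilon(\theta\mid\mathcal F_n)/\partial\theta$. Write $\|\xi\|=(\mathbb E\xi^2)^{1/2}$ and $\mathcal P_k\xi=\mathbb E(\xi\mid\mathcal F_k)-\mathbb E(\xi\mid\mathcal F_{k-1})$. For $\lambda\in\mathbb R$, $w_\lambda(du)=(1+|u|)^\lambda\,du$. For a measure $m$ and measurable $h$, $\sigma(h,m)=\sum_{j=0}^\infty\sqrt{\int_{\mathbb R}\|\mathcal P_0h(\theta,\mathcal F_j)\|^2m(d\theta)}$; $\sigma(f_\varepsilon,m)$, $\sigma(f'_\varepsilon,m)$ denote this with $h(\theta,\mathcal F_j)=f_\varepsilon(\theta\mid\mathcal F_j)$, resp. $f'_\varepsilon(\theta\mid\mathcal F_j)$. $F_n(s)=n^{-1}\sum_{i=1}^n\mathbf 1_{X_i\le s}$, $R_n(s)=\sqrt n[F_n(s)-F(s)]$.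 *)

theory Defs
  imports "HOL-Probability.Probability" "HOL-Library.Landau_Symbols"
begin

definition past_sigma :: "'w measure \<Rightarrow> (int \<Rightarrow> 'w \<Rightarrow> real) \<Rightarrow> int \<Rightarrow> 'w measure" where
  "past_sigma M eps n =
     sigma (space M) {eps k -` A \<inter> space M | k A. k \<le> n \<and> A \<in> sets borel}"

definition proj_P :: "'w measure \<Rightarrow> (int \<Rightarrow> 'w measure) \<Rightarrow> int \<Rightarrow> ('w \<Rightarrow> real) \<Rightarrow> 'w \<Rightarrow> real" where
  "proj_P M F k xi = (\<lambda>w. real_cond_exp M (F k) xi w - real_cond_exp M (F (k - 1)) xi w)"

definition ensqrt :: "ennreal \<Rightarrow> ennreal" where
  "ensqrt x = (if x = \<infinity> then \<infinity> else ennreal (sqrt (enn2real x)))"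

definition weight_measure :: "real \<Rightarrow> real measure" where
  "weight_measure l = density lborel (\<lambda>u. ennreal ((1 + \<bar>u\<bar>) powr l))"

text \<open>sigma(h,m) = sum_{j>=0} sqrt( int ||P_0 h(theta,F_j)||^2 m(dtheta) ), where
  h j theta is the random variable h(theta,F_j) and ||xi||^2 = E xi^2.\<close>
definition dep_sigma :: "'w measure \<Rightarrow> (int \<Rightarrow> 'w measure) \<Rightarrow> (int \<Rightarrow> real \<Rightarrow> 'w \<Rightarrow> real)
    \<Rightarrow> real measure \<Rightarrow> ennreal" where
  "dep_sigma M F h m =
     (\<Sum>j::nat. ensqrt (\<integral>\<^sup>+ \<theta>. (\<integral>\<^sup>+ w. ennreal ((proj_P M F 0 (h (int j) \<theta>) w)\<^sup>2) \<partial>M) \<partial>m))"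

definition emp_R :: "'w measure \<Rightarrow> (int \<Rightarrow> 'w \<Rightarrow> real) \<Rightarrow> nat \<Rightarrow> real \<Rightarrow> 'w \<Rightarrow> real" where
  "emp_R M X n s w =
     sqrt (real n) * ((\<Sum>i=1..n. indicator {..s} (X (int i) w)) / real n
                      - measure M {w\<in>space M. X 0 w \<le> s})"

end

theory Submission
  imports Defs
begin

text \<open>
  All randomness is moved to the path space of the innovations, where conditional expectation given
  the past is integration over resampled future coordinates and stationarity is invariance under the
  shift.  The empirical process splits into a sum of martingale differences
  \<open>1(X\<^sub>i \<le> s) - F\<^sub>\<epsilon>(s | F\<^sub>i\<^sub>-\<^sub>1)\<close> and the differentiable rest \<open>F\<^sub>\<epsilon>(s | F\<^sub>i\<^sub>-\<^sub>1) - F(s)\<close>.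

  For the martingale part, the second and fourth moments of an increment over an interval are bounded
  by induction on \<open>n\<close>, and interpolation gives the \<open>q\<close>-th moment for \<open>2 < q < 4\<close>.  Dyadic chaining on
  blocks of length \<open>\<delta>\<close> down to scale \<open>\<delta> / n\<close> costs a factor \<open>log n\<close>, which the assumption on \<open>n \<delta>\<close>
  absorbs; below that scale monotonicity is enough.  Summing the block bounds with weights
  \<open>(1 + |k \<delta>|)\<^sup>\<gamma>\<close> reproduces the moment of \<open>X\<close>.

  For the differentiable part, the density process is a sum of projections whose norms are summable
  by assumption, so its weighted \<open>L\<^sup>2\<close> norm and that of its derivative are bounded uniformly in \<open>n\<close>; a
  one-dimensional Sobolev inequality turns this into a bound on its weighted supremum.
\<close>

section \<open>The shift space of an iid sequence\<close>

text \<open>The exponent \<open>\<alpha> = 1/2 - 1/q\<close> governs the martingale part. The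
  \<open>q\<close>-th moment of an increment over an interval of length \<open>h\<close> is of order
  \<open>(h + 1/n) powr (q/2 - 1)\<close> times the \<open>F\<close>-mass of the interval. Keeping
  this mass, instead of bounding it by \<open>h\<close>, makes the sum over a dyadic level telescope
  and lets the weighted blocks add up to a moment of \<open>X\<close>. At level \<open>j\<close> the
  size is about \<open>(\<delta> / 2^j) powr \<alpha> + (1/n) powr \<alpha>\<close>: the first term
  is geometric, the second is paid once per level, about \<open>log n\<close> times. Since
  \<open>2 * q / (q - 2) = 1 / \<alpha>\<close>, the growth assumption says that
  \<open>log n * (1/n) powr \<alpha>\<close> is \<open>O(\<delta> powr \<alpha>)\<close>, and the
  final rate is the square of \<open>\<delta> powr \<alpha>\<close>.

  The obstacle in the smooth part is that the derivative of the conditional density is given only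
  pointwise. Its integrability, over paths and over the argument, has to be extracted from the
  finite dependence sums.

  The suprema run over uncountable sets. Each part therefore supplies a measurable majorant, and the
  supremum itself meets only the monotonicity of the integral.\<close>

definition seq_shift :: "int \<Rightarrow> (int \<Rightarrow> 'a) \<Rightarrow> int \<Rightarrow> 'a" where
  "seq_shift n x = (\<lambda>k. x (k + n))"

text \<open>The past of \<open>x\<close> with a fresh future from \<open>y\<close>: for independent
  \<open>x\<close> and \<open>y\<close>, integrating over \<open>y\<close> alone conditions on the
  coordinates up to \<open>k\<close>.\<close>

definition glue :: "int \<Rightarrow> (int \<Rightarrow> 'a) \<Rightarrow> (int \<Rightarrow> 'a) \<Rightarrow> int \<Rightarrow> 'a" where
  "glue k x y = (\<lambda>i. if i \<le> k then x i else y i)"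

text \<open>Stands in for measurability with respect to the past: resampling the coordinates after
  \<open>k\<close> has no effect.\<close>

definition past_dep :: "int \<Rightarrow> ((int \<Rightarrow> 'a) \<Rightarrow> 'b) \<Rightarrow> bool" where
  "past_dep k f \<longleftrightarrow> (\<forall>x y. f (glue k x y) = f x)"

lemma shift_shift [simp]: "seq_shift m (seq_shift n x) = seq_shift (m + n) x"
  by (auto simp: seq_shift_def fun_eq_iff algebra_simps)

lemma shift_0 [simp]: "seq_shift 0 x = x"
  by (simp add: seq_shift_def)

lemma shift_glue: "seq_shift n (glue k x y) = glue (k - n) (seq_shift n x) (seq_shift n y)"
  by (auto simp: seq_shift_def glue_def fun_eq_iff)

lemma glue_glue_left: "k \<le> l \<Longrightarrow> glue k (glue l x y) z = glue k x z"
  by (auto simp: glue_def fun_eq_iff)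

lemma glue_glue_right: "k \<le> l \<Longrightarrow> glue l (glue k x y) z = glue k x (glue l y z)"
  by (auto simp: glue_def fun_eq_iff)

lemma past_depD: "past_dep k f \<Longrightarrow> f (glue k x y) = f x"
  by (simp add: past_dep_def)

lemma past_dep_mono: assumes "past_dep k f" "k \<le> l" shows "past_dep l f"
  unfolding past_dep_def
proof (intro allI)
  fix x y
  have "f (glue l x y) = f (glue k (glue l x y) x)"
    using assms(1) by (simp add: past_dep_def)
  also have "glue k (glue l x y) x = x"
    using assms(2) by (auto simp: glue_def fun_eq_iff)
  finally show "f (glue l x y) = f x" .
qed

lemma past_dep_shift: "past_dep k f \<Longrightarrow> past_dep (k + n) (\<lambda>x. f (seq_shift n x))"
  by (simp add: past_dep_def shift_glue)

lemma shift_measurable [measurable (raw)]: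
  assumes [measurable]: "f \<in> N \<rightarrow>\<^sub>M Pi\<^sub>M UNIV (\<lambda>_. B)"
  shows "(\<lambda>w. seq_shift n (f w)) \<in> N \<rightarrow>\<^sub>M Pi\<^sub>M UNIV (\<lambda>_. B)"
  unfolding seq_shift_def
  by (rule measurable_PiM_single')
     (auto intro!: measurable_compose[OF assms measurable_component_singleton]
           dest!: measurable_space[OF assms] simp: space_PiM PiE_iff)

lemma glue_measurable [measurable (raw)]:
  assumes [measurable]: "f \<in> N \<rightarrow>\<^sub>M Pi\<^sub>M UNIV (\<lambda>_. B)" "g \<in> N \<rightarrow>\<^sub>M Pi\<^sub>M UNIV (\<lambda>_. B)"
  shows "(\<lambda>w. glue k (f w) (g w)) \<in> N \<rightarrow>\<^sub>M Pi\<^sub>M UNIV (\<lambda>_. B)"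
proof (rule measurable_PiM_single')
  show "(\<lambda>w. glue k (f w) (g w) i) \<in> N \<rightarrow>\<^sub>M B" for i
    by (cases "i \<le> k") (auto simp: glue_def intro!: measurable_compose[OF assms(1) measurable_component_singleton]
        measurable_compose[OF assms(2) measurable_component_singleton])
  show "(\<lambda>w. glue k (f w) (g w)) \<in> space N \<rightarrow> (\<Pi>\<^sub>E i\<in>UNIV. space B)"
    using measurable_space[OF assms(1)] measurable_space[OF assms(2)]
    by (auto simp: glue_def space_PiM PiE_iff)
qed

section \<open>The product measure on paths, shifts and resampling\<close>

locale path_space = prob_space D for D :: "real measure" +
  assumes sets_D [measurable_cong]: "sets D = sets borel"
begin

definition PM :: "(int \<Rightarrow> real) measure" where
  "PM = Pi\<^sub>M UNIV (\<lambda>_. D)"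

lemma sets_PM [measurable_cong]: "sets PM = sets (Pi\<^sub>M UNIV (\<lambda>_. borel))"
  unfolding PM_def by (intro sets_PiM_cong) (auto simp: sets_D)

lemma space_D [simp]: "space D = UNIV"
  using sets_eq_imp_space_eq[OF sets_D] by simp

lemma space_PM [simp]: "space PM = UNIV"
  by (simp add: PM_def space_PiM)

sublocale PS: product_prob_space "\<lambda>_::int. D" UNIV ..

sublocale PP: prob_space PM
  unfolding PM_def by (rule PS.P.prob_space_axioms)

sublocale PPP: pair_prob_space PM PM ..

lemma measurable_PM: "f \<in> N \<rightarrow>\<^sub>M PM \<longleftrightarrow> f \<in> N \<rightarrow>\<^sub>M Pi\<^sub>M UNIV (\<lambda>_. borel)"
  using measurable_cong_sets[OF refl sets_PM, of N] by simp

lemma PM_eqI: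
  assumes s: "sets Q = sets PM"
    and eq: "\<And>J F. finite J \<Longrightarrow> (\<And>j. j \<in> J \<Longrightarrow> F j \<in> sets borel) \<Longrightarrow>
      emeasure Q {x. \<forall>j\<in>J. x j \<in> F j} = (\<Prod>j\<in>J. emeasure D (F j))"
  shows "Q = PM"
  unfolding PM_def
proof (rule PS.PiM_eq)
  show "sets Q = sets (Pi\<^sub>M UNIV (\<lambda>_. D))" using s by (simp add: PM_def)
  fix J :: "int set" and F assume J: "finite J" "\<And>j. j \<in> J \<Longrightarrow> F j \<in> sets D"
  have "prod_emb UNIV (\<lambda>_. D) J (Pi\<^sub>E J F) = {x. \<forall>j\<in>J. x j \<in> F j}"
    by (auto simp: prod_emb_def space_PiM PiE_iff)
  then show "emeasure Q (prod_emb UNIV (\<lambda>_. D) J (Pi\<^sub>E J F)) = (\<Prod>j\<in>J. emeasure D (F j))"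
    using eq[of J F] J by (simp add: sets_D)
qed

lemma emeasure_PM_box:
  assumes "finite J" "\<And>j. j \<in> J \<Longrightarrow> F j \<in> sets borel"
  shows "emeasure PM {x. \<forall>j\<in>J. x j \<in> F j} = (\<Prod>j\<in>J. emeasure D (F j))"
proof -
  have "{x. \<forall>j\<in>J. x j \<in> F j} = prod_emb UNIV (\<lambda>_. D) J (Pi\<^sub>E J F)"
    by (auto simp: prod_emb_def space_PiM PiE_iff)
  then show ?thesis
    using assms by (simp add: PM_def sets_D PS.emeasure_PiM_emb)
qed

lemma box_sets:
  assumes "finite J" "\<And>j. j \<in> J \<Longrightarrow> F j \<in> sets borel"
  shows "{x. \<forall>j\<in>J. x j \<in> F j} \<in> sets PM"
proof -
  have "{x. \<forall>j\<in>J. x j \<in> F j} = prod_emb UNIV (\<lambda>_. borel) J (Pi\<^sub>E J F)"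
    by (auto simp: prod_emb_def space_PiM PiE_iff)
  then show ?thesis
    using assms by (auto simp: sets_PM intro!: sets_PiM_I)
qed

lemma shift_meas_PM [measurable]: "seq_shift n \<in> PM \<rightarrow>\<^sub>M PM"
  by measurable

lemma glue_meas_PM [measurable]: "(\<lambda>(x, y). glue k x y) \<in> PM \<Otimes>\<^sub>M PM \<rightarrow>\<^sub>M PM"
  by measurable

lemma distr_shift: "distr PM PM (seq_shift n) = PM"
proof (rule PM_eqI)
  fix J :: "int set" and F :: "int \<Rightarrow> real set"
  assume J: "finite J" "\<And>j. j \<in> J \<Longrightarrow> F j \<in> sets borel"
  have "emeasure (distr PM PM (seq_shift n)) {x. \<forall>j\<in>J. x j \<in> F j}
    = emeasure PM {x. \<forall>j\<in>(\<lambda>k. k + n) ` J. x j \<in> F (j - n)}"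
    using box_sets[OF J] by (subst emeasure_distr) (auto simp: seq_shift_def intro!: arg_cong[where f="emeasure PM"])
  also have "\<dots> = (\<Prod>j\<in>(\<lambda>k. k + n) ` J. emeasure D (F (j - n)))"
    using J by (intro emeasure_PM_box) auto
  also have "\<dots> = (\<Prod>j\<in>J. emeasure D (F j))"
    by (subst prod.reindex) (auto simp: inj_on_def)
  finally show "emeasure (distr PM PM (seq_shift n)) {x. \<forall>j\<in>J. x j \<in> F j} = (\<Prod>j\<in>J. emeasure D (F j))" .
qed simp

text \<open>The two halves of a glued path use disjoint coordinates of two independent paths, so the
  probability of a box factors into its part up to \<open>k\<close> and its part after
  \<open>k\<close>, exactly as under \<open>PM\<close>.\<close>

lemma distr_glue: "distr (PM \<Otimes>\<^sub>M PM) PM (\<lambda>(x, y). glue k x y) = PM"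
proof (rule PM_eqI)
  fix J :: "int set" and F :: "int \<Rightarrow> real set"
  assume J: "finite J" "\<And>j. j \<in> J \<Longrightarrow> F j \<in> sets borel"
  define A where "A = {x. \<forall>j\<in>J \<inter> {..k}. x j \<in> F j}"
  define B where "B = {x. \<forall>j\<in>J \<inter> {k<..}. x j \<in> F j}"
  have A: "A \<in> sets PM" "emeasure PM A = (\<Prod>j\<in>J \<inter> {..k}. emeasure D (F j))"
    unfolding A_def using J by (auto intro!: emeasure_PM_box box_sets)
  have B: "B \<in> sets PM" "emeasure PM B = (\<Prod>j\<in>J \<inter> {k<..}. emeasure D (F j))"
    unfolding B_def using J by (auto intro!: emeasure_PM_box box_sets)
  have "(\<lambda>(x, y). glue k x y) -` {x. \<forall>j\<in>J. x j \<in> F j} \<inter> space (PM \<Otimes>\<^sub>M PM) = A \<times> B"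
    by (auto simp: glue_def A_def B_def space_pair_measure split: if_splits)
  then have "emeasure (distr (PM \<Otimes>\<^sub>M PM) PM (\<lambda>(x, y). glue k x y)) {x. \<forall>j\<in>J. x j \<in> F j}
    = emeasure (PM \<Otimes>\<^sub>M PM) (A \<times> B)"
    using emeasure_distr[OF glue_meas_PM[of k] box_sets[OF J(1), of F]] J(2) by simp
  also have "\<dots> = emeasure PM A * emeasure PM B"
    using A B by (simp add: PP.emeasure_pair_measure_Times)
  also have "\<dots> = (\<Prod>j\<in>(J \<inter> {..k}) \<union> (J \<inter> {k<..}). emeasure D (F j))"
    using J unfolding A B by (subst prod.union_disjoint) auto
  also have "(J \<inter> {..k}) \<union> (J \<inter> {k<..}) = J" by auto
  finally show "emeasure (distr (PM \<Otimes>\<^sub>M PM) PM (\<lambda>(x, y). glue k x y)) {x. \<forall>j\<in>J. x j \<in> F j}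
    = (\<Prod>j\<in>J. emeasure D (F j))" .
qed simp

lemma nn_integral_shift:
  assumes [measurable]: "f \<in> borel_measurable PM"
  shows "(\<integral>\<^sup>+x. f (seq_shift n x) \<partial>PM) = (\<integral>\<^sup>+x. f x \<partial>PM)"
  by (subst (2) distr_shift[of n, symmetric]) (simp add: nn_integral_distr)

lemma integral_shift:
  fixes f :: "_ \<Rightarrow> real"
  assumes [measurable]: "f \<in> borel_measurable PM"
  shows "(\<integral>x. f (seq_shift n x) \<partial>PM) = (\<integral>x. f x \<partial>PM)"
  by (subst (2) distr_shift[of n, symmetric]) (simp add: integral_distr)

lemma integrable_shift:
  fixes f :: "_ \<Rightarrow> real"
  assumes "integrable PM f"
  shows "integrable PM (\<lambda>x. f (seq_shift n x))"
  using assms integrable_distr[OF shift_meas_PM[of n], of f] by (simp add: distr_shift)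

lemma AE_shift:
  assumes "AE x in PM. Q x"
  shows "AE x in PM. Q (seq_shift n x)"
  using assms by (subst (asm) distr_shift[of n, symmetric]) (rule AE_distrD[OF shift_meas_PM])

lemma nn_integral_glue:
  assumes [measurable]: "f \<in> borel_measurable PM"
  shows "(\<integral>\<^sup>+x. \<integral>\<^sup>+y. f (glue k x y) \<partial>PM \<partial>PM) = (\<integral>\<^sup>+x. f x \<partial>PM)"
proof -
  have "(\<integral>\<^sup>+x. f x \<partial>PM) = (\<integral>\<^sup>+z. f (case z of (x, y) \<Rightarrow> glue k x y) \<partial>(PM \<Otimes>\<^sub>M PM))"
    by (subst distr_glue[of k, symmetric]) (simp add: nn_integral_distr)
  also have "\<dots> = (\<integral>\<^sup>+x. \<integral>\<^sup>+y. f (glue k x y) \<partial>PM \<partial>PM)"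
    by (subst PP.nn_integral_fst[symmetric]) auto
  finally show ?thesis ..
qed

lemma AE_glue:
  assumes "AE x in PM. Q x"
  shows "AE x in PM. AE y in PM. Q (glue k x y)"
proof -
  have "AE z in PM \<Otimes>\<^sub>M PM. Q ((\<lambda>(x, y). glue k x y) z)"
    using assms by (subst (asm) distr_glue[of k, symmetric]) (rule AE_distrD[OF glue_meas_PM])
  then show ?thesis
    using PPP.AE_pair by fastforce
qed

lemma integrable_glue:
  fixes f :: "_ \<Rightarrow> real"
  assumes "integrable PM f"
  shows "integrable (PM \<Otimes>\<^sub>M PM) (\<lambda>(x, y). f (glue k x y))"
  using assms integrable_distr[OF glue_meas_PM[of k], of f] by (simp add: distr_glue) (simp add: case_prod_beta')

lemma AE_integrable_glue:
  fixes f :: "_ \<Rightarrow> real"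
  assumes "integrable PM f"
  shows "AE x in PM. integrable PM (\<lambda>y. f (glue k x y))"
  using PPP.AE_integrable_fst'[OF integrable_glue[OF assms]] by simp

lemma integral_glue:
  fixes f :: "_ \<Rightarrow> real"
  assumes f: "integrable PM f"
  shows "(\<integral>x. \<integral>y. f (glue k x y) \<partial>PM \<partial>PM) = (\<integral>x. f x \<partial>PM)"
proof -
  have [measurable]: "f \<in> borel_measurable PM" using f by auto
  have "(\<integral>x. f x \<partial>PM) = (\<integral>z. f (case z of (x, y) \<Rightarrow> glue k x y) \<partial>(PM \<Otimes>\<^sub>M PM))"
    by (subst distr_glue[of k, symmetric]) (simp add: integral_distr)
  also have "\<dots> = (\<integral>x. \<integral>y. f (glue k x y) \<partial>PM \<partial>PM)"
    using PPP.integral_fst'[OF integrable_glue[OF f]] by (simp add: case_prod_beta')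
  finally show ?thesis ..
qed

text \<open>\<open>CE\<close> imitates \<open>real_cond_exp\<close> on non-integrable functions too (where
  \<open>enn2real \<infinity> = 0\<close>), so that \<open>dep_sigma\<close> can be transported before the integrability of the
  derivative \<open>f'\<^sub>\<epsilon>\<close> is known.\<close>
definition CEn :: "int \<Rightarrow> ((int \<Rightarrow> real) \<Rightarrow> ennreal) \<Rightarrow> (int \<Rightarrow> real) \<Rightarrow> ennreal" where
  "CEn k f x = (\<integral>\<^sup>+y. f (glue k x y) \<partial>PM)"

definition CE :: "int \<Rightarrow> ((int \<Rightarrow> real) \<Rightarrow> real) \<Rightarrow> (int \<Rightarrow> real) \<Rightarrow> real" where
  "CE k f x = enn2real (CEn k (\<lambda>z. ennreal (f z)) x) - enn2real (CEn k (\<lambda>z. ennreal (- f z)) x)"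

lemma CEn_measurable [measurable]:
  assumes [measurable]: "f \<in> borel_measurable PM"
  shows "CEn k f \<in> borel_measurable PM"
  unfolding CEn_def by measurable

lemma CE_measurable [measurable]:
  assumes [measurable]: "f \<in> borel_measurable PM"
  shows "CE k f \<in> borel_measurable PM"
  unfolding CE_def by measurable

lemma past_dep_CEn: "past_dep k (CEn k f)"
  by (simp add: past_dep_def CEn_def glue_glue_left)

lemma past_dep_CE: "past_dep k (CE k f)"
  using past_dep_CEn by (simp add: past_dep_def CE_def)

lemma CEn_shift:
  assumes [measurable]: "f \<in> borel_measurable PM"
  shows "CEn k (\<lambda>z. f (seq_shift n z)) x = CEn (k - n) f (seq_shift n x)"
  unfolding CEn_def shift_glue
  by (rule nn_integral_shift[of "\<lambda>y. f (glue (k - n) (seq_shift n x) y)"]) measurable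

lemma CE_shift:
  assumes [measurable]: "f \<in> borel_measurable PM"
  shows "CE k (\<lambda>z. f (seq_shift n z)) x = CE (k - n) f (seq_shift n x)"
  unfolding CE_def
  using CEn_shift[of "\<lambda>z. ennreal (f z)"] CEn_shift[of "\<lambda>z. ennreal (- f z)"] by simp

lemma CE_past:
  assumes "past_dep k f"
  shows "CE k f x = f x"
  using assms PP.emeasure_space_1
  by (cases "f x \<ge> 0") (simp_all add: CE_def CEn_def past_depD ennreal_neg)

lemma CE_eq_integral:
  assumes "integrable PM (\<lambda>y. f (glue k x y))"
  shows "CE k f x = (\<integral>y. f (glue k x y) \<partial>PM)"
  by (simp add: CE_def CEn_def real_lebesgue_integral_def[OF assms])

end

section \<open>Conditional expectations as kernel integrals\<close>

definition paths :: "(int \<Rightarrow> 'w \<Rightarrow> real) \<Rightarrow> 'w \<Rightarrow> int \<Rightarrow> real" where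
  "paths eps w = (\<lambda>k. eps k w)"

text \<open>Independence and identical distribution enter only through the law of the whole
  innovation path, so every expectation over \<open>M\<close> can be moved to path space.\<close>

locale iid_path = path_space D + M: prob_space M
  for D :: "real measure" and M :: "'w measure" +
  fixes eps :: "int \<Rightarrow> 'w \<Rightarrow> real"
  assumes eps_meas [measurable]: "\<And>k. eps k \<in> borel_measurable M"
    and distr_paths: "distr M PM (paths eps) = PM"
begin

lemma paths_meas [measurable]: "paths eps \<in> M \<rightarrow>\<^sub>M Pi\<^sub>M UNIV (\<lambda>_. borel)"
  unfolding paths_def by (rule measurable_PiM_single') auto

lemma paths_meas_PM [measurable]: "paths eps \<in> M \<rightarrow>\<^sub>M PM"
  by (simp add: measurable_PM)

lemma nn_integral_paths:
  assumes [measurable]: "f \<in> borel_measurable PM"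
  shows "(\<integral>\<^sup>+w. f (paths eps w) \<partial>M) = (\<integral>\<^sup>+x. f x \<partial>PM)"
  using nn_integral_distr[OF paths_meas_PM, of f] by (simp add: distr_paths)

lemma integral_paths:
  fixes f :: "_ \<Rightarrow> real"
  assumes [measurable]: "f \<in> borel_measurable PM"
  shows "(\<integral>w. f (paths eps w) \<partial>M) = (\<integral>x. f x \<partial>PM)"
  using integral_distr[OF paths_meas_PM, of f] by (simp add: distr_paths)

lemma integrable_paths:
  fixes f :: "_ \<Rightarrow> real"
  assumes "integrable PM f"
  shows "integrable M (\<lambda>w. f (paths eps w))"
  using assms integrable_distr[OF paths_meas_PM, of f] by (simp add: distr_paths)

lemma AE_paths:
  assumes "AE x in PM. Q x"
  shows "AE w in M. Q (paths eps w)"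
  using assms by (subst (asm) distr_paths[symmetric]) (rule AE_distrD[OF paths_meas_PM])

lemma AE_paths_iff:
  assumes [measurable]: "Measurable.pred PM Q"
  shows "(AE w in M. Q (paths eps w)) \<longleftrightarrow> (AE x in PM. Q x)"
  using AE_distr_iff[OF paths_meas_PM, of Q, unfolded distr_paths] assms by (simp add: pred_def)

lemma space_past_sigma [simp]: "space (past_sigma M eps k) = space M"
  unfolding past_sigma_def by (rule space_measure_of) auto

lemma sets_past_sigma: "sets (past_sigma M eps k)
   = sigma_sets (space M) {eps i -` A \<inter> space M | i A. i \<le> k \<and> A \<in> sets borel}"
  unfolding past_sigma_def by (rule sets_measure_of) auto

lemma eps_meas_past: "i \<le> k \<Longrightarrow> eps i \<in> borel_measurable (past_sigma M eps k)"
  by (rule measurableI) (auto simp: sets_past_sigma)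

lemma subalgebra_past_sigma: "subalgebra M (past_sigma M eps k)"
  unfolding subalgebra_def
proof
  show "sets (past_sigma M eps k) \<subseteq> sets M"
    unfolding sets_past_sigma by (rule sets.sigma_sets_subset) auto
qed simp

text \<open>Induction over the generated sigma-algebra. It supplies the test events for conditional
  expectations in a form whose indicator is unchanged by resampling the future.\<close>

lemma past_sigma_ex_path_set:
  assumes "A \<in> sets (past_sigma M eps k)"
  shows "\<exists>B\<in>sets PM. A = paths eps -` B \<inter> space M \<and> past_dep k (\<lambda>x. x \<in> B)"
  using assms unfolding sets_past_sigma
proof (induction rule: sigma_sets.induct)
  case (Basic a)
  then obtain i A where a: "a = eps i -` A \<inter> space M" "i \<le> k" "A \<in> sets borel" by auto
  have "{x. \<forall>j\<in>{i}. x j \<in> A} \<in> sets PM"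
    by (rule box_sets) (auto simp: a)
  then show ?case using a
    by (intro bexI[of _ "{x. x i \<in> A}"]) (auto simp: paths_def past_dep_def glue_def)
next
  case Empty
  then show ?case by (intro bexI[of _ "{}"]) (auto simp: past_dep_def)
next
  case (Compl a)
  then obtain B where B: "B \<in> sets PM" "a = paths eps -` B \<inter> space M" "past_dep k (\<lambda>x. x \<in> B)" by auto
  then show ?case using sets.compl_sets[OF B(1)]
    by (intro bexI[of _ "- B"]) (auto simp: past_dep_def Compl_eq_Diff_UNIV)
next
  case (Union a)
  from Union.IH have "\<forall>i. \<exists>B. B \<in> sets PM \<and> a i = paths eps -` B \<inter> space M \<and> past_dep k (\<lambda>x. x \<in> B)"
    by blast
  then obtain B where B: "\<And>i::nat. B i \<in> sets PM" "\<And>i. a i = paths eps -` B i \<inter> space M"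
      "\<And>i. past_dep k (\<lambda>x. x \<in> B i)" unfolding choice_iff by blast
  then show ?case
    by (intro bexI[of _ "\<Union>i. B i"]) (auto simp: past_dep_def)
qed

text \<open>Overwriting the future coordinates by \<open>0\<close> does not change \<open>f\<close>,
  and the overwritten path is visibly a function of the innovations up to \<open>k\<close>.\<close>

lemma measurable_past_sigma_paths:
  assumes f: "f \<in> PM \<rightarrow>\<^sub>M N" and dep: "past_dep k f"
  shows "(\<lambda>w. f (paths eps w)) \<in> past_sigma M eps k \<rightarrow>\<^sub>M N"
proof -
  have "(\<lambda>w. glue k (paths eps w) (\<lambda>_. 0)) \<in> past_sigma M eps k \<rightarrow>\<^sub>M Pi\<^sub>M UNIV (\<lambda>_. borel)"
  proof (rule measurable_PiM_single')
    show "(\<lambda>w. glue k (paths eps w) (\<lambda>_. 0) i) \<in> borel_measurable (past_sigma M eps k)" for i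
      using eps_meas_past[of i k] by (cases "i \<le> k") (auto simp: glue_def paths_def)
  qed auto
  then have "(\<lambda>w. f (glue k (paths eps w) (\<lambda>_. 0))) \<in> past_sigma M eps k \<rightarrow>\<^sub>M N"
    using f by (intro measurable_compose[OF _ f]) (simp add: measurable_PM)
  then show ?thesis using past_depD[OF dep] by simp
qed

text \<open>The resampling integral has the defining property of the conditional expectation: a test
  event of the past factors out of the inner integral, and the law of the glued path is again
  \<open>PM\<close>.\<close>

lemma nn_cond_exp_paths:
  assumes [measurable]: "f \<in> borel_measurable PM"
  shows "AE w in M. nn_cond_exp M (past_sigma M eps k) (\<lambda>w. f (paths eps w)) w = CEn k f (paths eps w)"
proof -
  interpret finite_measure_subalgebra M "past_sigma M eps k"
    by unfold_locales (rule subalgebra_past_sigma)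
  have "AE w in M. CEn k f (paths eps w) = nn_cond_exp M (past_sigma M eps k) (\<lambda>w. f (paths eps w)) w"
  proof (rule nn_cond_exp_charact)
    fix A assume "A \<in> sets (past_sigma M eps k)"
    then obtain B where B: "B \<in> sets PM" "A = paths eps -` B \<inter> space M" "past_dep k (\<lambda>x. x \<in> B)"
      using past_sigma_ex_path_set by blast
    note [measurable] = B(1)
    have Bg: "indicator B (glue k x y) = (indicator B x :: ennreal)" for x y
      using past_depD[OF B(3)] by (simp add: indicator_def)
    have ind: "indicator A w = (indicator B (paths eps w) :: ennreal)" if "w \<in> space M" for w
      using that by (simp add: B(2) indicator_def)
    have "(\<integral>\<^sup>+w\<in>A. f (paths eps w) \<partial>M) = (\<integral>\<^sup>+w. f (paths eps w) * indicator B (paths eps w) \<partial>M)"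
      by (rule nn_integral_cong) (simp add: ind)
    also have "\<dots> = (\<integral>\<^sup>+x. f x * indicator B x \<partial>PM)"
      by (rule nn_integral_paths) measurable
    also have "\<dots> = (\<integral>\<^sup>+x. \<integral>\<^sup>+y. f (glue k x y) * indicator B (glue k x y) \<partial>PM \<partial>PM)"
      by (rule nn_integral_glue[symmetric]) measurable
    also have "\<dots> = (\<integral>\<^sup>+x. CEn k f x * indicator B x \<partial>PM)"
      unfolding Bg CEn_def by (intro nn_integral_cong nn_integral_multc) measurable
    also have "\<dots> = (\<integral>\<^sup>+w. CEn k f (paths eps w) * indicator B (paths eps w) \<partial>M)"
      by (rule nn_integral_paths[symmetric]) measurable
    also have "\<dots> = (\<integral>\<^sup>+w\<in>A. CEn k f (paths eps w) \<partial>M)"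
      by (rule nn_integral_cong) (simp add: ind)
    finally show "(\<integral>\<^sup>+w\<in>A. f (paths eps w) \<partial>M) = (\<integral>\<^sup>+w\<in>A. CEn k f (paths eps w) \<partial>M)" .
  next
    show "(\<lambda>w. CEn k f (paths eps w)) \<in> borel_measurable (past_sigma M eps k)"
      by (rule measurable_past_sigma_paths[OF _ past_dep_CEn]) measurable
  qed measurable
  then show ?thesis by eventually_elim simp
qed

lemma real_cond_exp_paths:
  assumes [measurable]: "f \<in> borel_measurable PM"
  shows "AE w in M. real_cond_exp M (past_sigma M eps k) (\<lambda>w. f (paths eps w)) w = CE k f (paths eps w)"
proof -
  have "AE w in M. nn_cond_exp M (past_sigma M eps k) (\<lambda>w. ennreal (f (paths eps w))) w
      = CEn k (\<lambda>x. ennreal (f x)) (paths eps w)"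
    by (rule nn_cond_exp_paths) measurable
  moreover have "AE w in M. nn_cond_exp M (past_sigma M eps k) (\<lambda>w. ennreal (- f (paths eps w))) w
      = CEn k (\<lambda>x. ennreal (- f x)) (paths eps w)"
    by (rule nn_cond_exp_paths) measurable
  ultimately show ?thesis
    by eventually_elim (simp add: real_cond_exp_def CE_def)
qed

end

lemma iid_pathI:
  fixes eps :: "int \<Rightarrow> 'w \<Rightarrow> real"
  assumes "prob_space M" and rv: "\<And>k. eps k \<in> borel_measurable M"
    and indep: "prob_space.indep_vars M (\<lambda>_. borel) eps UNIV"
    and ident: "\<And>k. distr M borel (eps k) = distr M borel (eps 0)"
  shows "iid_path (distr M borel (eps 0)) M eps"
proof -
  interpret prob_space M by fact
  interpret D: prob_space "distr M borel (eps 0)"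
    using rv by (rule prob_space_distr)
  interpret path_space "distr M borel (eps 0)"
    by unfold_locales simp
  have "distr M (Pi\<^sub>M UNIV (\<lambda>_. borel)) (\<lambda>w. \<lambda>i\<in>UNIV. eps i w) = (\<Pi>\<^sub>M i\<in>UNIV. distr M borel (eps i))"
    using indep rv by (subst (asm) indep_vars_iff_distr_eq_PiM) auto
  also have "(\<Pi>\<^sub>M i\<in>UNIV. distr M borel (eps i)) = PM"
    unfolding PM_def using ident by (intro PiM_cong) blast+
  finally have "distr M (Pi\<^sub>M UNIV (\<lambda>_. borel)) (paths eps) = PM"
    by (simp add: paths_def[abs_def] restrict_def)
  moreover have "distr M PM (paths eps) = distr M (Pi\<^sub>M UNIV (\<lambda>_. borel)) (paths eps)"
    by (rule distr_cong) (auto simp: sets_PM)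
  ultimately show ?thesis
    by unfold_locales (auto simp: rv)
qed

section \<open>Variances of sums under summable projections\<close>

text \<open>Weighted Cauchy-Schwarz: write \<open>a j\<close> as \<open>sqrt (t j)\<close> times
  \<open>a j / sqrt (t j)\<close>, first for partial sums and then in the limit.\<close>

lemma ennreal_suminf_square_le:
  fixes a t :: "nat \<Rightarrow> real"
  assumes a: "a sums S" and t: "\<And>j. 0 < t j" "summable t"
  shows "ennreal (S\<^sup>2) \<le> ennreal (suminf t) * (\<Sum>j. ennreal ((a j)\<^sup>2 / t j))"
proof -
  have part: "ennreal ((\<Sum>j<m. a j)\<^sup>2) \<le> ennreal (suminf t) * (\<Sum>j. ennreal ((a j)\<^sup>2 / t j))" for m
  proof -
    have "(\<Sum>j<m. a j)\<^sup>2 = (\<Sum>j<m. sqrt (t j) * (a j / sqrt (t j)))\<^sup>2"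
      using t(1) by (simp add: less_imp_neq[THEN not_sym])
    also have "\<dots> \<le> (\<Sum>j<m. (sqrt (t j))\<^sup>2) * (\<Sum>j<m. (a j / sqrt (t j))\<^sup>2)"
      by (rule Cauchy_Schwarz_ineq_sum)
    also have "\<dots> = (\<Sum>j<m. t j) * (\<Sum>j<m. (a j)\<^sup>2 / t j)"
      using t(1) by (simp add: power_divide less_imp_le)
    also have "\<dots> \<le> suminf t * (\<Sum>j<m. (a j)\<^sup>2 / t j)"
      using t by (intro mult_right_mono sum_le_suminf sum_nonneg) (auto simp: less_imp_le)
    finally have "ennreal ((\<Sum>j<m. a j)\<^sup>2) \<le> ennreal (suminf t * (\<Sum>j<m. (a j)\<^sup>2 / t j))"
      by (rule ennreal_leI)
    also have "\<dots> = ennreal (suminf t) * (\<Sum>j<m. ennreal ((a j)\<^sup>2 / t j))"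
      using t by (subst ennreal_mult) (auto intro!: suminf_nonneg sum_nonneg simp: less_imp_le sum_ennreal)
    also have "\<dots> \<le> ennreal (suminf t) * (\<Sum>j. ennreal ((a j)\<^sup>2 / t j))"
      by (intro mult_left_mono sum_le_suminf) auto
    finally show ?thesis .
  qed
  have "(\<lambda>m. \<Sum>j<m. a j) \<longlonglongrightarrow> S" using a by (simp add: sums_def)
  then have "(\<lambda>m. ennreal ((\<Sum>j<m. a j)\<^sup>2)) \<longlonglongrightarrow> ennreal (S\<^sup>2)"
    by (intro tendsto_ennrealI tendsto_power)
  then show ?thesis
    by (rule LIMSEQ_le_const2) (use part in auto)
qed

section \<open>Tail functions are almost surely constant\<close>

context path_space
begin

lemma emeasure_PM_UNIV [simp]: "emeasure PM UNIV = 1"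
  using PP.emeasure_space_1 by simp

lemma measure_PM_UNIV [simp]: "measure PM UNIV = 1"
  using PP.prob_space by simp

text \<open>Conditioning on a tail event does not change the probability of boxes, hence not the
  measure.\<close>
lemma tail_zero_one:
  assumes A [measurable]: "A \<in> sets PM" and tail: "\<And>m::nat. past_dep (- int m) (\<lambda>x. x \<in> A)"
  shows "emeasure PM A = 0 \<or> emeasure PM A = 1"
proof (rule disjCI)
  assume "emeasure PM A \<noteq> 1"
  show "emeasure PM A = 0"
  proof (rule ccontr)
    assume nz: "emeasure PM A \<noteq> 0"
    have fin: "emeasure PM A \<noteq> \<infinity>" by simp
    define Q where "Q = density PM (\<lambda>x. indicator A x / emeasure PM A)"
    have Q: "emeasure Q B = emeasure PM (A \<inter> B) / emeasure PM A" if [measurable]: "B \<in> sets PM" for B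
    proof -
      have "emeasure Q B = (\<integral>\<^sup>+x. indicator (A \<inter> B) x / emeasure PM A \<partial>PM)"
        unfolding Q_def by (subst emeasure_density) (auto intro!: nn_integral_cong simp: indicator_def)
      also have "\<dots> = emeasure PM (A \<inter> B) / emeasure PM A"
        by (subst nn_integral_divide) auto
      finally show ?thesis .
    qed
    have "Q = PM"
    proof (rule PM_eqI)
      show "sets Q = sets PM" by (simp add: Q_def)
      fix J :: "int set" and F :: "int \<Rightarrow> real set"
      assume J: "finite J" "\<And>j. j \<in> J \<Longrightarrow> F j \<in> sets borel"
      define B where "B = {x. \<forall>j\<in>J. x j \<in> F j}"
      have B [measurable]: "B \<in> sets PM" unfolding B_def using J by (rule box_sets)
      \<comment> \<open>A time before every index of the box: after gluing at
        \<open>- int m\<close>, the box constrains only \<open>y\<close> while the tail event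
        constrains only \<open>x\<close>, which gives independence.\<close>
      obtain m :: nat where m: "\<And>j. j \<in> J \<Longrightarrow> - int m < j"
      proof
        fix j assume "j \<in> J"
        then have "\<bar>j\<bar> \<le> (\<Sum>j\<in>J. \<bar>j\<bar>)" using J(1) by (intro member_le_sum) auto
        then show "- int (nat (1 + (\<Sum>j\<in>J. \<bar>j\<bar>))) < j" by linarith
      qed
      have "emeasure PM (A \<inter> B) = (\<integral>\<^sup>+x. indicator A x * indicator B x \<partial>PM)"
        by (simp flip: nn_integral_indicator add: indicator_inter_arith)
      also have "\<dots> = (\<integral>\<^sup>+x. \<integral>\<^sup>+y. indicator A (glue (- int m) x y) * indicator B (glue (- int m) x y) \<partial>PM \<partial>PM)"
        by (rule nn_integral_glue[symmetric]) measurable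
      also have "\<dots> = (\<integral>\<^sup>+x. \<integral>\<^sup>+y. indicator A x * indicator B y \<partial>PM \<partial>PM)"
      proof (intro nn_integral_cong arg_cong2[where f="(*)"])
        fix x y
        show "indicator A (glue (- int m) x y) = (indicator A x :: ennreal)"
          using past_depD[OF tail[of m]] by (simp add: indicator_def)
        show "indicator B (glue (- int m) x y) = (indicator B y :: ennreal)"
          using m by (force simp: B_def glue_def indicator_def)
      qed
      also have "\<dots> = emeasure PM A * emeasure PM B"
        by (simp add: nn_integral_cmult nn_integral_multc)
      finally have "emeasure Q B = emeasure PM B"
        using nz fin by (simp add: Q mult.commute[of "emeasure PM A"] ennreal_mult_divide_eq)
      then show "emeasure Q {x. \<forall>j\<in>J. x j \<in> F j} = (\<Prod>j\<in>J. emeasure D (F j))"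
        using emeasure_PM_box[OF J(1), of F] J(2) by (simp add: B_def)
    qed
    then have "emeasure PM A = emeasure PM A / emeasure PM A"
      using Q[OF A] by simp
    also have "\<dots> = 1" using nz fin by (simp add: ennreal_divide_self less_top[symmetric])
    finally show False using \<open>emeasure PM A \<noteq> 1\<close> by simp
  qed
qed

text \<open>By the zero-one law every level event has probability 0 or 1. The constant is the point
  where this probability jumps, the infimum of the almost sure upper bounds.\<close>

lemma tail_measurable_const:
  fixes f :: "_ \<Rightarrow> real"
  assumes [measurable]: "f \<in> borel_measurable PM" and tail: "\<And>m::nat. past_dep (- int m) f"
  shows "\<exists>c. AE x in PM. f x = c"
proof -
  have zo: "(AE x in PM. f x \<le> r) \<or> (AE x in PM. r < f x)" for r
  proof -
    have "{x\<in>space PM. f x \<le> r} \<in> sets PM" by measurable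
    then have ev: "{x. f x \<le> r} \<in> sets PM" by simp
    have "emeasure PM {x\<in>space PM. f x \<le> r} = 0 \<or> emeasure PM {x\<in>space PM. f x \<le> r} = 1"
    proof (rule tail_zero_one)
      show "past_dep (- int m) (\<lambda>x. x \<in> {x \<in> space PM. f x \<le> r})" for m
        using tail[of m] by (simp add: past_dep_def)
    qed measurable
    then show ?thesis
    proof
      assume "emeasure PM {x\<in>space PM. f x \<le> r} = 0"
      then have "AE x in PM. \<not> f x \<le> r"
        by (intro AE_I'[of "{x\<in>space PM. f x \<le> r}"]) (auto simp: null_sets_def ev)
      then show ?thesis by (simp add: not_le)
    next
      assume "emeasure PM {x\<in>space PM. f x \<le> r} = 1"
      then have "AE x in PM. x \<in> {x\<in>space PM. f x \<le> r}"
        by (intro PP.AE_prob_1) (simp add: PP.emeasure_eq_measure)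
      then show ?thesis by simp
    qed
  qed
  define R where "R = {r. AE x in PM. f x \<le> r}"
  have up: "s \<in> R" if "r \<in> R" "r \<le> s" for r s
    using that by (auto simp: R_def elim!: eventually_mono)
  have "R \<noteq> {}"
  proof
    assume "R = {}"
    then have "AE x in PM. real n < f x" for n :: nat using zo by (auto simp: R_def)
    then have "AE x in PM. \<forall>n::nat. real n < f x" by (simp add: AE_all_countable)
    then have "AE x in PM. False"
      by eventually_elim (meson less_asym reals_Archimedean2)
    then show False by (simp add: PP.AE_False)
  qed
  have "bdd_below R"
  proof (rule ccontr)
    assume nb: "\<not> bdd_below R"
    have "- real n \<in> R" for n :: nat
    proof -
      from nb obtain r where "r \<in> R" "r < - real n" unfolding bdd_below_def by (meson not_le)
      then show ?thesis using up by auto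
    qed
    then have "AE x in PM. \<forall>n::nat. f x \<le> - real n" by (simp add: AE_all_countable R_def)
    then have "AE x in PM. False"
    proof eventually_elim
      case (elim x)
      obtain n :: nat where "- f x < real n" using reals_Archimedean2 by blast
      with elim[rule_format, of n] show False by simp
    qed
    then show False by (simp add: PP.AE_False)
  qed
  define c where "c = Inf R"
  have "AE x in PM. f x \<le> c + 1 / real (Suc n)" for n
  proof -
    obtain r where "r \<in> R" "r < c + 1 / real (Suc n)"
      using cInf_lessD[OF \<open>R \<noteq> {}\<close>, of "c + 1 / real (Suc n)"] by (auto simp: c_def)
    then have "c + 1 / real (Suc n) \<in> R" using up by auto
    then show ?thesis by (simp add: R_def)
  qed
  then have "AE x in PM. \<forall>n. f x \<le> c + 1 / real (Suc n)" by (simp add: AE_all_countable)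
  moreover have "AE x in PM. c - 1 / real (Suc n) < f x" for n
  proof -
    have "c - 1 / real (Suc n) \<notin> R"
    proof
      assume "c - 1 / real (Suc n) \<in> R"
      then have "c \<le> c - 1 / real (Suc n)" unfolding c_def by (rule cInf_lower) fact
      then show False by simp
    qed
    then show ?thesis using zo by (auto simp: R_def)
  qed
  then have "AE x in PM. \<forall>n. c - 1 / real (Suc n) < f x" by (simp add: AE_all_countable)
  ultimately have "AE x in PM. f x = c"
  proof eventually_elim
    case (elim x)
    have "f x \<le> c"
      by (rule field_le_epsilon) (metis elim(1) nat_approx_posE add_left_mono less_imp_le order_trans)
    moreover have "c \<le> f x"
    proof (rule field_le_epsilon)
      fix e :: real assume "0 < e"
      then obtain n where "1 / real (Suc n) < e" using nat_approx_posE by blast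
      with elim(2)[rule_format, of n] show "c \<le> f x + e" by linarith
    qed
    ultimately show ?case by simp
  qed
  then show ?thesis by blast
qed

section \<open>Orthogonality of stationary martingale differences\<close>

lemma integrable_mult_of_squares:
  fixes u v :: "_ \<Rightarrow> real"
  assumes [measurable]: "u \<in> borel_measurable N" "v \<in> borel_measurable N"
    and "integrable N (\<lambda>x. (u x)\<^sup>2)" "integrable N (\<lambda>x. (v x)\<^sup>2)"
  shows "integrable N (\<lambda>x. u x * v x)"
proof (rule Bochner_Integration.integrable_bound)
  show "integrable N (\<lambda>x. (u x)\<^sup>2 + (v x)\<^sup>2)" using assms by simp
  have "\<bar>a * b\<bar> \<le> a\<^sup>2 + b\<^sup>2" for a b :: real
    using sum_squares_bound[of "\<bar>a\<bar>" "\<bar>b\<bar>"] abs_ge_zero[of "a * b"]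
    by (simp only: abs_mult power2_abs mult.assoc)
  then show "AE x in N. norm (u x * v x) \<le> norm ((u x)\<^sup>2 + (v x)\<^sup>2)" by simp
qed measurable

text \<open>\<open>u\<close> does not see the resampled coordinates, so it leaves the inner
  integral, and what remains there is zero.\<close>

lemma martingale_difference_orthogonal:
  fixes u v :: "_ \<Rightarrow> real"
  assumes [measurable]: "u \<in> borel_measurable PM" "v \<in> borel_measurable PM"
    and sq: "integrable PM (\<lambda>x. (u x)\<^sup>2)" "integrable PM (\<lambda>x. (v x)\<^sup>2)"
    and u: "past_dep k u" and v: "AE x in PM. (\<integral>y. v (glue k x y) \<partial>PM) = 0"
  shows "(\<integral>x. u x * v x \<partial>PM) = 0"
proof -
  have "(\<integral>x. u x * v x \<partial>PM) = (\<integral>x. \<integral>y. u (glue k x y) * v (glue k x y) \<partial>PM \<partial>PM)"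
    by (rule integral_glue[symmetric]) (rule integrable_mult_of_squares; fact)
  also have "\<dots> = (\<integral>x. u x * (\<integral>y. v (glue k x y) \<partial>PM) \<partial>PM)"
    by (simp add: past_depD[OF u])
  also have "\<dots> = (\<integral>x. 0 \<partial>PM)"
    using v by (intro integral_cong_AE) auto
  finally show ?thesis by simp
qed

lemma martingale_difference_sum_square:
  fixes v :: "_ \<Rightarrow> real"
  assumes [measurable]: "v \<in> borel_measurable PM" and sq: "integrable PM (\<lambda>x. (v x)\<^sup>2)"
    and v: "past_dep 0 v" "AE x in PM. (\<integral>y. v (glue (-1) x y) \<partial>PM) = 0"
  shows "integrable PM (\<lambda>x. (\<Sum>i<n. v (seq_shift (int i) x))\<^sup>2) \<and>
    (\<integral>x. (\<Sum>i<n. v (seq_shift (int i) x))\<^sup>2 \<partial>PM) = real n * (\<integral>x. (v x)\<^sup>2 \<partial>PM)"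
proof (induction n)
  case (Suc n)
  define S where "S = (\<lambda>x. \<Sum>i<n. v (seq_shift (int i) x))"
  have [measurable]: "S \<in> borel_measurable PM" unfolding S_def by measurable
  have S: "integrable PM (\<lambda>x. (S x)\<^sup>2)" "(\<integral>x. (S x)\<^sup>2 \<partial>PM) = real n * (\<integral>x. (v x)\<^sup>2 \<partial>PM)"
    using Suc by (auto simp: S_def)
  have vn: "integrable PM (\<lambda>x. (v (seq_shift (int n) x))\<^sup>2)"
    by (rule integrable_shift[of "\<lambda>x. (v x)\<^sup>2"]) fact
  have int: "integrable PM (\<lambda>x. S x * v (seq_shift (int n) x))"
    by (rule integrable_mult_of_squares) (use S vn in measurable)
  \<comment> \<open>Shifting back by \<open>n\<close> turns the newest difference into
    \<open>v\<close> itself and pushes the earlier sum into the coordinates up to \<open>-1\<close>,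
    where orthogonality applies.\<close>
  have dep: "past_dep (-1) (\<lambda>x. S (seq_shift (- int n) x))"
    unfolding past_dep_def
  proof (intro allI)
    fix x y :: "int \<Rightarrow> real"
    show "S (seq_shift (- int n) (glue (-1) x y)) = S (seq_shift (- int n) x)"
      unfolding S_def shift_shift
    proof (rule sum.cong)
      fix i assume "i \<in> {..<n}"
      then have "past_dep (-1) (\<lambda>x. v (seq_shift (int i + - int n) x))"
        by (intro past_dep_mono[OF past_dep_shift[OF v(1)]]) auto
      then show "v (seq_shift (int i + - int n) (glue (-1) x y)) = v (seq_shift (int i + - int n) x)"
        by (rule past_depD)
    qed simp
  qed
  have "(\<integral>x. S x * v (seq_shift (int n) x) \<partial>PM)
      = (\<integral>x. S (seq_shift (- int n) x) * v x \<partial>PM)"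
    using integral_shift[of "\<lambda>x. S (seq_shift (- int n) x) * v x" "int n"] by simp
  also have "\<dots> = 0"
    by (rule martingale_difference_orthogonal[OF _ _ _ sq dep v(2)])
       (use integrable_shift[OF S(1), of "- int n"] in measurable)
  finally have 0: "(\<integral>x. S x * v (seq_shift (int n) x) \<partial>PM) = 0" .
  have eq: "(\<Sum>i<Suc n. v (seq_shift (int i) x))\<^sup>2
     = (S x)\<^sup>2 + 2 * (S x * v (seq_shift (int n) x)) + (v (seq_shift (int n) x))\<^sup>2" for x
    by (simp add: S_def power2_sum)
  have "(\<integral>x. (v (seq_shift (int n) x))\<^sup>2 \<partial>PM) = (\<integral>x. (v x)\<^sup>2 \<partial>PM)"
    by (rule integral_shift[of "\<lambda>x. (v x)\<^sup>2"]) measurable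
  then show ?case
    unfolding eq using S vn int 0 by (simp add: distrib_right)
qed simp

section \<open>Projections as differences of resampling integrals\<close>

lemma AE_CE_eq_integral:
  assumes "integrable PM f"
  shows "AE x in PM. CE k f x = (\<integral>y. f (glue k x y) \<partial>PM)"
  using AE_integrable_glue[OF assms, of k] by eventually_elim (rule CE_eq_integral)

lemma integrable_CE:
  assumes f: "integrable PM f"
  shows "integrable PM (CE k f)" "(\<integral>x. CE k f x \<partial>PM) = (\<integral>x. f x \<partial>PM)"
proof -
  have [measurable]: "f \<in> borel_measurable PM" using f by auto
  have "integrable PM (\<lambda>x. \<integral>y. f (glue k x y) \<partial>PM)"
    using PPP.integrable_fst'[OF integrable_glue[OF f]] by simp
  then show "integrable PM (CE k f)"
    by (subst integrable_cong_AE[OF _ _ AE_CE_eq_integral[OF f]]) auto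
  show "(\<integral>x. CE k f x \<partial>PM) = (\<integral>x. f x \<partial>PM)"
    by (subst integral_glue[OF f, of k, symmetric], rule integral_cong_AE[OF _ _ AE_CE_eq_integral[OF f]]) auto
qed

text \<open>The tower property on almost every fibre: resampling after \<open>k\<close> and then
  again after the later time \<open>l\<close> has the same effect as resampling once after
  \<open>k\<close>.\<close>

lemma integral_CE_glue:
  assumes f: "integrable PM f" and kl: "k \<le> l"
  shows "AE x in PM. (\<integral>y. CE l f (glue k x y) \<partial>PM) = (\<integral>y. f (glue k x y) \<partial>PM)"
proof -
  have [measurable]: "f \<in> borel_measurable PM" using f by auto
  show ?thesis
    using AE_integrable_glue[OF f, of k] AE_glue[OF AE_CE_eq_integral[OF f, of l], of k]
  proof eventually_elim
    case (elim x)
    have "(\<integral>y. CE l f (glue k x y) \<partial>PM) = (\<integral>y. \<integral>z. f (glue k x (glue l y z)) \<partial>PM \<partial>PM)"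
      using elim(2) by (intro integral_cong_AE) (auto simp: glue_glue_right[OF kl])
    also have "\<dots> = (\<integral>y. f (glue k x y) \<partial>PM)"
      by (rule integral_glue[OF elim(1)])
    finally show ?case .
  qed
qed

lemma martingale_difference_CE:
  assumes f: "integrable PM f"
  shows "AE x in PM. (\<integral>y. CE 0 f (glue (-1) x y) - CE (-1) f (glue (-1) x y) \<partial>PM) = 0"
  using integral_CE_glue[OF f, of "-1" 0, simplified] AE_CE_eq_integral[OF f, of "-1"]
    AE_integrable_glue[OF integrable_CE(1)[OF f, of 0], of "-1"]
proof eventually_elim
  case (elim x)
  then show ?case
    by (simp add: past_depD[OF past_dep_CE] PP.prob_space)
qed


text \<open>Integrability of \<open>\<Xi>\<close> is a conclusion: the conditional expectations given the remote past
  converge because the projections are summable, their limit is a tail function and so a constant,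
  and \<open>\<Xi>\<close> differs from it by the integrable sum of the projections.  The weights \<open>t\<close> replace
  Minkowski's inequality by the Cauchy--Schwarz inequality, which needs no square roots of
  integrals.\<close>
lemma variance_bound:
  fixes \<Xi> :: "(int \<Rightarrow> real) \<Rightarrow> real" and t :: "nat \<Rightarrow> real"
  defines "\<Psi> \<equiv> \<lambda>j::nat. \<lambda>x. CE 0 (\<lambda>z. \<Xi> (seq_shift (int j) z)) x - CE (-1) (\<lambda>z. \<Xi> (seq_shift (int j) z)) x"
  defines "B \<equiv> \<Sum>j. \<integral>\<^sup>+x. ennreal ((\<Psi> j x)\<^sup>2 / t j) \<partial>PM"
  assumes \<Xi> [measurable]: "\<Xi> \<in> borel_measurable PM" and dep: "past_dep 0 \<Xi>"
    and t: "\<And>j. 0 < t j" "summable t" and B: "B < \<infinity>"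
  shows "integrable PM \<Xi>"
    and "(\<integral>\<^sup>+x. ennreal ((\<Sum>i<n. \<Xi> (seq_shift (int i) x) - (\<integral>x. \<Xi> x \<partial>PM))\<^sup>2) \<partial>PM)
          \<le> of_nat n * (ennreal (suminf t) * B)"
proof -
  have [measurable]: "\<Psi> j \<in> borel_measurable PM" for j unfolding \<Psi>_def by measurable
  \<comment> \<open>Shifted back by \<open>j\<close>, the time-0 projection of the
    \<open>j\<close>-th future value becomes the projection of \<open>\<Xi>\<close> at time
    \<open>-j\<close>. In this form consecutive terms telescope.\<close>
  define \<psi> where "\<psi> = (\<lambda>j x. \<Psi> j (seq_shift (- int j) x))"
  have [measurable]: "\<psi> j \<in> borel_measurable PM" for j unfolding \<psi>_def by measurable
  have \<psi>: "\<psi> j x = CE (- int j) \<Xi> x - CE (- int (Suc j)) \<Xi> x" for j x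
    by (simp add: \<psi>_def \<Psi>_def CE_shift algebra_simps)
  have telescope: "(\<Sum>j<m. \<psi> j x) = \<Xi> x - CE (- int m) \<Xi> x" for m x
    by (induction m) (simp_all add: \<psi> CE_past[OF dep])
  define W where "W x = (\<Sum>j. ennreal \<bar>\<psi> j x\<bar>)" for x
  have [measurable]: "W \<in> borel_measurable PM" unfolding W_def by measurable
  \<comment> \<open>since \<open>|a| \<le> t + a\<^sup>2 / t\<close> for \<open>t > 0\<close>\<close>
  have "(\<integral>\<^sup>+x. ennreal \<bar>\<psi> j x\<bar> \<partial>PM) \<le> ennreal (t j) + (\<integral>\<^sup>+x. ennreal ((\<Psi> j x)\<^sup>2 / t j) \<partial>PM)" for j
  proof -
    have "\<bar>a\<bar> \<le> t j + a\<^sup>2 / t j" for a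
    proof -
      have "2 * (\<bar>a\<bar> * t j) \<le> t j * t j + a\<^sup>2"
        using sum_squares_bound[of "\<bar>a\<bar>" "t j"] by (simp add: power2_eq_square)
      then have "\<bar>a\<bar> * t j \<le> t j * t j + a\<^sup>2"
        using mult_nonneg_nonneg[of "\<bar>a\<bar>" "t j"] t(1)[of j] by linarith
      then show ?thesis using t(1)[of j] by (simp add: field_simps)
    qed
    then have "(\<integral>\<^sup>+x. ennreal \<bar>\<Psi> j x\<bar> \<partial>PM) \<le> (\<integral>\<^sup>+x. ennreal (t j) + ennreal ((\<Psi> j x)\<^sup>2 / t j) \<partial>PM)"
      using t(1)[of j] by (intro nn_integral_mono) (simp flip: ennreal_plus add: ennreal_leI less_imp_le)
    also have "\<dots> = ennreal (t j) + (\<integral>\<^sup>+x. ennreal ((\<Psi> j x)\<^sup>2 / t j) \<partial>PM)"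
      using PP.emeasure_space_1 by (subst nn_integral_add) simp_all
    also have "(\<integral>\<^sup>+x. ennreal \<bar>\<Psi> j x\<bar> \<partial>PM) = (\<integral>\<^sup>+x. ennreal \<bar>\<psi> j x\<bar> \<partial>PM)"
      unfolding \<psi>_def by (rule nn_integral_shift[symmetric]) measurable
    finally show ?thesis .
  qed
  then have "(\<integral>\<^sup>+x. W x \<partial>PM) \<le> (\<Sum>j. ennreal (t j) + (\<integral>\<^sup>+x. ennreal ((\<Psi> j x)\<^sup>2 / t j) \<partial>PM))"
    unfolding W_def by (subst nn_integral_suminf) (auto intro!: suminf_le)
  also have "\<dots> = ennreal (suminf t) + B"
    unfolding B_def using t by (subst suminf_add[symmetric]) (auto simp: suminf_ennreal2 less_imp_le)
  also have "\<dots> < \<infinity>" using B by simp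
  finally have Wfin: "(\<integral>\<^sup>+x. W x \<partial>PM) < \<infinity>" .
  then have AEW: "AE x in PM. W x \<noteq> \<infinity>" by (intro nn_integral_PInf_AE) auto
  have summ: "summable (\<lambda>j. \<bar>\<psi> j x\<bar>)" "ennreal (\<Sum>j. \<bar>\<psi> j x\<bar>) = W x" if "W x \<noteq> \<infinity>" for x
  proof -
    show "summable (\<lambda>j. \<bar>\<psi> j x\<bar>)" using that by (intro summable_suminf_not_top) (auto simp: W_def)
    then show "ennreal (\<Sum>j. \<bar>\<psi> j x\<bar>) = W x" by (simp add: W_def suminf_ennreal2)
  qed

  define Y where "Y x = lim (\<lambda>m. CE (- int m) \<Xi> x)" for x
  have [measurable]: "Y \<in> borel_measurable PM" unfolding Y_def by measurable
  \<comment> \<open>The limit only sees the terms with index at least \<open>m\<close>, and each of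
    these depends on coordinates up to \<open>- int m\<close>.\<close>
  have "past_dep (- int m) Y" for m
    unfolding past_dep_def
  proof (intro allI)
    fix x y
    have "eventually (\<lambda>k. CE (- int k) \<Xi> (glue (- int m) x y) = CE (- int k) \<Xi> x) sequentially"
      using eventually_ge_at_top[of m]
      by eventually_elim (rule past_depD[OF past_dep_mono[OF past_dep_CE]], simp)
    then have "((\<lambda>k. CE (- int k) \<Xi> (glue (- int m) x y)) \<longlonglongrightarrow> L) \<longleftrightarrow> ((\<lambda>k. CE (- int k) \<Xi> x) \<longlonglongrightarrow> L)" for L
      by (rule tendsto_cong)
    then show "Y (glue (- int m) x y) = Y x" by (simp add: Y_def lim_def)
  qed
  then obtain c where c: "AE x in PM. Y x = c"
    using tail_measurable_const[of Y] by auto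
  have main: "AE x in PM. W x \<noteq> \<infinity> \<and> (\<lambda>j. \<psi> j x) sums (\<Xi> x - c) \<and> (\<lambda>m. CE (- int m) \<Xi> x) \<longlonglongrightarrow> c"
    using AEW c
  proof eventually_elim
    case (elim x)
    have "summable (\<lambda>j. \<psi> j x)" using summ(1)[OF elim(1)] by (rule summable_rabs_cancel)
    then have "(\<lambda>m. \<Xi> x - CE (- int m) \<Xi> x) \<longlonglongrightarrow> (\<Sum>j. \<psi> j x)"
      by (simp add: telescope[symmetric] summable_LIMSEQ)
    from tendsto_diff[OF tendsto_const[of "\<Xi> x"] this]
    have *: "(\<lambda>m. CE (- int m) \<Xi> x) \<longlonglongrightarrow> \<Xi> x - (\<Sum>j. \<psi> j x)" by simp
    then have "Y x = \<Xi> x - (\<Sum>j. \<psi> j x)" unfolding Y_def by (rule limI)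
    then have "(\<Sum>j. \<psi> j x) = \<Xi> x - c" using elim(2) by simp
    with * \<open>summable (\<lambda>j. \<psi> j x)\<close> show ?case using elim(1) by (auto simp: sums_iff)
  qed
  \<comment> \<open>One envelope used twice: it makes \<open>\<Xi> - c\<close> integrable, and it
    dominates the convergence that identifies \<open>c\<close> as the mean of
    \<open>\<Xi>\<close>.\<close>
  have absW: "AE x in PM. \<forall>m. ennreal \<bar>CE (- int m) \<Xi> x - \<Xi> x\<bar> \<le> W x"
    using AEW
  proof eventually_elim
    case (elim x)
    show ?case
    proof
      fix m
      have "\<bar>CE (- int m) \<Xi> x - \<Xi> x\<bar> = \<bar>\<Sum>j<m. \<psi> j x\<bar>" by (simp add: telescope)
      also have "\<dots> \<le> (\<Sum>j<m. \<bar>\<psi> j x\<bar>)" by (rule sum_abs)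
      also have "\<dots> \<le> (\<Sum>j. \<bar>\<psi> j x\<bar>)" by (intro sum_le_suminf summ elim) auto
      finally show "ennreal \<bar>CE (- int m) \<Xi> x - \<Xi> x\<bar> \<le> W x"
        using summ(2)[OF elim] by (metis ennreal_leI)
    qed
  qed
  have intW: "integrable PM (\<lambda>x. enn2real (W x))"
    using Wfin AEW by (intro integrableI_nn_integral_finite[where x="enn2real (\<integral>\<^sup>+x. W x \<partial>PM)"])
      (auto intro!: nn_integral_cong_AE simp: less_top elim!: eventually_mono)
  show int\<Xi>: "integrable PM \<Xi>"
  proof -
    have "integrable PM (\<lambda>x. \<Xi> x - c)"
    proof (rule Bochner_Integration.integrable_bound[OF intW])
      show "AE x in PM. norm (\<Xi> x - c) \<le> norm (enn2real (W x))"
        using main absW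
      proof eventually_elim
        case (elim x)
        then have "\<bar>CE (- int m) \<Xi> x - \<Xi> x\<bar> \<le> enn2real (W x)" for m
          by (metis ennreal_le_iff2 ennreal_enn2real infinity_ennreal_def less_top enn2real_nonneg enn2real_leI enn2real_mono enn2real_ennreal abs_ge_zero)
        moreover have "(\<lambda>m. \<bar>CE (- int m) \<Xi> x - \<Xi> x\<bar>) \<longlonglongrightarrow> \<bar>c - \<Xi> x\<bar>"
          using elim by (intro tendsto_intros) auto
        ultimately have "\<bar>c - \<Xi> x\<bar> \<le> enn2real (W x)"
          by (intro LIMSEQ_le_const2) auto
        then show ?case by (simp add: abs_minus_commute)
      qed
    qed measurable
    then have "integrable PM (\<lambda>x. (\<Xi> x - c) + c)" by (intro Bochner_Integration.integrable_add) auto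
    then show ?thesis by simp
  qed
  have c_eq: "c = (\<integral>x. \<Xi> x \<partial>PM)"
  proof -
    have "(\<lambda>m. \<integral>x. CE (- int m) \<Xi> x \<partial>PM) \<longlonglongrightarrow> (\<integral>x. c \<partial>PM)"
    proof (rule integral_dominated_convergence[where w="\<lambda>x. enn2real (W x) + \<bar>\<Xi> x\<bar>"])
      show "integrable PM (\<lambda>x. enn2real (W x) + \<bar>\<Xi> x\<bar>)" using intW int\<Xi> by simp
      show "AE x in PM. (\<lambda>m. CE (- int m) \<Xi> x) \<longlonglongrightarrow> c" using main by eventually_elim simp
      show "AE x in PM. norm (CE (- int m) \<Xi> x) \<le> enn2real (W x) + \<bar>\<Xi> x\<bar>" for m
        using absW AEW
      proof eventually_elim
        case (elim x)
        then have "\<bar>CE (- int m) \<Xi> x - \<Xi> x\<bar> \<le> enn2real (W x)"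
          by (metis enn2real_mono enn2real_ennreal abs_ge_zero infinity_ennreal_def less_top)
        then show ?case by simp
      qed
    qed measurable
    then show ?thesis
      using integrable_CE(2)[OF int\<Xi>] by (simp add: PP.prob_space LIMSEQ_const_iff)
  qed
  \<comment> \<open>Interchanging the sums over \<open>i\<close> and \<open>j\<close>: for fixed
    \<open>j\<close> the inner sum is, up to a shift, a sum of \<open>n\<close> stationary
    martingale differences, whose second moment is \<open>n\<close> times that of
    \<open>\<Psi> j\<close>.\<close>
  define U where "U j x = (\<Sum>i<n. \<Psi> j (seq_shift (int i) x))" for j x
  have [measurable]: "U j \<in> borel_measurable PM" for j unfolding U_def by measurable
  have "AE x in PM. \<forall>i. (\<lambda>j. \<psi> j (seq_shift (int i) x)) sums (\<Xi> (seq_shift (int i) x) - c)"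
    unfolding AE_all_countable
  proof
    fix i :: nat
    have "AE x in PM. (\<lambda>j. \<psi> j x) sums (\<Xi> x - c)" using main by eventually_elim simp
    then show "AE x in PM. (\<lambda>j. \<psi> j (seq_shift (int i) x)) sums (\<Xi> (seq_shift (int i) x) - c)"
      by (rule AE_shift)
  qed
  then have sq: "AE x in PM. ennreal ((\<Sum>i<n. \<Xi> (seq_shift (int i) x) - c)\<^sup>2)
      \<le> ennreal (suminf t) * (\<Sum>j. ennreal ((U j (seq_shift (- int j) x))\<^sup>2 / t j))"
  proof eventually_elim
    case (elim x)
    have "(\<lambda>j. \<Sum>i<n. \<psi> j (seq_shift (int i) x)) sums (\<Sum>i<n. \<Xi> (seq_shift (int i) x) - c)"
      using elim by (intro sums_sum) auto
    moreover have "(\<Sum>i<n. \<psi> j (seq_shift (int i) x)) = U j (seq_shift (- int j) x)" for j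
      by (simp add: \<psi>_def U_def add.commute)
    ultimately show ?case
      using ennreal_suminf_square_le[OF _ t, of "\<lambda>j. U j (seq_shift (- int j) x)"] by simp
  qed
  have U: "(\<integral>\<^sup>+x. ennreal ((U j (seq_shift (- int j) x))\<^sup>2 / t j) \<partial>PM)
      \<le> of_nat n * (\<integral>\<^sup>+x. ennreal ((\<Psi> j x)\<^sup>2 / t j) \<partial>PM)" for j
  proof -
    have "(\<integral>\<^sup>+x. ennreal ((\<Psi> j x)\<^sup>2 / t j) \<partial>PM) \<le> B"
      unfolding B_def using sum_le_suminf[of "\<lambda>j. \<integral>\<^sup>+x. ennreal ((\<Psi> j x)\<^sup>2 / t j) \<partial>PM" "{j}"] by simp
    then have "integrable PM (\<lambda>x. (\<Psi> j x)\<^sup>2 / t j)"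
      using B t(1)[of j] by (intro integrableI_bounded) (auto simp: less_imp_le)
    then have "integrable PM (\<lambda>x. (\<Psi> j x)\<^sup>2 / t j * t j)" by (rule integrable_mult_left)
    then have int: "integrable PM (\<lambda>x. (\<Psi> j x)\<^sup>2)" using t(1)[of j] by simp
    have d: "past_dep 0 (\<Psi> j)"
      using past_depD[OF past_dep_CE[of 0]] past_depD[OF past_dep_mono[OF past_dep_CE[of "-1"], of 0]]
      by (simp add: past_dep_def \<Psi>_def)
    have m: "AE x in PM. (\<integral>y. \<Psi> j (glue (-1) x y) \<partial>PM) = 0"
      unfolding \<Psi>_def by (rule martingale_difference_CE) (rule integrable_shift[OF int\<Xi>])
    note * = martingale_difference_sum_square[OF _ int d m, of n, folded U_def]
    have "(\<integral>\<^sup>+x. ennreal ((U j (seq_shift (- int j) x))\<^sup>2 / t j) \<partial>PM)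
        = (\<integral>\<^sup>+x. ennreal ((U j x)\<^sup>2 / t j) \<partial>PM)"
      by (rule nn_integral_shift) measurable
    also have "\<dots> = ennreal ((\<integral>x. (U j x)\<^sup>2 \<partial>PM) / t j)"
      using * t(1)[of j] by (subst nn_integral_eq_integral) (auto simp: less_imp_le)
    also have "\<dots> = ennreal (real n * (\<integral>x. (\<Psi> j x)\<^sup>2 / t j \<partial>PM))"
      using * by simp
    also have "\<dots> = of_nat n * (\<integral>\<^sup>+x. ennreal ((\<Psi> j x)\<^sup>2 / t j) \<partial>PM)"
      using int t(1)[of j] by (subst nn_integral_eq_integral) (auto simp: less_imp_le ennreal_of_nat_eq_real_of_nat simp flip: ennreal_mult)
    finally show ?thesis by simp
  qed
  have "(\<integral>\<^sup>+x. ennreal ((\<Sum>i<n. \<Xi> (seq_shift (int i) x) - c)\<^sup>2) \<partial>PM)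
    \<le> (\<integral>\<^sup>+x. ennreal (suminf t) * (\<Sum>j. ennreal ((U j (seq_shift (- int j) x))\<^sup>2 / t j)) \<partial>PM)"
    using sq by (rule nn_integral_mono_AE)
  also have "\<dots> = ennreal (suminf t) * (\<Sum>j. \<integral>\<^sup>+x. ennreal ((U j (seq_shift (- int j) x))\<^sup>2 / t j) \<partial>PM)"
    by (simp add: nn_integral_cmult nn_integral_suminf)
  also have "\<dots> \<le> ennreal (suminf t) * (\<Sum>j. of_nat n * (\<integral>\<^sup>+x. ennreal ((\<Psi> j x)\<^sup>2 / t j) \<partial>PM))"
    by (intro mult_left_mono suminf_le U) auto
  also have "\<dots> = of_nat n * (ennreal (suminf t) * B)"
    by (simp add: B_def mult.left_commute)
  finally show "(\<integral>\<^sup>+x. ennreal ((\<Sum>i<n. \<Xi> (seq_shift (int i) x) - (\<integral>x. \<Xi> x \<partial>PM))\<^sup>2) \<partial>PM)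
          \<le> of_nat n * (ennreal (suminf t) * B)"
    by (simp add: c_eq)
qed

end

section \<open>Moments of martingale sums of indicators\<close>

text \<open>Interpolation by cutting at \<open>s\<^sup>2 = A\<close>: below the cut the excess power
  over 2 is at most \<open>A powr (q/2 - 1)\<close>, above it the missing power to 4 is at most
  \<open>A powr (q/2 - 2)\<close>.\<close>

lemma powr_le_square_fourth:
  fixes s A q :: real
  assumes "0 < A" "2 < q" "q < 4"
  shows "\<bar>s\<bar> powr q \<le> A powr (q/2 - 1) * s\<^sup>2 + A powr (q/2 - 2) * s ^ 4"
proof (cases "s = 0")
  case False
  have s2: "s\<^sup>2 = \<bar>s\<bar> powr 2" and s4: "s ^ 4 = \<bar>s\<bar> powr 4"
    using False by (simp_all add: powr_numeral power_even_abs)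
  have nn: "0 \<le> A powr (q/2 - 1) * s\<^sup>2" "0 \<le> A powr (q/2 - 2) * s ^ 4"
    by (simp_all add: zero_le_even_power)
  show ?thesis
  proof (cases "\<bar>s\<bar> powr 2 \<le> A")
    case True
    have "\<bar>s\<bar> powr q = (\<bar>s\<bar> powr 2) powr (q/2 - 1) * \<bar>s\<bar> powr 2"
      by (simp only: powr_powr powr_add[symmetric]) (simp add: algebra_simps)
    also have "\<dots> \<le> A powr (q/2 - 1) * \<bar>s\<bar> powr 2"
      using True assms by (intro mult_right_mono powr_mono2) auto
    finally show ?thesis using nn unfolding s2[symmetric] by linarith
  next
    case gt: False
    have "\<bar>s\<bar> powr q = (\<bar>s\<bar> powr 2) powr (q/2 - 2) * \<bar>s\<bar> powr 4"
      by (simp only: powr_powr powr_add[symmetric]) (simp add: algebra_simps)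
    also have "\<dots> \<le> A powr (q/2 - 2) * \<bar>s\<bar> powr 4"
      using gt assms by (intro mult_right_mono powr_mono2') auto
    finally show ?thesis using nn unfolding s4[symmetric] by linarith
  qed
qed simp

text \<open>Models the event that the current observation lies in a fixed interval. Below,
  \<open>p\<close> is the conditional probability of the next occurrence, \<open>d\<close> the
  centred current occurrence, and \<open>S\<close> the resulting martingale.\<close>

locale binary_process = path_space D for D +
  fixes v :: "(int \<Rightarrow> real) \<Rightarrow> real"
  assumes v_meas [measurable]: "v \<in> borel_measurable PM"
    and v_past: "past_dep 0 v"
    and v01: "\<And>x. v x = 0 \<or> v x = 1"
begin

definition p :: "(int \<Rightarrow> real) \<Rightarrow> real" where
  "p x = (\<integral>y. v (seq_shift 1 (glue 0 x y)) \<partial>PM)"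

definition d :: "(int \<Rightarrow> real) \<Rightarrow> real" where
  "d x = v x - p (seq_shift (-1) x)"

definition S :: "nat \<Rightarrow> (int \<Rightarrow> real) \<Rightarrow> real" where
  "S n x = (\<Sum>i=1..n. d (seq_shift (int i) x))"

lemma p_meas [measurable]: "p \<in> borel_measurable PM"
  unfolding p_def by measurable

lemma d_meas [measurable]: "d \<in> borel_measurable PM"
  unfolding d_def by measurable

lemma S_meas [measurable]: "S n \<in> borel_measurable PM"
  unfolding S_def by measurable

lemma v_bounds: "0 \<le> v x" "v x \<le> 1"
  using v01[of x] by auto

lemma integrable_bounded:
  fixes f :: "_ \<Rightarrow> real"
  assumes "f \<in> borel_measurable PM" "\<And>x. \<bar>f x\<bar> \<le> B"
  shows "integrable PM f"
  using assms by (intro PP.integrable_const_bound[where B=B]) auto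

lemma p_bounds: "0 \<le> p x" "p x \<le> 1"
proof -
  show "0 \<le> p x" unfolding p_def by (intro integral_nonneg_AE) (simp add: v_bounds)
  have "p x \<le> (\<integral>y. 1 \<partial>PM)" unfolding p_def
    by (intro integral_mono integrable_bounded[where B=1]) (auto simp: v_bounds abs_le_iff intro: order_trans[of _ 0])
  then show "p x \<le> 1" by simp
qed

lemma p_past: "past_dep 0 p"
  by (simp add: past_dep_def p_def glue_glue_left)

lemma pp_past: "past_dep (-1) (\<lambda>x. p (seq_shift (-1) x))"
  using past_dep_shift[OF p_past, of "-1"] by simp

lemma d_past: "past_dep 0 d"
  using past_depD[OF v_past] past_depD[OF past_dep_mono[OF pp_past, of 0]]
  by (simp add: past_dep_def d_def)

lemma integral_v_glue: "(\<integral>y. v (glue (-1) x y) \<partial>PM) = p (seq_shift (-1) x)"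
proof -
  have "p (seq_shift (-1) x) = (\<integral>y. v (seq_shift 1 (glue 0 (seq_shift (-1) x) (seq_shift (-1) y))) \<partial>PM)"
    unfolding p_def by (rule integral_shift[symmetric]) measurable
  also have "\<dots> = (\<integral>y. v (glue (-1) x y) \<partial>PM)"
    by (simp add: shift_glue)
  finally show ?thesis by simp
qed

lemma d_bound: "\<bar>d x\<bar> \<le> 1"
  using v_bounds[of x] p_bounds[of "seq_shift (-1) x"] by (simp add: d_def abs_le_iff)

lemma integral_d_glue: "(\<integral>y. d (glue (-1) x y) \<partial>PM) = 0"
proof -
  have "integrable PM (\<lambda>y. v (glue (-1) x y))"
    by (rule integrable_bounded[where B=1]) (auto simp: v_bounds abs_le_iff intro: order_trans[of _ 0])
  then show ?thesis
    unfolding d_def by (simp add: past_depD[OF pp_past] integral_v_glue)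
qed

text \<open>The conditional variance of an indicator is \<open>p - p\<^sup>2\<close>, at most its
  conditional probability. This is what makes short intervals cheap.\<close>

lemma integral_d2_glue: "(\<integral>y. (d (glue (-1) x y))\<^sup>2 \<partial>PM) \<le> p (seq_shift (-1) x)"
proof -
  let ?p = "p (seq_shift (-1) x)"
  have v2: "(v z)\<^sup>2 = v z" for z using v01[of z] by auto
  have int: "integrable PM (\<lambda>y. v (glue (-1) x y))"
    by (rule integrable_bounded[where B=1]) (auto simp: v_bounds abs_le_iff intro: order_trans[of _ 0])
  have "(\<integral>y. (d (glue (-1) x y))\<^sup>2 \<partial>PM) = (\<integral>y. v (glue (-1) x y) - 2 * ?p * v (glue (-1) x y) + ?p\<^sup>2 \<partial>PM)"
    by (simp add: d_def past_depD[OF pp_past] power2_diff v2 algebra_simps)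
  also have "\<dots> = ?p - 2 * ?p * ?p + ?p\<^sup>2"
    using int by (simp add: integral_v_glue)
  also have "\<dots> \<le> ?p" by (simp add: power2_eq_square)
  finally show ?thesis .
qed

lemma integral_pp: "(\<integral>x. p (seq_shift (-1) x) \<partial>PM) = (\<integral>x. v x \<partial>PM)"
  by (subst integral_glue[of v "-1", symmetric])
     (auto simp: integral_v_glue v_bounds abs_le_iff intro!: integrable_bounded[where B=1] intro: order_trans[of _ 0])

lemma integral_p: "(\<integral>x. p x \<partial>PM) = (\<integral>x. v x \<partial>PM)"
  using integral_shift[of p "-1"] integral_pp by simp

text \<open>All terms linear in \<open>d\<close> vanish after resampling at \<open>-1\<close>, and a
  conditional second moment of \<open>d\<close> is replaced by \<open>p\<close>. In the fourth
  moment, \<open>p\<close> times \<open>u\<^sup>2\<close> is bounded by \<open>b\<close>, elsewhere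
  \<open>p\<close> integrates to the mean of \<open>v\<close>.\<close>

lemma one_step:
  fixes u :: "_ \<Rightarrow> real"
  assumes [measurable]: "u \<in> borel_measurable PM" and u: "past_dep (-1) u" and B: "\<And>x. \<bar>u x\<bar> \<le> B"
    and b: "AE x in PM. p x \<le> b"
  shows "(\<integral>x. (u x + d x)\<^sup>2 \<partial>PM) \<le> (\<integral>x. (u x)\<^sup>2 \<partial>PM) + (\<integral>x. v x \<partial>PM)"
    and "(\<integral>x. (u x + d x) ^ 4 \<partial>PM) \<le> (\<integral>x. (u x) ^ 4 \<partial>PM) + 8 * b * (\<integral>x. (u x)\<^sup>2 \<partial>PM) + 3 * (\<integral>x. v x \<partial>PM)"
proof -
  have B0: "0 \<le> B" using B[of undefined] by linarith
  have int: "integrable PM (\<lambda>x. u x ^ i * d x ^ j)" for i j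
  proof (rule integrable_bounded[where B="B ^ i * 1 ^ j"])
    show "\<bar>u x ^ i * d x ^ j\<bar> \<le> B ^ i * 1 ^ j" for x
      unfolding abs_mult power_abs using B[of x] d_bound[of x]
      by (intro mult_mono power_mono) auto
  qed measurable
  have intpp: "integrable PM (\<lambda>x. u x ^ i * p (seq_shift (-1) x))" for i
  proof (rule integrable_bounded[where B="B ^ i * 1"])
    show "\<bar>u x ^ i * p (seq_shift (-1) x)\<bar> \<le> B ^ i * 1" for x
      unfolding abs_mult power_abs using B[of x] p_bounds[of "seq_shift (-1) x"]
      by (intro mult_mono power_mono) auto
  qed measurable
  have cross: "(\<integral>x. u x ^ i * d x \<partial>PM) = 0" for i
  proof -
    have "(\<integral>x. u x ^ i * d x \<partial>PM) = (\<integral>x. \<integral>y. u (glue (-1) x y) ^ i * d (glue (-1) x y) \<partial>PM \<partial>PM)"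
      using int[of i 1] by (intro integral_glue[symmetric]) simp
    also have "\<dots> = 0" by (simp add: past_depD[OF u] integral_d_glue)
    finally show ?thesis .
  qed
  have quad: "(\<integral>x. u x ^ i * (d x)\<^sup>2 \<partial>PM) \<le> (\<integral>x. u x ^ i * p (seq_shift (-1) x) \<partial>PM)" if "even i" for i
  proof -
    have "(\<integral>x. u x ^ i * (d x)\<^sup>2 \<partial>PM) = (\<integral>x. \<integral>y. u (glue (-1) x y) ^ i * (d (glue (-1) x y))\<^sup>2 \<partial>PM \<partial>PM)"
      using int[of i 2] by (intro integral_glue[symmetric]) simp
    also have "\<dots> = (\<integral>x. u x ^ i * (\<integral>y. (d (glue (-1) x y))\<^sup>2 \<partial>PM) \<partial>PM)"
      by (simp add: past_depD[OF u])
    also have "\<dots> \<le> (\<integral>x. u x ^ i * p (seq_shift (-1) x) \<partial>PM)"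
    proof (rule integral_mono)
      show "integrable PM (\<lambda>x. u x ^ i * (\<integral>y. (d (glue (-1) x y))\<^sup>2 \<partial>PM))"
      proof (rule Bochner_Integration.integrable_bound[OF intpp[of i]])
        show "AE x in PM. norm (u x ^ i * (\<integral>y. (d (glue (-1) x y))\<^sup>2 \<partial>PM)) \<le> norm (u x ^ i * p (seq_shift (-1) x))"
          using integral_d2_glue p_bounds by (auto simp: abs_mult intro!: mult_left_mono)
      qed measurable
      show "u x ^ i * (\<integral>y. (d (glue (-1) x y))\<^sup>2 \<partial>PM) \<le> u x ^ i * p (seq_shift (-1) x)" for x
        using that by (intro mult_left_mono integral_d2_glue) (auto simp: zero_le_even_power)
    qed (rule intpp)
    finally show ?thesis .
  qed
  have "(\<integral>x. (u x + d x)\<^sup>2 \<partial>PM) = (\<integral>x. (u x)\<^sup>2 + 2 * (u x * d x) + (d x)\<^sup>2 \<partial>PM)"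
    by (simp add: power2_sum algebra_simps)
  also have "\<dots> = (\<integral>x. (u x)\<^sup>2 \<partial>PM) + (\<integral>x. (d x)\<^sup>2 \<partial>PM)"
    using int[of 2 0] int[of 1 1] int[of 0 2] cross[of 1] by simp
  also have "\<dots> \<le> (\<integral>x. (u x)\<^sup>2 \<partial>PM) + (\<integral>x. v x \<partial>PM)"
    using quad[of 0] integral_pp by simp
  finally show "(\<integral>x. (u x + d x)\<^sup>2 \<partial>PM) \<le> (\<integral>x. (u x)\<^sup>2 \<partial>PM) + (\<integral>x. v x \<partial>PM)" .
  \<comment> \<open>The term \<open>4 * a * e ^ 3\<close> is split by the arithmetic-geometric mean
    into \<open>2 * a\<^sup>2 * e\<^sup>2 + 2 * e ^ 4\<close>, and
    \<open>e ^ 4 \<le> e\<^sup>2\<close>. This gives the 8 = 6 + 2 and the 3 = 1 + 2.\<close>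
  have poly: "(a + e) ^ 4 \<le> a ^ 4 + 4 * (a ^ 3 * e) + 8 * (a\<^sup>2 * e\<^sup>2) + 3 * e\<^sup>2" if "\<bar>e\<bar> \<le> 1" for a e :: real
  proof -
    have e2: "e\<^sup>2 \<le> 1" using that by (simp add: abs_square_le_1)
    have "4 * (a * e ^ 3) \<le> 2 * (a\<^sup>2 * e\<^sup>2) + 2 * (e\<^sup>2 * e\<^sup>2)"
      using mult_left_mono[OF sum_squares_bound[of a e], of "2 * e\<^sup>2"]
      by (simp add: algebra_simps power2_eq_square power3_eq_cube)
    moreover have "e\<^sup>2 * e\<^sup>2 \<le> e\<^sup>2" using mult_right_mono[OF e2, of "e\<^sup>2"] by simp
    moreover have "(a + e) ^ 4 = a ^ 4 + 4 * (a ^ 3 * e) + 6 * (a\<^sup>2 * e\<^sup>2) + 4 * (a * e ^ 3) + e\<^sup>2 * e\<^sup>2"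
      by (simp add: power2_eq_square power3_eq_cube power4_eq_xxxx algebra_simps)
    ultimately show ?thesis by linarith
  qed
  have "(\<integral>x. (u x + d x) ^ 4 \<partial>PM) \<le> (\<integral>x. u x ^ 4 + 4 * (u x ^ 3 * d x) + 8 * ((u x)\<^sup>2 * (d x)\<^sup>2) + 3 * (d x)\<^sup>2 \<partial>PM)"
  proof (rule integral_mono)
    show "integrable PM (\<lambda>x. (u x + d x) ^ 4)"
    proof (rule integrable_bounded[where B="(B + 1) ^ 4"])
      show "\<bar>(u x + d x) ^ 4\<bar> \<le> (B + 1) ^ 4" for x
        unfolding power_abs using B[of x] d_bound[of x] by (intro power_mono) auto
    qed measurable
    show "integrable PM (\<lambda>x. u x ^ 4 + 4 * (u x ^ 3 * d x) + 8 * ((u x)\<^sup>2 * (d x)\<^sup>2) + 3 * (d x)\<^sup>2)"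
      using int[of 4 0] int[of 3 1] int[of 2 2] int[of 0 2] by simp
  qed (rule poly[OF d_bound])
  also have "\<dots> = (\<integral>x. u x ^ 4 \<partial>PM) + 8 * (\<integral>x. (u x)\<^sup>2 * (d x)\<^sup>2 \<partial>PM) + 3 * (\<integral>x. (d x)\<^sup>2 \<partial>PM)"
    using int[of 4 0] int[of 3 1] int[of 2 2] int[of 0 2] cross[of 3] by simp
  also have "(\<integral>x. (d x)\<^sup>2 \<partial>PM) \<le> (\<integral>x. v x \<partial>PM)"
    using quad[of 0] integral_pp by simp
  also have "(\<integral>x. (u x)\<^sup>2 * (d x)\<^sup>2 \<partial>PM) \<le> (\<integral>x. (u x)\<^sup>2 * p (seq_shift (-1) x) \<partial>PM)"
    by (rule quad) simp
  also have "\<dots> \<le> (\<integral>x. b * (u x)\<^sup>2 \<partial>PM)"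
  proof (rule integral_mono_AE)
    show "AE x in PM. (u x)\<^sup>2 * p (seq_shift (-1) x) \<le> b * (u x)\<^sup>2"
      using AE_shift[OF b, of "-1"] by eventually_elim (simp add: mult.commute[of b] mult_left_mono)
  qed (use int[of 2 0] intpp[of 2] in simp_all)
  finally show "(\<integral>x. (u x + d x) ^ 4 \<partial>PM) \<le> (\<integral>x. (u x) ^ 4 \<partial>PM) + 8 * b * (\<integral>x. (u x)\<^sup>2 \<partial>PM) + 3 * (\<integral>x. v x \<partial>PM)"
    by simp
qed

lemma S_bound: "\<bar>S n x\<bar> \<le> real n"
proof -
  have "\<bar>S n x\<bar> \<le> (\<Sum>i=1..n. \<bar>d (seq_shift (int i) x)\<bar>)" unfolding S_def by (rule sum_abs)
  also have "\<dots> \<le> (\<Sum>i=1..n. 1)" by (intro sum_mono d_bound)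
  finally show ?thesis by simp
qed

lemma S_moments:
  assumes b: "AE x in PM. p x \<le> b" "0 \<le> b"
  shows "(\<integral>x. (S n x)\<^sup>2 \<partial>PM) \<le> real n * (\<integral>x. v x \<partial>PM)"
    and "(\<integral>x. (S n x) ^ 4 \<partial>PM) \<le> (8 * b * real n + 3) * (real n * (\<integral>x. v x \<partial>PM))"
proof -
  define w where "w = (\<integral>x. v x \<partial>PM)"
  have w: "0 \<le> w" unfolding w_def by (intro integral_nonneg_AE) (simp add: v_bounds)
  have "(\<integral>x. (S n x)\<^sup>2 \<partial>PM) \<le> real n * w \<and>
    (\<integral>x. (S n x) ^ 4 \<partial>PM) \<le> (8 * b * real n + 3) * (real n * w)"
  proof (induction n)
    case 0
    then show ?case by (simp add: S_def)
  next
    case (Suc n)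
    \<comment> \<open>Normalises the induction step as in the variance computation: the last
      difference becomes \<open>d\<close> at time 0 and the previous sum lives on coordinates up to
      \<open>-1\<close>.\<close>
    define u where "u x = S n (seq_shift (- int (Suc n)) x)" for x
    have [measurable]: "u \<in> borel_measurable PM" unfolding u_def by measurable
    have eq: "S (Suc n) x = u (seq_shift (int (Suc n)) x) + d (seq_shift (int (Suc n)) x)" for x
      by (simp add: S_def u_def)
    have dep: "past_dep (-1) u"
      unfolding past_dep_def u_def S_def shift_shift
    proof (intro allI sum.cong refl)
      fix x y :: "int \<Rightarrow> real" and i assume "i \<in> {1..n}"
      then have "past_dep (-1) (\<lambda>x. d (seq_shift (int i + - int (Suc n)) x))"
        by (intro past_dep_mono[OF past_dep_shift[OF d_past]]) auto
      then show "d (seq_shift (int i + - int (Suc n)) (glue (-1) x y)) = d (seq_shift (int i + - int (Suc n)) x)"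
        by (rule past_depD)
    qed
    have sh: "(\<integral>x. (S (Suc n) x) ^ k \<partial>PM) = (\<integral>x. (u x + d x) ^ k \<partial>PM)" for k
      unfolding eq by (rule integral_shift[of "\<lambda>x. (u x + d x) ^ k"]) measurable
    have shu: "(\<integral>x. (u x) ^ k \<partial>PM) = (\<integral>x. (S n x) ^ k \<partial>PM)" for k
      unfolding u_def by (rule integral_shift[of "\<lambda>x. S n x ^ k"]) measurable
    have ub: "\<bar>u x\<bar> \<le> real n" for x unfolding u_def by (rule S_bound)
    note os = one_step[OF _ dep ub b(1), folded w_def, unfolded shu sh[symmetric]]
    have 1: "(\<integral>x. (S (Suc n) x)\<^sup>2 \<partial>PM) \<le> real (Suc n) * w"
      using os(1) Suc by (simp add: algebra_simps)
    have "(\<integral>x. (S (Suc n) x) ^ 4 \<partial>PM) \<le> (\<integral>x. (S n x) ^ 4 \<partial>PM) + 8 * b * (\<integral>x. (S n x)\<^sup>2 \<partial>PM) + 3 * w"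
      using os(2) by simp
    also have "\<dots> \<le> (8 * b * real n + 3) * (real n * w) + 8 * b * (real n * w) + 3 * w"
      using Suc b(2) by (intro add_mono mult_left_mono) auto
    also have "\<dots> = (8 * b * real (Suc n) + 3) * (real (Suc n) * w) - 8 * b * real (Suc n) * w"
      by (simp add: algebra_simps)
    also have "\<dots> \<le> (8 * b * real (Suc n) + 3) * (real (Suc n) * w)"
      using b(2) w by simp
    finally show ?case using 1 by simp
  qed
  then show "(\<integral>x. (S n x)\<^sup>2 \<partial>PM) \<le> real n * (\<integral>x. v x \<partial>PM)"
    and "(\<integral>x. (S n x) ^ 4 \<partial>PM) \<le> (8 * b * real n + 3) * (real n * (\<integral>x. v x \<partial>PM))"
    by (auto simp: w_def)
qed

text \<open>The cut \<open>A = 8 * b * n + 3\<close> is the ratio of the fourth moment bound to the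
  second moment bound, so both terms of the interpolation are equal.\<close>

lemma S_powr_moment:
  assumes b: "AE x in PM. p x \<le> b" "0 \<le> b" and q: "2 < q" "q < 4"
  shows "(\<integral>x. \<bar>S n x\<bar> powr q \<partial>PM) \<le> 2 * (8 * b * real n + 3) powr (q/2 - 1) * (real n * (\<integral>x. v x \<partial>PM))"
proof -
  define A where "A = 8 * b * real n + 3"
  have A: "0 < A" using b(2) by (auto simp: A_def intro: add_nonneg_pos)
  have int: "integrable PM (\<lambda>x. (S n x) ^ k)" for k
    by (rule integrable_bounded[where B="real n ^ k"]) (auto simp: power_abs intro!: power_mono S_bound)
  have "(\<integral>x. \<bar>S n x\<bar> powr q \<partial>PM) \<le> (\<integral>x. A powr (q/2 - 1) * (S n x)\<^sup>2 + A powr (q/2 - 2) * (S n x) ^ 4 \<partial>PM)"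
  proof (rule integral_mono)
    show "integrable PM (\<lambda>x. \<bar>S n x\<bar> powr q)"
      using q by (intro integrable_bounded[where B="real n powr q"]) (auto intro!: powr_mono2 S_bound)
  qed (use int A q in \<open>auto intro!: powr_le_square_fourth\<close>)
  also have "\<dots> = A powr (q/2 - 1) * (\<integral>x. (S n x)\<^sup>2 \<partial>PM) + A powr (q/2 - 2) * (\<integral>x. (S n x) ^ 4 \<partial>PM)"
    using int by simp
  also have "\<dots> \<le> A powr (q/2 - 1) * (real n * (\<integral>x. v x \<partial>PM)) + A powr (q/2 - 2) * (A * (real n * (\<integral>x. v x \<partial>PM)))"
    using S_moments[OF b, of n] by (intro add_mono mult_left_mono) (auto simp: A_def)
  also have "A powr (q/2 - 2) * (A * (real n * (\<integral>x. v x \<partial>PM))) = A powr (q/2 - 1) * (real n * (\<integral>x. v x \<partial>PM))"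
    using A powr_add[of A "q/2 - 2" 1] by (simp add: mult.assoc[symmetric])
  finally show ?thesis by (simp add: A_def mult.assoc mult.left_commute mult.commute)
qed

text \<open>Each conditional probability is at most \<open>b\<close> almost surely, so all but one
  power of the sum can be bounded by \<open>n * b\<close>, and the remaining first power integrates
  exactly.\<close>

lemma sum_p_powr_moment:
  assumes b: "AE x in PM. p x \<le> b" "0 \<le> b" and q: "1 < q"
  shows "(\<integral>x. (\<Sum>i=1..n. p (seq_shift (int i - 1) x)) powr q \<partial>PM)
    \<le> (real n * b) powr (q - 1) * (real n * (\<integral>x. v x \<partial>PM))"
proof -
  define s where "s x = (\<Sum>i=1..n. p (seq_shift (int i - 1) x))" for x
  have [measurable]: "s \<in> borel_measurable PM" unfolding s_def by measurable
  have s0: "0 \<le> s x" for x unfolding s_def by (intro sum_nonneg p_bounds)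
  have sn: "s x \<le> real n" for x
    using sum_bounded_above[of "{1..n}" "\<lambda>i. p (seq_shift (int i - 1) x)" 1] p_bounds by (simp add: s_def)
  have "AE x in PM. \<forall>i::nat. p (seq_shift (int i - 1) x) \<le> b"
    unfolding AE_all_countable using AE_shift[OF b(1)] by blast
  then have sb: "AE x in PM. s x \<le> real n * b"
  proof eventually_elim
    case (elim x)
    then show ?case
      using sum_bounded_above[of "{1..n}" "\<lambda>i. p (seq_shift (int i - 1) x)" b] by (simp add: s_def)
  qed
  have ints: "integrable PM s" using s0 sn by (intro integrable_bounded[where B="real n"]) auto
  have intp: "integrable PM (\<lambda>x. p (seq_shift k x))" for k
    using p_bounds by (intro integrable_bounded[where B=1]) auto
  have "(\<integral>x. s x powr q \<partial>PM) \<le> (\<integral>x. (real n * b) powr (q - 1) * s x \<partial>PM)"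
  proof (rule integral_mono_AE)
    show "integrable PM (\<lambda>x. s x powr q)"
      using s0 sn q by (intro integrable_bounded[where B="real n powr q"]) (auto intro!: powr_mono2)
    show "AE x in PM. s x powr q \<le> (real n * b) powr (q - 1) * s x"
      using sb
    proof eventually_elim
      case (elim x)
      have "s x powr q = s x powr (q - 1) * s x"
        using s0[of x] powr_add[of "s x" "q - 1" 1] by (cases "s x = 0") auto
      also have "\<dots> \<le> (real n * b) powr (q - 1) * s x"
        using elim s0[of x] q by (intro mult_right_mono powr_mono2) auto
      finally show ?case .
    qed
  qed (use ints in simp)
  also have "\<dots> = (real n * b) powr (q - 1) * (\<integral>x. s x \<partial>PM)" by simp
  also have "(\<integral>x. s x \<partial>PM) = (\<Sum>i=1..n. \<integral>x. p (seq_shift (int i - 1) x) \<partial>PM)"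
    unfolding s_def by (rule Bochner_Integration.integral_sum) (rule intp)
  also have "\<dots> = real n * (\<integral>x. v x \<partial>PM)"
    by (simp add: integral_shift integral_p)
  finally show ?thesis by (simp add: s_def)
qed

end

section \<open>The martingale part of the empirical process\<close>

text \<open>Jensen's inequality for the \<open>q\<close>-th power with the weights \<open>c\<close>
  normalised to sum 1.\<close>

lemma weighted_power_mean:
  fixes c y :: "'i \<Rightarrow> real"
  assumes fin: "finite I" and c: "\<And>i. i \<in> I \<Longrightarrow> 0 < c i" and y: "\<And>i. i \<in> I \<Longrightarrow> 0 \<le> y i" and q: "1 \<le> q"
  shows "(\<Sum>i\<in>I. c i * y i) powr q \<le> (\<Sum>i\<in>I. c i) powr (q - 1) * (\<Sum>i\<in>I. c i * y i powr q)"
proof -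
  \<comment> \<open>Indices with \<open>y i = 0\<close> contribute to neither sum of
    \<open>y\<close>. Dropping them leaves positive arguments for the convexity of the power
    function.\<close>
  define I' where "I' = {i\<in>I. 0 < y i}"
  have I': "finite I'" "I' \<subseteq> I" using fin by (auto simp: I'_def)
  have 1: "(\<Sum>i\<in>I. c i * y i) = (\<Sum>i\<in>I'. c i * y i)"
    using fin y by (intro sum.mono_neutral_right) (auto simp: I'_def less_le)
  have 2: "(\<Sum>i\<in>I. c i * y i powr q) = (\<Sum>i\<in>I'. c i * y i powr q)"
    using fin y by (intro sum.mono_neutral_right) (auto simp: I'_def less_le)
  show ?thesis
  proof (cases "I' = {}")
    case True
    then show ?thesis using 1 2 by simp
  next
    case False
    define C where "C = sum c I'"
    have C: "0 < C" unfolding C_def using I' c False by (intro sum_pos) auto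
    have "(\<Sum>i\<in>I'. (c i / C) *\<^sub>R y i) powr q \<le> (\<Sum>i\<in>I'. (c i / C) * y i powr q)"
    proof (rule convex_on_sum[OF I'(1) False powr_convex[OF q]])
      show "(\<Sum>i\<in>I'. c i / C) = 1" using C by (simp add: C_def flip: sum_divide_distrib)
    qed (use c I' C in \<open>auto simp: I'_def less_imp_le\<close>)
    then have "((\<Sum>i\<in>I'. c i * y i) / C) powr q \<le> (\<Sum>i\<in>I'. c i * y i powr q) / C"
      by (simp add: sum_divide_distrib)
    moreover have "0 \<le> (\<Sum>i\<in>I'. c i * y i)"
      using I' c y by (intro sum_nonneg) (auto simp: less_imp_le subset_iff)
    ultimately have "(\<Sum>i\<in>I'. c i * y i) powr q \<le> C powr q * ((\<Sum>i\<in>I'. c i * y i powr q) / C)"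
      using C by (simp add: powr_divide field_simps)
    also have "\<dots> = C powr (q - 1) * (\<Sum>i\<in>I'. c i * y i powr q)"
      using C by (simp add: powr_diff)
    also have "\<dots> \<le> (\<Sum>i\<in>I. c i) powr (q - 1) * (\<Sum>i\<in>I'. c i * y i powr q)"
      using I' c C q fin
      by (intro mult_right_mono powr_mono2 sum_nonneg) (auto simp: C_def less_imp_le subset_iff intro!: sum_mono2)
    finally show ?thesis using 1 2 by simp
  qed
qed

lemma powr_add_le_double:
  fixes a b \<alpha> :: real
  assumes "0 \<le> a" "0 \<le> b" "0 \<le> \<alpha>" "\<alpha> \<le> 1"
  shows "(a + b) powr \<alpha> \<le> 2 * (a powr \<alpha> + b powr \<alpha>)"
proof -
  have "(a + b) powr \<alpha> \<le> (2 * max a b) powr \<alpha>"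
    using assms by (intro powr_mono2) auto
  also have "\<dots> = 2 powr \<alpha> * max a b powr \<alpha>"
    using assms by (subst powr_mult) auto
  also have "\<dots> \<le> 2 * (a powr \<alpha> + b powr \<alpha>)"
    using assms powr_mono[of \<alpha> 1 "2::real"] by (intro mult_mono) (auto simp: max_def)
  finally show ?thesis .
qed

text \<open>A grid point of level \<open>r\<close> either lies on the coarser grid or is the right
  neighbour of a point that does, so reaching it from \<open>t\<close> takes at most one step per
  level.\<close>

lemma dyadic_chain:
  fixes g :: "real \<Rightarrow> real" and A :: "nat \<Rightarrow> real"
  assumes A: "\<And>j m. j \<le> N \<Longrightarrow> m < 2 ^ j \<Longrightarrow> \<bar>g (t + real (Suc m) * \<delta> / 2 ^ j) - g (t + real m * \<delta> / 2 ^ j)\<bar> \<le> A j"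
  shows "r \<le> N \<Longrightarrow> m < 2 ^ r \<Longrightarrow> \<bar>g (t + real m * \<delta> / 2 ^ r) - g t\<bar> \<le> (\<Sum>j\<le>r. A j)"
proof (induction r arbitrary: m)
  case 0
  have "0 \<le> A 0" using A[of 0 0] by auto
  with 0 show ?case by simp
next
  case (Suc r)
  define k where "k = m div 2"
  have k: "k < 2 ^ r" using Suc.prems by (auto simp: k_def)
  have IH: "\<bar>g (t + real k * \<delta> / 2 ^ r) - g t\<bar> \<le> (\<Sum>j\<le>r. A j)"
    using Suc k by simp
  have pt: "t + real (2 * k) * \<delta> / 2 ^ Suc r = t + real k * \<delta> / 2 ^ r" by simp
  have "2 * k < 2 ^ Suc r" using k by simp
  from A[OF Suc.prems(1) this]
  have step: "\<bar>g (t + real (Suc (2 * k)) * \<delta> / 2 ^ Suc r) - g (t + real k * \<delta> / 2 ^ r)\<bar> \<le> A (Suc r)"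
    unfolding pt .
  consider "m = 2 * k" | "m = Suc (2 * k)" by (cases "even m") (auto simp: k_def elim!: evenE oddE)
  then show ?case
  proof cases
    case 1
    have "0 \<le> A (Suc r)" using step by linarith
    with IH show ?thesis unfolding 1 pt by simp
  next
    case 2
    show ?thesis unfolding 2 using IH step by simp
  qed
qed

section \<open>Conditional distribution functions and increments over intervals\<close>

locale cond_cdf = path_space D for D +
  fixes Xh :: "(int \<Rightarrow> real) \<Rightarrow> real"
  assumes Xh_meas [measurable]: "Xh \<in> borel_measurable PM"
    and Xh_past: "past_dep 0 Xh"
begin

text \<open>A version of the conditional distribution function of the next observation given the
  past up to time 0. Evaluated at \<open>seq_shift n x\<close> it conditions on the past up to time
  \<open>n\<close>.\<close>

definition H :: "real \<Rightarrow> (int \<Rightarrow> real) \<Rightarrow> real" where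
  "H r x = (\<integral>y. indicator {..r} (Xh (seq_shift 1 (glue 0 x y))) \<partial>PM)"

definition F :: "real \<Rightarrow> real" where
  "F r = (\<integral>x. indicator {..r} (Xh x) \<partial>PM)"

definition emp_mart :: "nat \<Rightarrow> real \<Rightarrow> (int \<Rightarrow> real) \<Rightarrow> real" where
  "emp_mart n s x = (\<Sum>i=1..n. indicator {..s} (Xh (seq_shift (int i) x)) - H s (seq_shift (int i - 1) x)) / sqrt (real n)"

text \<open>The predictable increment that \<open>emp_mart\<close> subtracts. Being monotone in its
  end points, it controls the error of passing from a grid point to an arbitrary point.\<close>

definition compensator :: "nat \<Rightarrow> real \<Rightarrow> real \<Rightarrow> (int \<Rightarrow> real) \<Rightarrow> real" where
  "compensator n a b x = (\<Sum>i=1..n. H b (seq_shift (int i - 1) x) - H a (seq_shift (int i - 1) x)) / sqrt (real n)"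

lemma H_measurable [measurable (raw)]:
  assumes [measurable]: "f \<in> N \<rightarrow>\<^sub>M Pi\<^sub>M UNIV (\<lambda>_. borel)" "r \<in> borel_measurable N"
  shows "(\<lambda>w. H (r w) (f w)) \<in> borel_measurable N"
  unfolding H_def indicator_def atMost_iff by measurable

lemma H_meas_PM [measurable]: "H r \<in> borel_measurable PM"
  by measurable

lemma emp_mart_meas [measurable]: "emp_mart n s \<in> borel_measurable PM"
  unfolding emp_mart_def by measurable

lemma compensator_meas [measurable]: "compensator n a b \<in> borel_measurable PM"
  unfolding compensator_def by measurable

lemma integrable_indicator_Xh: "integrable PM (\<lambda>y. indicator A (Xh (seq_shift k (glue l x y))) :: real)"
  if "A \<in> sets borel"
  using that by (intro PP.integrable_const_bound[where B=1]) auto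

lemma H_mono: "a \<le> b \<Longrightarrow> H a x \<le> H b x"
  unfolding H_def by (intro integral_mono integrable_indicator_Xh) (auto simp: indicator_def)

lemma indicator_Ioc: "a \<le> b \<Longrightarrow> indicator {a<..b} z = (indicator {..b} z - indicator {..a} z :: real)" for z :: real
  by (auto simp: indicator_def)

lemma binary_interval: "binary_process D (\<lambda>x. indicator {a<..b} (Xh x))"
  by unfold_locales (auto simp: past_dep_def past_depD[OF Xh_past] indicator_def)

lemma p_interval:
  assumes "a \<le> b"
  shows "binary_process.p D (\<lambda>x. indicator {a<..b} (Xh x)) x = H b x - H a x"
proof -
  interpret binary_process D "\<lambda>x. indicator {a<..b} (Xh x)" by (rule binary_interval)
  show ?thesis
    unfolding p_def H_def
    by (subst Bochner_Integration.integral_diff[symmetric])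
       (auto intro!: integrable_indicator_Xh Bochner_Integration.integral_cong simp: indicator_Ioc[OF assms])
qed

lemma integral_interval:
  assumes "a \<le> b"
  shows "(\<integral>x. indicator {a<..b} (Xh x) \<partial>PM) = F b - F a"
  unfolding F_def indicator_Ioc[OF assms]
  by (intro Bochner_Integration.integral_diff PP.integrable_const_bound[where B=1]) auto

lemma F_mono: "a \<le> b \<Longrightarrow> F a \<le> F b"
  unfolding F_def by (intro integral_mono PP.integrable_const_bound[where B=1]) (auto simp: indicator_def)

lemma integral_H: "(\<integral>x. H r x \<partial>PM) = F r"
proof -
  have "F r = (\<integral>x. indicator {..r} (Xh (seq_shift 1 x)) \<partial>PM)"
    unfolding F_def by (rule integral_shift[symmetric]) measurable
  also have "\<dots> = (\<integral>x. H r x \<partial>PM)"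
    unfolding H_def by (rule integral_glue[symmetric]) (auto intro!: PP.integrable_const_bound[where B=1])
  finally show ?thesis by simp
qed

lemma emp_mart_diff:
  assumes "a \<le> b"
  shows "emp_mart n b x - emp_mart n a x = binary_process.S D (\<lambda>x. indicator {a<..b} (Xh x)) n x / sqrt (real n)"
proof -
  interpret binary_process D "\<lambda>x. indicator {a<..b} (Xh x)" by (rule binary_interval)
  show ?thesis
    unfolding S_def emp_mart_def d_def p_interval[OF assms]
    by (simp add: indicator_Ioc[OF assms] diff_divide_distrib[symmetric] sum_subtractf[symmetric] algebra_simps)
qed

lemma compensator_nonneg: "a \<le> b \<Longrightarrow> 0 \<le> compensator n a b x"
  unfolding compensator_def by (intro divide_nonneg_nonneg sum_nonneg) (auto simp: H_mono)

text \<open>\<open>emp_mart\<close> is a difference of two nondecreasing functions of the level. An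
  increment to an interior point is at most the full increment of the first and at least minus that
  of the second, and the former is the martingale increment plus the compensator.\<close>

lemma emp_mart_bracket:
  assumes "a \<le> s" "s \<le> b"
  shows "\<bar>emp_mart n s x - emp_mart n a x\<bar> \<le> \<bar>emp_mart n b x - emp_mart n a x\<bar> + compensator n a b x"
proof -
  define I where "I r = (\<Sum>i=1..n. indicator {..r} (Xh (seq_shift (int i) x)) :: real) / sqrt (real n)" for r
  define K where "K r = (\<Sum>i=1..n. H r (seq_shift (int i - 1) x)) / sqrt (real n)" for r
  have G: "emp_mart n r x = I r - K r" for r
    by (simp add: emp_mart_def I_def K_def sum_subtractf diff_divide_distrib)
  have N: "compensator n r r' x = K r' - K r" for r r'
    by (simp add: compensator_def K_def sum_subtractf diff_divide_distrib)
  have "I r \<le> I r'" if "r \<le> r'" for r r'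
    unfolding I_def using that by (intro divide_right_mono sum_mono) (auto simp: indicator_def)
  moreover have "K r \<le> K r'" if "r \<le> r'" for r r'
    unfolding K_def using that by (intro divide_right_mono sum_mono H_mono) auto
  ultimately have "I a \<le> I s" "I s \<le> I b" "K a \<le> K s" "K s \<le> K b" using assms by auto
  then show ?thesis unfolding G N by linarith
qed

end

text \<open>The density bound is kept only in the integrated form that interval probabilities use.
  The normalisation \<open>1 \<le> \<tau>\<close> allows \<open>\<tau> powr (q - 1)\<close> to be
  enlarged to \<open>\<tau> powr q\<close>.\<close>

locale bounded_cond_density = cond_cdf +
  fixes \<tau> :: real
  assumes tau: "1 \<le> \<tau>"
    and dens: "\<And>a b. a \<le> b \<Longrightarrow> AE x in PM. H b x - H a x \<le> \<tau> * (b - a)"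
begin

text \<open>The surplus factor \<open>n powr (1 - q/2)\<close> is absorbed into the base of the
  power. This creates the term \<open>3 / n\<close>, which does not shrink with the interval and is
  responsible for the logarithm in the chaining.\<close>

lemma emp_mart_powr_moment:
  assumes ab: "a \<le> b" and n: "1 \<le> n" and q: "2 < q" "q < 4"
  shows "(\<integral>\<^sup>+x. ennreal (\<bar>emp_mart n b x - emp_mart n a x\<bar> powr q) \<partial>PM)
    \<le> ennreal (2 * (8 * \<tau> * (b - a) + 3 / real n) powr (q/2 - 1) * (F b - F a))"
proof -
  interpret binary_process D "\<lambda>x. indicator {a<..b} (Xh x)" by (rule binary_interval)
  have b: "AE x in PM. p x \<le> \<tau> * (b - a)" "0 \<le> \<tau> * (b - a)"
    using dens[OF ab] tau ab by (auto simp: p_interval[OF ab])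
  have n0: "0 < real n" using n by simp
  have "(\<integral>\<^sup>+x. ennreal (\<bar>emp_mart n b x - emp_mart n a x\<bar> powr q) \<partial>PM)
      = (\<integral>\<^sup>+x. ennreal (\<bar>S n x\<bar> powr q / real n powr (q/2)) \<partial>PM)"
    using n0 by (intro nn_integral_cong)
      (simp add: emp_mart_diff[OF ab] abs_divide powr_divide powr_half_sqrt[symmetric] powr_powr)
  also have "\<dots> = ennreal (\<integral>x. \<bar>S n x\<bar> powr q / real n powr (q/2) \<partial>PM)"
  proof (rule nn_integral_eq_integral)
    have "integrable PM (\<lambda>x. \<bar>S n x\<bar> powr q)"
      using q by (intro integrable_bounded[where B="real n powr q"]) (auto intro!: powr_mono2 S_bound)
    then show "integrable PM (\<lambda>x. \<bar>S n x\<bar> powr q / real n powr (q/2))" by simp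
  qed auto
  also have "\<dots> \<le> ennreal (2 * (8 * \<tau> * (b - a) + 3 / real n) powr (q/2 - 1) * (F b - F a))"
  proof (rule ennreal_leI)
    have "(\<integral>x. \<bar>S n x\<bar> powr q / real n powr (q/2) \<partial>PM)
      \<le> (2 * (8 * (\<tau> * (b - a)) * real n + 3) powr (q/2 - 1) * (real n * (F b - F a))) / real n powr (q/2)"
      using S_powr_moment[OF b q, of n] by (simp add: integral_interval[OF ab] divide_right_mono)
    also have "\<dots> = 2 * (8 * (\<tau> * (b - a)) * real n + 3) powr (q/2 - 1) * (F b - F a) * (real n / real n powr (q/2))"
      by simp
    also have "real n / real n powr (q/2) = 1 / real n powr (q/2 - 1)"
      using n0 by (simp add: powr_diff)
    also have "2 * (8 * (\<tau> * (b - a)) * real n + 3) powr (q/2 - 1) * (F b - F a) * (1 / real n powr (q/2 - 1))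
      = 2 * ((8 * (\<tau> * (b - a)) * real n + 3) powr (q/2 - 1) / real n powr (q/2 - 1)) * (F b - F a)"
      by simp
    also have "(8 * (\<tau> * (b - a)) * real n + 3) powr (q/2 - 1) / real n powr (q/2 - 1)
      = (8 * \<tau> * (b - a) + 3 / real n) powr (q/2 - 1)"
      using n0 b(2) by (subst powr_divide[symmetric]) (auto simp: field_simps)
    finally show "(\<integral>x. \<bar>S n x\<bar> powr q / real n powr (q/2) \<partial>PM)
      \<le> 2 * (8 * \<tau> * (b - a) + 3 / real n) powr (q/2 - 1) * (F b - F a)" .
  qed
  finally show ?thesis .
qed

text \<open>The factor \<open>n powr (1 - q/2)\<close> is simply bounded by 1 here. The estimate is
  applied only at the finest scale, where \<open>n * (b - a)\<close> is at most the block
  length.\<close>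

lemma compensator_powr_moment:
  assumes ab: "a \<le> b" and n: "1 \<le> n" and q: "2 < q"
  shows "(\<integral>\<^sup>+x. ennreal (compensator n a b x powr q) \<partial>PM) \<le> ennreal ((real n * (\<tau> * (b - a))) powr (q - 1) * (F b - F a))"
proof -
  interpret binary_process D "\<lambda>x. indicator {a<..b} (Xh x)" by (rule binary_interval)
  have b: "AE x in PM. p x \<le> \<tau> * (b - a)" "0 \<le> \<tau> * (b - a)"
    using dens[OF ab] tau ab by (auto simp: p_interval[OF ab])
  define s where "s x = (\<Sum>i=1..n. p (seq_shift (int i - 1) x))" for x
  have s0: "0 \<le> s x" for x unfolding s_def by (intro sum_nonneg p_bounds)
  have sn: "s x \<le> real n" for x
    using sum_bounded_above[of "{1..n}" "\<lambda>i. p (seq_shift (int i - 1) x)" 1] p_bounds by (simp add: s_def)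
  have n0: "0 < real n" using n by simp
  have "(\<integral>\<^sup>+x. ennreal (compensator n a b x powr q) \<partial>PM) = (\<integral>\<^sup>+x. ennreal (s x powr q / real n powr (q/2)) \<partial>PM)"
    using n0 s0 by (intro nn_integral_cong)
      (simp add: compensator_def s_def p_interval[OF ab] powr_divide powr_half_sqrt[symmetric] powr_powr)
  also have "\<dots> = ennreal (\<integral>x. s x powr q / real n powr (q/2) \<partial>PM)"
  proof (rule nn_integral_eq_integral)
    have "integrable PM (\<lambda>x. s x powr q)"
    proof (rule integrable_bounded[where B="real n powr q"])
      show "\<bar>s x powr q\<bar> \<le> real n powr q" for x using q s0 sn by (auto intro!: powr_mono2)
    qed (unfold s_def, measurable)
    then show "integrable PM (\<lambda>x. s x powr q / real n powr (q/2))" by simp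
  qed auto
  also have "\<dots> \<le> ennreal ((real n * (\<tau> * (b - a))) powr (q - 1) * (F b - F a))"
  proof (rule ennreal_leI)
    have "(\<integral>x. s x powr q / real n powr (q/2) \<partial>PM)
      \<le> (real n * (\<tau> * (b - a))) powr (q - 1) * (real n * (F b - F a)) / real n powr (q/2)"
      using sum_p_powr_moment[OF b, of q n] q
      by (simp add: integral_interval[OF ab] divide_right_mono s_def)
    also have "\<dots> = (real n * (\<tau> * (b - a))) powr (q - 1) * (F b - F a) * (real n / real n powr (q/2))"
      by simp
    also have "\<dots> \<le> (real n * (\<tau> * (b - a))) powr (q - 1) * (F b - F a) * 1"
    proof (rule mult_left_mono)
      have "real n powr 1 \<le> real n powr (q/2)" using n q by (intro powr_mono) auto
      then show "real n / real n powr (q/2) \<le> 1" using n0 by simp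
    qed (use F_mono[OF ab] in auto)
    finally show "(\<integral>x. s x powr q / real n powr (q/2) \<partial>PM) \<le> (real n * (\<tau> * (b - a))) powr (q - 1) * (F b - F a)" by simp
  qed
  finally show ?thesis .
qed

end

section \<open>Chaining\<close>

lemma nn_integral_le_imp_integral_le:
  fixes f :: "'a \<Rightarrow> real"
  assumes f [measurable]: "f \<in> borel_measurable N" and nn: "\<And>x. 0 \<le> f x" and r: "0 \<le> r"
    and le: "(\<integral>\<^sup>+x. ennreal (f x) \<partial>N) \<le> ennreal r"
  shows "integrable N f" "(\<integral>x. f x \<partial>N) \<le> r"
proof -
  show i: "integrable N f"
    using le nn by (intro integrableI_bounded) (auto intro: le_less_trans)
  show "(\<integral>x. f x \<partial>N) \<le> r"
    using le r nn by (subst (asm) nn_integral_eq_integral[OF i]) auto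
qed

text \<open>As \<open>s\<close> is at most one block length, \<open>t\<close> and
  \<open>t + s\<close> lie in the same or in adjacent blocks. Passing between them uses at most
  three increments that start at a left end point, all within \<open>2 * \<delta>\<close> of
  \<open>t\<close>.\<close>

lemma three_block_increment:
  fixes g :: "real \<Rightarrow> real"
  assumes \<delta>: "0 < \<delta>" and s: "\<bar>s\<bar> \<le> \<delta>"
    and g: "\<And>k u. \<bar>t - of_int k * \<delta>\<bar> \<le> 2 * \<delta> \<Longrightarrow> of_int k * \<delta> \<le> u \<Longrightarrow> u \<le> (of_int k + 1) * \<delta> \<Longrightarrow>
      \<bar>g u - g (of_int k * \<delta>)\<bar> \<le> \<rho>"
  shows "\<bar>g (t + s) - g t\<bar> \<le> 3 * \<rho>"
proof -
  define k where "k = \<lfloor>t / \<delta>\<rfloor>"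
  have "of_int k \<le> t / \<delta>" "t / \<delta> \<le> of_int k + 1" unfolding k_def by linarith+
  then have k: "of_int k * \<delta> \<le> t" "t \<le> (of_int k + 1) * \<delta>" using \<delta> by (simp_all add: field_simps)
  have e: "(of_int k + 1) * \<delta> = of_int k * \<delta> + \<delta>" "of_int (k + 1) * \<delta> = of_int k * \<delta> + \<delta>"
    "(of_int (k + 1) + 1) * \<delta> = of_int k * \<delta> + 2 * \<delta>" "of_int (k - 1) * \<delta> = of_int k * \<delta> - \<delta>"
    "(of_int (k - 1) + 1) * \<delta> = of_int k * \<delta>"
    by (simp_all add: algebra_simps)
  have t: "\<bar>g t - g (of_int k * \<delta>)\<bar> \<le> \<rho>" using k \<delta> by (intro g) (auto simp: e)
  have \<rho>: "0 \<le> \<rho>" using t by linarith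
  consider "of_int k * \<delta> + \<delta> \<le> t + s" | "of_int k * \<delta> \<le> t + s" "t + s \<le> of_int k * \<delta> + \<delta>" | "t + s \<le> of_int k * \<delta>"
    by linarith
  then show ?thesis
  proof cases
    case 1
    have "\<bar>g (t + s) - g (of_int (k + 1) * \<delta>)\<bar> \<le> \<rho>" using 1 k s \<delta> by (intro g) (auto simp only: e)
    moreover have "\<bar>g (of_int (k + 1) * \<delta>) - g (of_int k * \<delta>)\<bar> \<le> \<rho>" using k \<delta> by (intro g) (auto simp only: e)
    ultimately show ?thesis using t by linarith
  next
    case 2
    have "\<bar>g (t + s) - g (of_int k * \<delta>)\<bar> \<le> \<rho>" using 2 k s \<delta> by (intro g) (auto simp only: e)
    then show ?thesis using t \<rho> by linarith
  next
    case 3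
    have "\<bar>g (t + s) - g (of_int (k - 1) * \<delta>)\<bar> \<le> \<rho>" using 3 k s \<delta> by (intro g) (auto simp only: e)
    moreover have "\<bar>g (of_int k * \<delta>) - g (of_int (k - 1) * \<delta>)\<bar> \<le> \<rho>" using k \<delta> by (intro g) (auto simp only: e)
    ultimately show ?thesis using t by linarith
  qed
qed

lemma powr_weight_le:
  fixes t u \<gamma> :: real
  assumes "\<bar>t - u\<bar> \<le> 1" "0 \<le> \<gamma>"
  shows "(1 + \<bar>t\<bar>) powr \<gamma> \<le> 2 powr \<gamma> * (1 + \<bar>u\<bar>) powr \<gamma>"
  using assms by (subst powr_mult[symmetric]) (auto intro!: powr_mono2)

context bounded_cond_density
begin

text \<open>Chaining inside one block. The expectation of the majorant retains the
  \<open>F\<close>-mass of the block as a factor, so that the blocks can later be summed with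
  weights.\<close>

lemma block_moment:
  fixes n N :: nat and \<delta> K q \<alpha> :: real and k :: int
  defines "\<alpha> \<equiv> 1/2 - 1/q"
  defines "C \<equiv> 4 * ((8 * \<tau>) powr \<alpha> / (1 - (1/2) powr \<alpha>) + 3 powr \<alpha> * K) + \<tau>"
  assumes n: "1 \<le> n" "real n \<le> 2 ^ N" and \<delta>: "0 < \<delta>" "\<delta> < 1" and q: "2 < q" "q < 4"
    and K: "real (Suc N) * (1 / real n) powr \<alpha> \<le> K * \<delta> powr \<alpha>"
  shows "\<exists>V. V \<in> borel_measurable PM \<and> (\<forall>z. 0 \<le> V z) \<and>
    (\<forall>z s. of_int k * \<delta> \<le> s \<longrightarrow> s \<le> (of_int k + 1) * \<delta> \<longrightarrow> \<bar>emp_mart n s z - emp_mart n (of_int k * \<delta>) z\<bar> powr q \<le> V z) \<and>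
    (\<integral>\<^sup>+z. ennreal (V z) \<partial>PM) \<le> ennreal (2 * C powr q * \<delta> powr (q/2 - 1) * (F ((of_int k + 1) * \<delta>) - F (of_int k * \<delta>)))"
proof -
  have \<alpha>: "0 < \<alpha>" "\<alpha> \<le> 1" "\<alpha> * q = q/2 - 1" using q by (simp_all add: \<alpha>_def field_simps)
  have n0: "0 < real n" using n by simp
  define t where "t = of_int k * \<delta>"
  have t': "(of_int k + 1) * \<delta> = t + \<delta>" by (simp add: t_def algebra_simps)
  define \<Delta> where "\<Delta> = F (t + \<delta>) - F t"
  have \<Delta>: "0 \<le> \<Delta>" using \<delta> by (simp add: \<Delta>_def F_mono)
  define pt where "pt j m = t + real m * \<delta> / 2 ^ j" for j m :: nat
  have pt_Suc: "pt j (Suc m) - pt j m = \<delta> / 2 ^ j" "pt j m \<le> pt j (Suc m)" for j m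
    using \<delta> by (simp_all add: pt_def field_simps)
  have telF: "(\<Sum>m<2 ^ j. F (pt j (Suc m)) - F (pt j m)) = \<Delta>" for j :: nat
    using sum_lessThan_telescope[of "\<lambda>m. F (pt j m)" "2 ^ j"] by (simp add: pt_def \<Delta>_def)
  \<comment> \<open>\<open>c j\<close>, and \<open>cB\<close> for the compensator at the finest
    level, bound the \<open>L^q\<close> sizes of the respective links up to a constant and the
    common factor \<open>\<Delta> powr (1/q)\<close>.\<close>
  define c where "c j = (8 * \<tau> * (\<delta> / 2 ^ j) + 3 / real n) powr \<alpha>" for j :: nat
  define cB where "cB = \<tau> * \<delta> powr \<alpha>"
  define L where "L = (\<Sum>j\<le>N. 2 * c j) + cB"
  have base: "0 < 8 * \<tau> * (\<delta> / 2 ^ j) + 3 / real n" for j :: nat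
    using tau \<delta> n0 by (intro add_pos_pos mult_pos_pos divide_pos_pos) auto
  have c0: "0 < c j" for j using base[of j] by (simp add: c_def)
  have cq: "c j powr q = (8 * \<tau> * (\<delta> / 2 ^ j) + 3 / real n) powr (q/2 - 1)" for j
    by (simp add: c_def powr_powr \<alpha>)
  have cB0: "0 < cB" using tau \<delta> by (simp add: cB_def)
  have L0: "0 < L" unfolding L_def using c0 cB0 by (intro add_nonneg_pos sum_nonneg) (auto simp: less_imp_le)
  define Aq where "Aq j z = (\<Sum>m<2 ^ j. \<bar>emp_mart n (pt j (Suc m)) z - emp_mart n (pt j m) z\<bar> powr q)" for j z
  define Bq where "Bq z = (\<Sum>m<2 ^ N. compensator n (pt N m) (pt N (Suc m)) z powr q)" for z
  have [measurable]: "Aq j \<in> borel_measurable PM" "Bq \<in> borel_measurable PM" for j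
    unfolding Aq_def Bq_def by measurable
  have A0: "0 \<le> Aq j z" and B0: "0 \<le> Bq z" for j z
    unfolding Aq_def Bq_def by (auto intro!: sum_nonneg)
  \<comment> \<open>\<open>weighted_power_mean\<close> with weights \<open>2 * c j\<close> and
    \<open>cB\<close> replaces Minkowski's inequality in \<open>L^q\<close>. Division by
    \<open>c j powr q\<close> makes each level contribute in proportion to its weight, so the
    expectation is at most \<open>2 * L powr q * \<Delta>\<close>.\<close>
  define V where "V z = L powr (q - 1) * ((\<Sum>j\<le>N. 2 * c j * (Aq j z / c j powr q)) + cB * (Bq z / cB powr q))" for z
  have Vm [measurable]: "V \<in> borel_measurable PM" unfolding V_def by measurable
  have V0: "0 \<le> V z" for z
    unfolding V_def using c0 cB0 A0 B0
    by (intro mult_nonneg_nonneg add_nonneg_nonneg sum_nonneg divide_nonneg_nonneg) (auto simp: less_imp_le)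

  have intA: "integrable PM (Aq j)" "(\<integral>z. Aq j z \<partial>PM) \<le> 2 * c j powr q * \<Delta>" for j
  proof -
    have "(\<integral>\<^sup>+z. ennreal (Aq j z) \<partial>PM) = (\<Sum>m<2 ^ j. \<integral>\<^sup>+z. ennreal (\<bar>emp_mart n (pt j (Suc m)) z - emp_mart n (pt j m) z\<bar> powr q) \<partial>PM)"
      unfolding Aq_def by (subst nn_integral_sum[symmetric]) (auto simp: sum_ennreal)
    also have "\<dots> \<le> (\<Sum>m<2 ^ j. ennreal (2 * c j powr q * (F (pt j (Suc m)) - F (pt j m))))"
      using emp_mart_powr_moment[OF pt_Suc(2) n(1) q, of j] by (intro sum_mono) (simp add: pt_Suc(1) cq)
    also have "\<dots> = ennreal (2 * c j powr q * \<Delta>)"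
      using F_mono[OF pt_Suc(2)] by (subst sum_ennreal) (auto simp: sum_distrib_left[symmetric] telF)
    finally have *: "(\<integral>\<^sup>+z. ennreal (Aq j z) \<partial>PM) \<le> ennreal (2 * c j powr q * \<Delta>)" .
    show "integrable PM (Aq j)" "(\<integral>z. Aq j z \<partial>PM) \<le> 2 * c j powr q * \<Delta>"
      by (rule nn_integral_le_imp_integral_le[OF _ _ _ *]; use A0 \<Delta> in simp)+
  qed
  have intB: "integrable PM Bq" "(\<integral>z. Bq z \<partial>PM) \<le> cB powr q * \<Delta>"
  proof -
    \<comment> \<open>Here the depth matters: \<open>n \<le> 2 ^ N\<close> cancels the factor
      \<open>n\<close>. Then \<open>\<tau> \<ge> 1\<close>, \<open>\<delta> < 1\<close> and
      \<open>q - 1 \<ge> q/2 - 1\<close> lead to the target \<open>cB powr q\<close>.\<close>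
    have nd: "(real n * (\<tau> * (\<delta> / 2 ^ N))) powr (q - 1) \<le> cB powr q"
    proof -
      have "real n / 2 ^ N \<le> 1" using n by simp
      then have "real n / 2 ^ N * (\<tau> * \<delta>) \<le> 1 * (\<tau> * \<delta>)"
        using tau \<delta> by (intro mult_right_mono) auto
      then have "(real n * (\<tau> * (\<delta> / 2 ^ N))) powr (q - 1) \<le> (\<tau> * \<delta>) powr (q - 1)"
        using tau \<delta> q by (intro powr_mono2) auto
      also have "\<dots> = \<tau> powr (q - 1) * \<delta> powr (q - 1)" using tau \<delta> by (simp add: powr_mult)
      also have "\<dots> \<le> \<tau> powr q * \<delta> powr (q/2 - 1)"
        using tau \<delta> q by (intro mult_mono powr_mono powr_mono') auto
      also have "\<dots> = cB powr q" using tau \<delta> by (simp add: cB_def powr_mult powr_powr \<alpha>)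
      finally show ?thesis .
    qed
    have "(\<integral>\<^sup>+z. ennreal (Bq z) \<partial>PM) = (\<Sum>m<2 ^ N. \<integral>\<^sup>+z. ennreal (compensator n (pt N m) (pt N (Suc m)) z powr q) \<partial>PM)"
      unfolding Bq_def by (subst nn_integral_sum[symmetric]) (auto simp: sum_ennreal)
    also have "\<dots> \<le> (\<Sum>m<2 ^ N. ennreal (cB powr q * (F (pt N (Suc m)) - F (pt N m))))"
    proof (rule sum_mono)
      fix m
      have "(\<integral>\<^sup>+z. ennreal (compensator n (pt N m) (pt N (Suc m)) z powr q) \<partial>PM)
        \<le> ennreal ((real n * (\<tau> * (\<delta> / 2 ^ N))) powr (q - 1) * (F (pt N (Suc m)) - F (pt N m)))"
        using compensator_powr_moment[OF pt_Suc(2) n(1) q(1), of N m] by (simp add: pt_Suc(1))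
      also have "\<dots> \<le> ennreal (cB powr q * (F (pt N (Suc m)) - F (pt N m)))"
        using F_mono[OF pt_Suc(2)] by (intro ennreal_leI mult_right_mono nd) auto
      finally show "(\<integral>\<^sup>+z. ennreal (compensator n (pt N m) (pt N (Suc m)) z powr q) \<partial>PM) \<le> \<dots>" .
    qed
    also have "\<dots> = ennreal (cB powr q * \<Delta>)"
      using F_mono[OF pt_Suc(2)] by (subst sum_ennreal) (auto simp: sum_distrib_left[symmetric] telF)
    finally have *: "(\<integral>\<^sup>+z. ennreal (Bq z) \<partial>PM) \<le> ennreal (cB powr q * \<Delta>)" .
    show "integrable PM Bq" "(\<integral>z. Bq z \<partial>PM) \<le> cB powr q * \<Delta>"
      by (rule nn_integral_le_imp_integral_le[OF _ _ _ *]; use B0 \<Delta> in simp)+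
  qed

  have bound: "\<bar>emp_mart n s z - emp_mart n t z\<bar> powr q \<le> V z" if s: "t \<le> s" "s \<le> t + \<delta>" for s z
  proof (cases "s = t")
    case True
    then show ?thesis using V0 by simp
  next
    case False
    define A where "A j = Aq j z powr (1/q)" for j
    define B where "B = Bq z powr (1/q)"
    have AA: "\<bar>emp_mart n (pt j (Suc m)) z - emp_mart n (pt j m) z\<bar> \<le> A j" if "m < 2 ^ j" for j m
    proof -
      have "\<bar>emp_mart n (pt j (Suc m)) z - emp_mart n (pt j m) z\<bar> powr q \<le> Aq j z"
        unfolding Aq_def using that by (intro member_le_sum) auto
      then have "(\<bar>emp_mart n (pt j (Suc m)) z - emp_mart n (pt j m) z\<bar> powr q) powr (1/q) \<le> A j"
        unfolding A_def using q by (intro powr_mono2) auto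
      then show ?thesis using q by (simp add: powr_powr)
    qed
    have BB: "compensator n (pt N m) (pt N (Suc m)) z \<le> B" if "m < 2 ^ N" for m
    proof -
      have "compensator n (pt N m) (pt N (Suc m)) z powr q \<le> Bq z"
        unfolding Bq_def using that by (intro member_le_sum) auto
      then have "(compensator n (pt N m) (pt N (Suc m)) z powr q) powr (1/q) \<le> B"
        unfolding B_def using q by (intro powr_mono2) auto
      then show ?thesis using q compensator_nonneg[OF pt_Suc(2)] by (simp add: powr_powr)
    qed
    \<comment> \<open>The ceiling minus one, not the floor: the right end point
      \<open>s = t + \<delta>\<close> must belong to the last cell. The left end point has been
      dealt with separately.\<close>
    define m where "m = nat (\<lceil>(s - t) * 2 ^ N / \<delta>\<rceil> - 1)"
    have pos: "0 < (s - t) * 2 ^ N / \<delta>" using s False \<delta> by simp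
    have "(s - t) * 2 ^ N \<le> \<delta> * 2 ^ N" using s by (intro mult_right_mono) auto
    then have le: "(s - t) * 2 ^ N / \<delta> \<le> 2 ^ N" using \<delta> by (simp add: divide_le_eq mult.commute)
    have "1 \<le> \<lceil>(s - t) * 2 ^ N / \<delta>\<rceil>" using pos by linarith
    moreover have "\<lceil>(s - t) * 2 ^ N / \<delta>\<rceil> \<le> 2 ^ N" using le by (simp add: ceiling_le_iff)
    ultimately have m: "int m = \<lceil>(s - t) * 2 ^ N / \<delta>\<rceil> - 1" "int m < 2 ^ N" by (auto simp: m_def)
    then have m2: "m < 2 ^ N" by (metis of_nat_less_iff of_nat_numeral of_nat_power)
    have "real m < (s - t) * 2 ^ N / \<delta>" "(s - t) * 2 ^ N / \<delta> \<le> real (Suc m)"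
      using m(1) by linarith+
    then have cell: "pt N m \<le> s" "s \<le> pt N (Suc m)"
      using \<delta> by (simp_all add: pt_def field_simps)
    have "\<bar>emp_mart n s z - emp_mart n (pt N m) z\<bar> \<le> A N + B"
      using emp_mart_bracket[OF cell, of n z] AA[OF m2] BB[OF m2] by linarith
    moreover have "\<bar>emp_mart n (pt N m) z - emp_mart n t z\<bar> \<le> (\<Sum>j\<le>N. A j)"
      unfolding pt_def
      by (rule dyadic_chain[where N=N and g="\<lambda>s. emp_mart n s z"]) (use AA m2 in \<open>auto simp: pt_def\<close>)
    \<comment> \<open>Level \<open>N\<close> occurs once more in the bracket around
      \<open>s\<close>. Doubling every level covers this, hence the weights
      \<open>2 * c j\<close>.\<close>
    moreover have "A N \<le> (\<Sum>j\<le>N. A j)" by (intro member_le_sum) (auto simp: A_def)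
    ultimately have "\<bar>emp_mart n s z - emp_mart n t z\<bar> \<le> (\<Sum>j\<le>N. 2 * A j) + B"
      by (simp add: sum_distrib_left[symmetric])
    then have "\<bar>emp_mart n s z - emp_mart n t z\<bar> powr q \<le> ((\<Sum>j\<le>N. 2 * A j) + B) powr q"
      using q by (intro powr_mono2) auto
    also have "\<dots> \<le> V z"
    proof -
      define cc where "cc i = (if i \<le> N then 2 * c i else cB)" for i
      define yy where "yy i = (if i \<le> N then A i / c i else B / cB)" for i
      have "(\<Sum>i\<le>Suc N. cc i * yy i) powr q \<le> (\<Sum>i\<le>Suc N. cc i) powr (q - 1) * (\<Sum>i\<le>Suc N. cc i * yy i powr q)"
        using c0 cB0 q by (intro weighted_power_mean) (auto simp: cc_def yy_def A_def B_def less_imp_le)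
      moreover have "(\<Sum>i\<le>Suc N. cc i * yy i) = (\<Sum>j\<le>N. 2 * A j) + B"
        using c0 cB0 by (simp add: cc_def yy_def less_imp_neq[THEN not_sym])
      moreover have "(\<Sum>i\<le>Suc N. cc i) = L" by (simp add: cc_def L_def)
      moreover have "(\<Sum>i\<le>Suc N. cc i * yy i powr q)
          = (\<Sum>j\<le>N. 2 * c j * (Aq j z / c j powr q)) + cB * (Bq z / cB powr q)"
        using c0 cB0 q A0 B0 by (simp add: cc_def yy_def A_def B_def powr_divide powr_powr less_imp_le)
      ultimately show ?thesis by (simp add: V_def)
    qed
    finally show ?thesis .
  qed

  have intV: "integrable PM V" unfolding V_def using intA(1) intB(1) by simp
  have "(\<integral>z. V z \<partial>PM) = L powr (q - 1) * ((\<Sum>j\<le>N. 2 * c j * ((\<integral>z. Aq j z \<partial>PM) / c j powr q)) + cB * ((\<integral>z. Bq z \<partial>PM) / cB powr q))"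
    unfolding V_def using intA(1) intB(1) by simp
  also have "\<dots> \<le> L powr (q - 1) * ((\<Sum>j\<le>N. 2 * c j * (2 * \<Delta>)) + cB * \<Delta>)"
    using intA(2) intB(2) c0 cB0 \<Delta>
    by (intro mult_left_mono add_mono sum_mono) (auto simp: less_imp_le divide_le_eq mult.commute mult.left_commute)
  also have "\<dots> = L powr (q - 1) * ((\<Sum>j\<le>N. 2 * (2 * c j)) + cB) * \<Delta>"
    by (simp add: sum_distrib_left sum_distrib_right algebra_simps)
  also have "\<dots> \<le> L powr (q - 1) * (2 * L) * \<Delta>"
    using cB0 \<Delta> by (intro mult_right_mono mult_left_mono) (auto simp: L_def sum_distrib_left[symmetric])
  also have "\<dots> = 2 * L powr q * \<Delta>"
    using L0 by (simp add: powr_diff)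
  also have "\<dots> \<le> 2 * (C powr q * \<delta> powr (q/2 - 1)) * \<Delta>"
  proof -
    \<comment> \<open>Splits each level into a geometric term and a term constant in
      \<open>j\<close>. The constant term, taken \<open>Suc N\<close> times, is what hypothesis
      \<open>K\<close> bounds by \<open>\<delta> powr \<alpha>\<close>.\<close>
    have cj: "c j \<le> 2 * ((8 * \<tau>) powr \<alpha> * \<delta> powr \<alpha> * ((1/2) powr \<alpha>) ^ j + 3 powr \<alpha> * (1 / real n) powr \<alpha>)" for j
    proof -
      have "c j \<le> 2 * ((8 * \<tau> * (\<delta> / 2 ^ j)) powr \<alpha> + (3 / real n) powr \<alpha>)"
        unfolding c_def using tau \<delta> \<alpha> by (intro powr_add_le_double) auto
      also have "(3 / real n) powr \<alpha> = 3 powr \<alpha> * (1 / real n) powr \<alpha>"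
        by (subst powr_mult[symmetric]) auto
      also have "(8 * \<tau> * (\<delta> / 2 ^ j)) powr \<alpha> = (8 * \<tau> * \<delta> * (1/2) ^ j) powr \<alpha>"
        by (simp add: power_one_over field_simps)
      also have "\<dots> = (8 * \<tau>) powr \<alpha> * \<delta> powr \<alpha> * ((1/2) ^ j) powr \<alpha>"
        using tau \<delta> by (simp add: powr_mult)
      also have "((1/2::real) ^ j) powr \<alpha> = ((1/2) powr \<alpha>) ^ j"
        by (simp add: powr_powr powr_realpow[symmetric] mult.commute)
      finally show ?thesis .
    qed
    have "(\<Sum>j\<le>N. 2 * c j) \<le> (\<Sum>j\<le>N. 4 * ((8 * \<tau>) powr \<alpha> * \<delta> powr \<alpha> * ((1/2) powr \<alpha>) ^ j + 3 powr \<alpha> * (1 / real n) powr \<alpha>))"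
    proof (rule sum_mono)
      fix j
      show "2 * c j \<le> 4 * ((8 * \<tau>) powr \<alpha> * \<delta> powr \<alpha> * ((1/2) powr \<alpha>) ^ j + 3 powr \<alpha> * (1 / real n) powr \<alpha>)"
        using cj[of j] by linarith
    qed
    also have "\<dots> = 4 * ((8 * \<tau>) powr \<alpha> * \<delta> powr \<alpha> * (\<Sum>j\<le>N. ((1/2) powr \<alpha>) ^ j) + 3 powr \<alpha> * (real (Suc N) * (1 / real n) powr \<alpha>))"
      by (simp add: sum_distrib_left sum.distrib algebra_simps)
    also have "\<dots> \<le> 4 * ((8 * \<tau>) powr \<alpha> * \<delta> powr \<alpha> * (1 / (1 - (1/2) powr \<alpha>)) + 3 powr \<alpha> * (K * \<delta> powr \<alpha>))"
    proof -
      have h: "0 < (1/2::real) powr \<alpha>" "(1/2::real) powr \<alpha> < 1"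
        using \<alpha> powr_less_mono2[of \<alpha> "1/2" "1::real"] by auto
      have "(\<Sum>j\<le>N. ((1/2::real) powr \<alpha>) ^ j) \<le> (\<Sum>j. ((1/2) powr \<alpha>) ^ j)"
        using h by (intro sum_le_suminf summable_geometric) auto
      also have "\<dots> = 1 / (1 - (1/2) powr \<alpha>)" using h by (intro suminf_geometric) auto
      finally show ?thesis using K by (intro mult_left_mono add_mono) auto
    qed
    finally have "L \<le> C * \<delta> powr \<alpha>"
      by (simp add: L_def C_def cB_def algebra_simps)
    then have "L powr q \<le> (C * \<delta> powr \<alpha>) powr q" using L0 q by (intro powr_mono2) auto
    also have "\<dots> = C powr q * \<delta> powr (q/2 - 1)"
    proof -
      have "0 < C * \<delta> powr \<alpha>" using L0 \<open>L \<le> C * \<delta> powr \<alpha>\<close> by linarith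
      then have "0 < C" using \<delta> by (simp add: zero_less_mult_iff)
      then show ?thesis by (simp add: powr_mult powr_powr \<alpha>)
    qed
    finally show ?thesis using \<Delta> by (intro mult_right_mono) auto
  qed
  finally have "(\<integral>z. V z \<partial>PM) \<le> 2 * C powr q * \<delta> powr (q/2 - 1) * \<Delta>" by simp
  then have "(\<integral>\<^sup>+z. ennreal (V z) \<partial>PM) \<le> ennreal (2 * C powr q * \<delta> powr (q/2 - 1) * \<Delta>)"
    using V0 by (subst nn_integral_eq_integral[OF intV]) (auto intro: ennreal_leI)
  then show ?thesis
    using Vm V0 bound unfolding t' t_def[symmetric] \<Delta>_def by blast
qed

text \<open>The relation between \<open>n\<close>, the depth and \<open>\<delta>\<close> enters only
  through \<open>K\<close>, so the constant is uniform in all three.\<close>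

lemma sup_emp_mart_moment:
  fixes q \<gamma> K :: real
  assumes q: "2 < q" "q < 4" and \<gamma>: "0 \<le> \<gamma>"
    and mom: "(\<integral>\<^sup>+x. ennreal ((1 + \<bar>Xh x\<bar>) powr \<gamma>) \<partial>PM) < \<infinity>"
  obtains C :: real where "0 \<le> C"
    "\<And>(n::nat) (N::nat) \<delta>::real. \<lbrakk>1 \<le> n; real n \<le> 2 ^ N; 0 < \<delta>; \<delta> < 1/2;
        real (Suc N) * (1 / real n) powr (1/2 - 1/q) \<le> K * \<delta> powr (1/2 - 1/q)\<rbrakk> \<Longrightarrow>
      \<exists>Z\<in>borel_measurable PM.
        (\<forall>z t s. \<bar>s\<bar> \<le> \<delta> \<longrightarrow>
          ennreal ((1 + \<bar>t\<bar>) powr (2 * \<gamma> / q) * (emp_mart n (t + s) z - emp_mart n t z)\<^sup>2) \<le> Z z) \<and>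
        (\<integral>\<^sup>+z. Z z \<partial>PM) \<le> ennreal (C * \<delta> powr (1 - 2/q))"
proof -
  define \<alpha> where "\<alpha> = 1/2 - 1/q"
  define C1 where "C1 = 2 * (4 * ((8 * \<tau>) powr \<alpha> / (1 - (1/2) powr \<alpha>) + 3 powr \<alpha> * K) + \<tau>) powr q"
  have C1: "0 \<le> C1" by (simp add: C1_def)
  define m where "m = enn2real (\<integral>\<^sup>+x. ennreal ((1 + \<bar>Xh x\<bar>) powr \<gamma>) \<partial>PM)"
  have m: "0 \<le> m" "(\<integral>\<^sup>+x. ennreal ((1 + \<bar>Xh x\<bar>) powr \<gamma>) \<partial>PM) = ennreal m"
    using mom by (auto simp: m_def less_top)
  define C where "C = 9 * 2 powr \<gamma> * (C1 * 2 powr \<gamma> * m + 1)"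
  show thesis
  proof (rule that[of C])
    show "0 \<le> C" using C1 m by (auto simp: C_def)
    fix n N :: nat and \<delta> :: real
    assume n: "1 \<le> n" "real n \<le> 2 ^ N" and \<delta>: "0 < \<delta>" "\<delta> < 1/2"
      and K: "real (Suc N) * (1 / real n) powr (1/2 - 1/q) \<le> K * \<delta> powr (1/2 - 1/q)"
    define a where "a = \<delta> powr (q/2 - 1)"
    have a: "0 < a" using \<delta> by (simp add: a_def)
    have a\<theta>: "a powr (2/q) = \<delta> powr (1 - 2/q)"
    proof -
      have "(q/2 - 1) * (2/q) = 1 - 2/q" using q by (simp add: field_simps)
      then show ?thesis by (simp add: a_def powr_powr)
    qed
    have "\<forall>k::int. \<exists>V. V \<in> borel_measurable PM \<and> (\<forall>z. 0 \<le> V z) \<and>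
      (\<forall>z s. of_int k * \<delta> \<le> s \<longrightarrow> s \<le> (of_int k + 1) * \<delta> \<longrightarrow> \<bar>emp_mart n s z - emp_mart n (of_int k * \<delta>) z\<bar> powr q \<le> V z) \<and>
      (\<integral>\<^sup>+z. ennreal (V z) \<partial>PM) \<le> ennreal (C1 * a * (F ((of_int k + 1) * \<delta>) - F (of_int k * \<delta>)))"
      unfolding C1_def \<alpha>_def a_def using block_moment[OF n _ _ q K] \<delta> by auto
    then obtain V where Vm [measurable]: "\<And>k::int. V k \<in> borel_measurable PM" and V0: "\<And>k z. 0 \<le> V k z"
      and V: "\<And>k z s. of_int k * \<delta> \<le> s \<Longrightarrow> s \<le> (of_int k + 1) * \<delta> \<Longrightarrow> \<bar>emp_mart n s z - emp_mart n (of_int k * \<delta>) z\<bar> powr q \<le> V k z"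
      and VI: "\<And>k. (\<integral>\<^sup>+z. ennreal (V k z) \<partial>PM) \<le> ennreal (C1 * a * (F ((of_int k + 1) * \<delta>) - F (of_int k * \<delta>)))"
      unfolding choice_iff by blast
    \<comment> \<open>A sum over all blocks, enumerated by \<open>int_decode\<close>, in place of a
      supremum. It dominates every weighted block at once, and its expectation stays finite because
      the block bounds carry disjoint masses.\<close>
    define Y where "Y z = (\<Sum>i. ennreal ((1 + \<bar>of_int (int_decode i) * \<delta>\<bar>) powr \<gamma> * V (int_decode i) z))" for z
    have [measurable]: "Y \<in> borel_measurable PM" unfolding Y_def by measurable
    have VY: "ennreal ((1 + \<bar>of_int k * \<delta>\<bar>) powr \<gamma> * V k z) \<le> Y z" for k z
      using sum_le_suminf[of "\<lambda>i. ennreal ((1 + \<bar>of_int (int_decode i) * \<delta>\<bar>) powr \<gamma> * V (int_decode i) z)" "{int_encode k}"]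
      by (simp add: Y_def)
    have YI: "(\<integral>\<^sup>+z. Y z \<partial>PM) \<le> ennreal (C1 * a * 2 powr \<gamma> * m)"
    proof -
      define A where "A i = {of_int (int_decode i) * \<delta> <.. (of_int (int_decode i) + 1) * \<delta>}" for i
      have Am [measurable]: "A i \<in> sets borel" for i by (simp add: A_def)
      have disj: "disjoint_family A"
        unfolding disjoint_family_on_def
      proof (intro ballI impI)
        fix i j :: nat assume "i \<noteq> j"
        then have ne: "int_decode i \<noteq> int_decode j" using inj_int_decode by (auto dest: injD)
        have "False" if "x \<in> A i" "x \<in> A j" for x
        proof -
          from that have "real_of_int (int_decode i) * \<delta> < (of_int (int_decode j) + 1) * \<delta>"
            "real_of_int (int_decode j) * \<delta> < (of_int (int_decode i) + 1) * \<delta>" by (auto simp: A_def)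
          then have "real_of_int (int_decode i) < of_int (int_decode j) + 1"
            "real_of_int (int_decode j) < of_int (int_decode i) + 1" using \<delta> by auto
          with ne show False by linarith
        qed
        then show "A i \<inter> A j = {}" by auto
      qed
      \<comment> \<open>Inside a block the weight at the left end point is at most
        \<open>2 powr \<gamma>\<close> times the weight at the observation, so weight times mass
        becomes a piece of the moment of \<open>Xh\<close>.\<close>
      have block: "(\<integral>\<^sup>+z. ennreal ((1 + \<bar>of_int (int_decode i) * \<delta>\<bar>) powr \<gamma> * V (int_decode i) z) \<partial>PM)
          \<le> ennreal (C1 * a * 2 powr \<gamma>) * (\<integral>\<^sup>+x. ennreal ((1 + \<bar>Xh x\<bar>) powr \<gamma>) * indicator (A i) (Xh x) \<partial>PM)" for i
      proof -
        define w where "w = (1 + \<bar>real_of_int (int_decode i) * \<delta>\<bar>) powr \<gamma>"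
        have w0: "0 \<le> w" by (simp add: w_def)
        have ord: "of_int (int_decode i) * \<delta> \<le> (of_int (int_decode i) + 1) * \<delta>" using \<delta> by simp
        have "(\<integral>\<^sup>+z. ennreal (w * V (int_decode i) z) \<partial>PM) = ennreal w * (\<integral>\<^sup>+z. ennreal (V (int_decode i) z) \<partial>PM)"
          using w0 V0 by (simp add: ennreal_mult nn_integral_cmult)
        also have "\<dots> \<le> ennreal w * ennreal (C1 * a * (F ((of_int (int_decode i) + 1) * \<delta>) - F (of_int (int_decode i) * \<delta>)))"
          by (intro mult_left_mono VI) simp
        also have "\<dots> = ennreal (C1 * a) * (ennreal w * ennreal (\<integral>x. indicator (A i) (Xh x) \<partial>PM))"
          using C1 a F_mono[OF ord] unfolding A_def integral_interval[OF ord]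
          by (simp add: ennreal_mult mult.left_commute)
        also have "ennreal (\<integral>x. indicator (A i) (Xh x) \<partial>PM) = (\<integral>\<^sup>+x. ennreal (indicator (A i) (Xh x)) \<partial>PM)"
          by (intro nn_integral_eq_integral[symmetric] PP.integrable_const_bound[where B=1]) auto
        also have "ennreal w * \<dots> = (\<integral>\<^sup>+x. ennreal w * indicator (A i) (Xh x) \<partial>PM)"
          by (subst nn_integral_cmult) (auto simp: ennreal_indicator)
        also have "\<dots> \<le> (\<integral>\<^sup>+x. ennreal (2 powr \<gamma>) * (ennreal ((1 + \<bar>Xh x\<bar>) powr \<gamma>) * indicator (A i) (Xh x)) \<partial>PM)"
        proof (rule nn_integral_mono)
          fix x
          show "ennreal w * indicator (A i) (Xh x) \<le> ennreal (2 powr \<gamma>) * (ennreal ((1 + \<bar>Xh x\<bar>) powr \<gamma>) * indicator (A i) (Xh x))"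
          proof (cases "Xh x \<in> A i")
            case True
            then have "\<bar>of_int (int_decode i) * \<delta> - Xh x\<bar> \<le> 1"
              using \<delta> by (auto simp: A_def algebra_simps)
            from powr_weight_le[OF this \<gamma>] show ?thesis
              using True by (simp add: w_def ennreal_leI flip: ennreal_mult)
          qed simp
        qed
        also have "\<dots> = ennreal (2 powr \<gamma>) * (\<integral>\<^sup>+x. ennreal ((1 + \<bar>Xh x\<bar>) powr \<gamma>) * indicator (A i) (Xh x) \<partial>PM)"
          by (rule nn_integral_cmult) measurable
        finally show ?thesis
          using C1 a by (simp add: w_def ennreal_mult mult.assoc mult_left_mono)
      qed
      have "(\<integral>\<^sup>+z. Y z \<partial>PM) = (\<Sum>i. \<integral>\<^sup>+z. ennreal ((1 + \<bar>of_int (int_decode i) * \<delta>\<bar>) powr \<gamma> * V (int_decode i) z) \<partial>PM)"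
        unfolding Y_def by (rule nn_integral_suminf) measurable
      also have "\<dots> \<le> (\<Sum>i. ennreal (C1 * a * 2 powr \<gamma>) * (\<integral>\<^sup>+x. ennreal ((1 + \<bar>Xh x\<bar>) powr \<gamma>) * indicator (A i) (Xh x) \<partial>PM))"
        by (intro suminf_le block) auto
      also have "\<dots> = ennreal (C1 * a * 2 powr \<gamma>) * (\<integral>\<^sup>+x. (\<Sum>i. ennreal ((1 + \<bar>Xh x\<bar>) powr \<gamma>) * indicator (A i) (Xh x)) \<partial>PM)"
        by (subst nn_integral_suminf) auto
      also have "\<dots> \<le> ennreal (C1 * a * 2 powr \<gamma>) * (\<integral>\<^sup>+x. ennreal ((1 + \<bar>Xh x\<bar>) powr \<gamma>) \<partial>PM)"
      proof (intro mult_left_mono nn_integral_mono)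
        fix x
        have "(\<Sum>i. ennreal ((1 + \<bar>Xh x\<bar>) powr \<gamma>) * indicator (A i) (Xh x))
            = ennreal ((1 + \<bar>Xh x\<bar>) powr \<gamma>) * indicator (\<Union>i. A i) (Xh x)"
          using suminf_indicator[OF disj, of "Xh x"] by simp
        also have "\<dots> \<le> ennreal ((1 + \<bar>Xh x\<bar>) powr \<gamma>)" by (simp add: indicator_def)
        finally show "(\<Sum>i. ennreal ((1 + \<bar>Xh x\<bar>) powr \<gamma>) * indicator (A i) (Xh x)) \<le> ennreal ((1 + \<bar>Xh x\<bar>) powr \<gamma>)" .
      qed simp
      also have "\<dots> = ennreal (C1 * a * 2 powr \<gamma> * m)"
        using C1 a m by (simp add: ennreal_mult)
      finally show ?thesis .
    qed
    \<comment> \<open>\<open>Y\<close> has expectation of order \<open>a\<close>. Its concave power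
      \<open>2/q\<close> is bounded linearly by \<open>a powr (2/q - 1) * Y + a powr (2/q)\<close>,
      whose expectation is of order \<open>a powr (2/q) = \<delta> powr (1 - 2/q)\<close>. The 9 is
      the square of the three increments.\<close>
    define Z where "Z z = ennreal (9 * 2 powr \<gamma>) * (ennreal (a powr (2/q - 1)) * Y z + ennreal (a powr (2/q)))" for z
    have [measurable]: "Z \<in> borel_measurable PM" unfolding Z_def by measurable
    have "ennreal ((1 + \<bar>t\<bar>) powr (2 * \<gamma> / q) * (emp_mart n (t + s) z - emp_mart n t z)\<^sup>2) \<le> Z z" if s: "\<bar>s\<bar> \<le> \<delta>" for z t s
    proof (cases "Y z = \<infinity>")
      case True
      then show ?thesis using a by (simp add: Z_def ennreal_mult_top ennreal_top_mult)
    next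
      case False
      define \<zeta> where "\<zeta> = enn2real (Y z)"
      have \<zeta>: "0 \<le> \<zeta>" "Y z = ennreal \<zeta>" using False by (auto simp: \<zeta>_def less_top)
      define W where "W = (1 + \<bar>t\<bar>) powr \<gamma>"
      have W: "0 < W" by (simp add: W_def)
      define \<rho> where "\<rho> = (2 powr \<gamma> * \<zeta> / W) powr (1/q)"
      have "\<bar>emp_mart n (t + s) z - emp_mart n t z\<bar> \<le> 3 * \<rho>"
      proof (rule three_block_increment[where g="\<lambda>s. emp_mart n s z", OF \<delta>(1) s])
        fix k :: int and u
        assume k: "\<bar>t - of_int k * \<delta>\<bar> \<le> 2 * \<delta>" and u: "of_int k * \<delta> \<le> u" "u \<le> (of_int k + 1) * \<delta>"
        \<comment> \<open>The blocks involved start within \<open>2 * \<delta> < 1\<close> of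
          \<open>t\<close>, so the weight at \<open>t\<close> may be moved to the block.\<close>
        have "W * V k z \<le> 2 powr \<gamma> * (1 + \<bar>of_int k * \<delta>\<bar>) powr \<gamma> * V k z"
          unfolding W_def using k \<delta> \<gamma> V0 by (intro mult_right_mono powr_weight_le) auto
        also have "(1 + \<bar>of_int k * \<delta>\<bar>) powr \<gamma> * V k z \<le> \<zeta>"
          using VY[of k z] \<zeta> V0 by simp
        then have "2 powr \<gamma> * (1 + \<bar>of_int k * \<delta>\<bar>) powr \<gamma> * V k z \<le> 2 powr \<gamma> * \<zeta>"
          by (simp add: mult.assoc)
        finally have "V k z \<le> 2 powr \<gamma> * \<zeta> / W" using W by (simp add: pos_le_divide_eq mult.commute)
        then have "\<bar>emp_mart n u z - emp_mart n (of_int k * \<delta>) z\<bar> powr q \<le> 2 powr \<gamma> * \<zeta> / W"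
          using V[OF u, of z] by linarith
        then have "(\<bar>emp_mart n u z - emp_mart n (of_int k * \<delta>) z\<bar> powr q) powr (1/q) \<le> \<rho>"
          unfolding \<rho>_def using q by (intro powr_mono2) auto
        then show "\<bar>emp_mart n u z - emp_mart n (of_int k * \<delta>) z\<bar> \<le> \<rho>" using q by (simp add: powr_powr)
      qed
      then have "\<bar>emp_mart n (t + s) z - emp_mart n t z\<bar>\<^sup>2 \<le> (3 * \<rho>)\<^sup>2" by (intro power_mono) auto
      then have "(1 + \<bar>t\<bar>) powr (2 * \<gamma> / q) * (emp_mart n (t + s) z - emp_mart n t z)\<^sup>2 \<le> W powr (2/q) * (9 * \<rho>\<^sup>2)"
        unfolding W_def by (intro mult_mono) (auto simp: powr_powr power_mult_distrib mult.commute)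
      also have "\<rho>\<^sup>2 = (2 powr \<gamma> * \<zeta> / W) powr (2/q)"
        by (simp add: \<rho>_def power2_eq_square powr_add[symmetric])
      also have "W powr (2/q) * (9 * (2 powr \<gamma> * \<zeta> / W) powr (2/q)) = 9 * (2 powr (\<gamma> * (2/q)) * \<zeta> powr (2/q))"
        using W \<zeta> by (simp add: powr_divide powr_mult powr_powr)
      also have "\<dots> \<le> 9 * (2 powr \<gamma> * (a powr (2/q - 1) * \<zeta> + a powr (2/q)))"
      proof (intro mult_left_mono mult_mono)
        have "\<gamma> * (2/q) \<le> \<gamma> * 1" using q \<gamma> by (intro mult_left_mono) auto
        then show "(2::real) powr (\<gamma> * (2/q)) \<le> 2 powr \<gamma>" by (intro powr_mono) auto
        show "\<zeta> powr (2/q) \<le> a powr (2/q - 1) * \<zeta> + a powr (2/q)"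
        proof (cases "\<zeta> \<le> a")
          case True
          then have "\<zeta> powr (2/q) \<le> a powr (2/q)" using \<zeta> q by (intro powr_mono2) auto
          then show ?thesis using \<zeta> by (simp add: add_increasing)
        next
          case False
          have "\<zeta> powr (2/q) = \<zeta> powr (2/q - 1) * \<zeta>"
            using False a powr_add[of \<zeta> "2/q - 1" 1] by simp
          also have "\<dots> \<le> a powr (2/q - 1) * \<zeta>"
            using False a q by (intro mult_right_mono powr_mono2') auto
          finally show ?thesis by (simp add: add_increasing2)
        qed
      qed auto
      finally have "(1 + \<bar>t\<bar>) powr (2 * \<gamma> / q) * (emp_mart n (t + s) z - emp_mart n t z)\<^sup>2 \<le> 9 * 2 powr \<gamma> * (a powr (2/q - 1) * \<zeta> + a powr (2/q))"
        by simp
      then have "ennreal ((1 + \<bar>t\<bar>) powr (2 * \<gamma> / q) * (emp_mart n (t + s) z - emp_mart n t z)\<^sup>2)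
          \<le> ennreal (9 * 2 powr \<gamma> * (a powr (2/q - 1) * \<zeta> + a powr (2/q)))" by (rule ennreal_leI)
      also have "\<dots> = Z z"
        unfolding Z_def \<zeta>(2) using \<zeta>(1) by (simp add: ennreal_mult)
      finally show ?thesis .
    qed
    moreover have "(\<integral>\<^sup>+z. Z z \<partial>PM) \<le> ennreal (C * \<delta> powr (1 - 2/q))"
    proof -
      have "(\<integral>\<^sup>+z. Z z \<partial>PM) = ennreal (9 * 2 powr \<gamma>) * (ennreal (a powr (2/q - 1)) * (\<integral>\<^sup>+z. Y z \<partial>PM) + ennreal (a powr (2/q)))"
        unfolding Z_def by (simp add: nn_integral_cmult nn_integral_add)
      also have "\<dots> \<le> ennreal (9 * 2 powr \<gamma>) * (ennreal (a powr (2/q - 1)) * ennreal (C1 * a * 2 powr \<gamma> * m) + ennreal (a powr (2/q)))"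
        by (intro mult_left_mono add_mono YI) auto
      also have "\<dots> = ennreal (9 * 2 powr \<gamma> * (a powr (2/q - 1) * (C1 * a * 2 powr \<gamma> * m) + a powr (2/q)))"
        using C1 a m by (simp add: ennreal_mult)
      also have "a powr (2/q - 1) * (C1 * a * 2 powr \<gamma> * m) = (a powr (2/q - 1) * a) * (C1 * 2 powr \<gamma> * m)"
        by simp
      also have "a powr (2/q - 1) * a = a powr (2/q)"
        using a powr_add[of a "2/q - 1" 1] by simp
      also have "9 * 2 powr \<gamma> * (a powr (2/q) * (C1 * 2 powr \<gamma> * m) + a powr (2/q)) = C * \<delta> powr (1 - 2/q)"
        unfolding a\<theta> C_def by (simp add: algebra_simps)
      finally show ?thesis .
    qed
    ultimately show "\<exists>Z\<in>borel_measurable PM.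
        (\<forall>z t s. \<bar>s\<bar> \<le> \<delta> \<longrightarrow>
          ennreal ((1 + \<bar>t\<bar>) powr (2 * \<gamma> / q) * (emp_mart n (t + s) z - emp_mart n t z)\<^sup>2) \<le> Z z) \<and>
        (\<integral>\<^sup>+z. Z z \<partial>PM) \<le> ennreal (C * \<delta> powr (1 - 2/q))"
      by (intro bexI[of _ Z]) auto
  qed
qed

end

section \<open>Weighted Sobolev bounds\<close>

lemma nn_integral_weight_measure:
  assumes [measurable]: "f \<in> borel_measurable borel"
  shows "(\<integral>\<^sup>+u. f u \<partial>weight_measure l) = (\<integral>\<^sup>+u. ennreal ((1 + \<bar>u\<bar>) powr l) * f u \<partial>lborel)"
  unfolding weight_measure_def by (rule nn_integral_density) auto

text \<open>Cauchy-Schwarz for a gauge integral. If the square integral of \<open>h'\<close> over a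
  proper interval is infinite the claim is trivial. Otherwise \<open>h'\<close> is Lebesgue
  integrable there and the two integrals agree.\<close>

lemma square_increment_le:
  fixes h h' :: "real \<Rightarrow> real"
  assumes [measurable]: "h' \<in> borel_measurable borel" and xy: "x \<le> y"
    and h: "(h' has_integral (h y - h x)) {x..y}"
  shows "ennreal ((h y - h x)\<^sup>2) \<le> ennreal (y - x) * (\<integral>\<^sup>+u. ennreal ((h' u)\<^sup>2) * indicator {x..y} u \<partial>lborel)"
proof (cases "x = y \<or> (\<integral>\<^sup>+u. ennreal ((h' u)\<^sup>2) * indicator {x..y} u \<partial>lborel) = \<infinity>")
  case True
  with xy show ?thesis by (auto simp: ennreal_mult_top)
next
  case False
  define I where "I = (\<integral>\<^sup>+u. ennreal ((h' u)\<^sup>2) * indicator {x..y} u \<partial>lborel)"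
  have I: "I < \<infinity>" using False by (simp add: I_def less_top)
  have "set_integrable lborel {x..y} h'"
    unfolding set_integrable_def
  proof (rule integrableI_bounded)
    have "(\<integral>\<^sup>+u. ennreal (norm (indicator {x..y} u *\<^sub>R h' u)) \<partial>lborel)
      \<le> (\<integral>\<^sup>+u. indicator {x..y} u + ennreal ((h' u)\<^sup>2) * indicator {x..y} u \<partial>lborel)"
    proof (rule nn_integral_mono)
      fix u
      have "\<bar>a\<bar> \<le> 1 + a\<^sup>2" for a :: real
        using sum_squares_bound[of 1 "\<bar>a\<bar>"] by simp
      then have "ennreal \<bar>h' u\<bar> \<le> ennreal (1 + (h' u)\<^sup>2)" by (rule ennreal_leI)
      also have "\<dots> = ennreal 1 + ennreal ((h' u)\<^sup>2)" by (rule ennreal_plus) auto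
      finally have "ennreal \<bar>h' u\<bar> \<le> ennreal 1 + ennreal ((h' u)\<^sup>2)" .
      then show "ennreal (norm (indicator {x..y} u *\<^sub>R h' u)) \<le> indicator {x..y} u + ennreal ((h' u)\<^sup>2) * indicator {x..y} u"
        by (simp add: indicator_def)
    qed
    also have "\<dots> = ennreal (y - x) + I"
      unfolding I_def using xy by (subst nn_integral_add) auto
    also have "\<dots> < \<infinity>" using I by simp
    finally show "(\<integral>\<^sup>+u. ennreal (norm (indicator {x..y} u *\<^sub>R h' u)) \<partial>lborel) < \<infinity>" .
  qed measurable
  from set_borel_integral_eq_integral(2)[OF this]
  have "h y - h x = (\<integral>u. indicator {x..y} u *\<^sub>R h' u \<partial>lborel)"
    using h by (simp add: set_lebesgue_integral_def integral_unique)
  then have "ennreal \<bar>h y - h x\<bar> \<le> (\<integral>\<^sup>+u. ennreal (norm (indicator {x..y} u *\<^sub>R h' u)) \<partial>lborel)"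
    using integral_norm_bound_ennreal[of lborel "\<lambda>u. indicator {x..y} u *\<^sub>R h' u"]
      \<open>set_integrable lborel {x..y} h'\<close> by (simp add: set_integrable_def)
  also have "\<dots> = (\<integral>\<^sup>+u. (ennreal \<bar>h' u\<bar> * indicator {x..y} u) * indicator {x..y} u \<partial>lborel)"
    by (intro nn_integral_cong) (simp add: indicator_def)
  finally have "(ennreal \<bar>h y - h x\<bar>)\<^sup>2 \<le> (\<integral>\<^sup>+u. (ennreal \<bar>h' u\<bar> * indicator {x..y} u) * indicator {x..y} u \<partial>lborel)\<^sup>2"
    by (intro power_mono) auto
  also have "\<dots> \<le> (\<integral>\<^sup>+u. (ennreal \<bar>h' u\<bar> * indicator {x..y} u)\<^sup>2 \<partial>lborel) * (\<integral>\<^sup>+u. (indicator {x..y} u)\<^sup>2 \<partial>lborel)"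
    by (rule Cauchy_Schwarz_nn_integral) measurable
  also have "(\<integral>\<^sup>+u. (ennreal \<bar>h' u\<bar> * indicator {x..y} u)\<^sup>2 \<partial>lborel) = I"
    unfolding I_def by (intro nn_integral_cong) (simp add: indicator_def ennreal_power)
  also have "(\<integral>\<^sup>+u. (indicator {x..y} u)\<^sup>2 \<partial>lborel) = ennreal (y - x)"
    using xy by (subst nn_integral_cong[where v="indicator {x..y}"]) (auto simp: indicator_def)
  finally show ?thesis by (simp add: I_def ennreal_power mult.commute)
qed

text \<open>The range of \<open>y\<close> gives \<open>1 + x \<le> 1 + y \<le> 2 * (1 + x)\<close>;
  the sign of \<open>\<nu>\<close> decides which of the two bounds is used.\<close>

lemma powr_weight_comparable:
  fixes x y \<nu> :: real
  assumes "0 \<le> x" "x \<le> y" "y \<le> x + (1 + x)"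
  shows "(1 + x) powr \<nu> \<le> 2 powr \<bar>\<nu>\<bar> * (1 + y) powr \<nu>"
proof (cases "0 \<le> \<nu>")
  case True
  have "(1 + x) powr \<nu> \<le> (1 + y) powr \<nu>" using assms True by (intro powr_mono2) auto
  also have "\<dots> \<le> 2 powr \<bar>\<nu>\<bar> * (1 + y) powr \<nu>"
    using ge_one_powr_ge_zero[of 2 "\<bar>\<nu>\<bar>"] mult_right_mono[of 1 "2 powr \<bar>\<nu>\<bar>" "(1 + y) powr \<nu>"] by simp
  finally show ?thesis .
next
  case False
  have "(1 + x) powr \<nu> = 2 powr \<bar>\<nu>\<bar> * (2 * (1 + x)) powr \<nu>"
  proof -
    have "(2 * (1 + x)) powr \<nu> = 2 powr \<nu> * (1 + x) powr \<nu>" by (rule powr_mult)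
    moreover have "(2::real) powr \<bar>\<nu>\<bar> * 2 powr \<nu> = 1" using False by (simp add: powr_add[symmetric])
    ultimately show ?thesis by (simp add: mult.assoc[symmetric])
  qed
  also have "\<dots> \<le> 2 powr \<bar>\<nu>\<bar> * (1 + y) powr \<nu>"
    using assms False by (intro mult_left_mono powr_mono2') auto
  finally show ?thesis .
qed

text \<open>Average over the interval of length \<open>(1 + x)\<^sup>\<mu>\<close> to the right of \<open>x\<close>.  As \<open>\<mu> \<le> 1\<close>, the weight
  is constant up to a factor on this interval.\<close>
lemma weighted_sup_bound_nonneg:
  fixes h h' :: "real \<Rightarrow> real" and l \<mu> x :: real
  assumes [measurable]: "h \<in> borel_measurable borel" "h' \<in> borel_measurable borel"
    and h: "\<And>u v. u \<le> v \<Longrightarrow> (h' has_integral (h v - h u)) {u..v}"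
    and \<mu>: "\<mu> \<le> 1" and x: "0 \<le> x"
  shows "ennreal ((1 + x) powr l * (h x)\<^sup>2) \<le> ennreal (2 * 2 powr (\<bar>l - \<mu>\<bar> + \<bar>l + \<mu>\<bar>)) *
    ((\<integral>\<^sup>+u. ennreal ((1 + \<bar>u\<bar>) powr (l - \<mu>)) * ennreal ((h u)\<^sup>2) \<partial>lborel) +
     (\<integral>\<^sup>+u. ennreal ((1 + \<bar>u\<bar>) powr (l + \<mu>)) * ennreal ((h' u)\<^sup>2) \<partial>lborel))"
proof -
  define L where "L = (1 + x) powr \<mu>"
  have L: "0 < L" "L \<le> 1 + x" using x \<mu> powr_mono[of \<mu> 1 "1 + x"] by (auto simp: L_def)
  define J where "J = {x..x + L}"
  have Jm [measurable]: "J \<in> sets borel" by (simp add: J_def)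
  define I1 where "I1 = (\<integral>\<^sup>+u. ennreal ((h u)\<^sup>2) * indicator J u \<partial>lborel)"
  define I2 where "I2 = (\<integral>\<^sup>+u. ennreal ((h' u)\<^sup>2) * indicator J u \<partial>lborel)"
  have pt: "ennreal ((h x)\<^sup>2) \<le> 2 * ennreal ((h y)\<^sup>2) + 2 * (ennreal L * I2)" if y: "y \<in> J" for y
  proof -
    have xy: "x \<le> y" "y - x \<le> L" using y by (auto simp: J_def)
    have "(h x)\<^sup>2 \<le> 2 * (h y)\<^sup>2 + 2 * (h y - h x)\<^sup>2"
    proof -
      have "0 \<le> (2 * h y - h x)\<^sup>2" by simp
      then show ?thesis by (simp add: power2_eq_square algebra_simps)
    qed
    then have "ennreal ((h x)\<^sup>2) \<le> ennreal (2 * (h y)\<^sup>2 + 2 * (h y - h x)\<^sup>2)" by (rule ennreal_leI)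
    also have "\<dots> = 2 * ennreal ((h y)\<^sup>2) + 2 * ennreal ((h y - h x)\<^sup>2)"
      by (simp add: ennreal_plus ennreal_mult)
    also have "ennreal ((h y - h x)\<^sup>2) \<le> ennreal (y - x) * (\<integral>\<^sup>+u. ennreal ((h' u)\<^sup>2) * indicator {x..y} u \<partial>lborel)"
      by (rule square_increment_le[OF _ xy(1) h[OF xy(1)]]) measurable
    also have "\<dots> \<le> ennreal L * I2"
      unfolding I2_def using xy y
      by (intro mult_mono nn_integral_mono ennreal_leI) (auto simp: J_def indicator_def)
    finally show ?thesis by (simp add: mult_left_mono add_left_mono)
  qed
  have "ennreal L * ennreal ((h x)\<^sup>2) = (\<integral>\<^sup>+y. ennreal ((h x)\<^sup>2) * indicator J y \<partial>lborel)"
    using L by (simp add: nn_integral_cmult J_def mult.commute)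
  also have "\<dots> \<le> (\<integral>\<^sup>+y. 2 * (ennreal ((h y)\<^sup>2) * indicator J y) + 2 * (ennreal L * I2) * indicator J y \<partial>lborel)"
    using pt by (intro nn_integral_mono) (auto simp: indicator_def)
  also have "\<dots> = 2 * I1 + 2 * (ennreal L * I2) * ennreal L"
    using L by (simp add: nn_integral_add nn_integral_cmult I1_def J_def)
  finally have LL: "ennreal L * ennreal ((h x)\<^sup>2) \<le> 2 * I1 + 2 * (ennreal L * I2) * ennreal L" .
  \<comment> \<open>The origin of the two weights: multiplying by
    \<open>L = (1 + x) powr \<mu>\<close> once raises the exponent \<open>l - \<mu>\<close> to
    \<open>l\<close>, and twice raises it to \<open>l + \<mu>\<close>.\<close>
  have split: "(1 + x) powr l = (1 + x) powr (l - \<mu>) * L" "(1 + x) powr (l - \<mu>) * L * L = (1 + x) powr (l + \<mu>)"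
    using x by (simp_all add: L_def powr_add[symmetric])
  have "ennreal ((1 + x) powr l * (h x)\<^sup>2) = ennreal ((1 + x) powr (l - \<mu>)) * (ennreal L * ennreal ((h x)\<^sup>2))"
    unfolding split(1) using L by (simp add: ennreal_mult mult.assoc)
  also have "\<dots> \<le> ennreal ((1 + x) powr (l - \<mu>)) * (2 * I1 + 2 * (ennreal L * I2) * ennreal L)"
    by (intro mult_left_mono LL) simp
  also have "\<dots> = 2 * (ennreal ((1 + x) powr (l - \<mu>)) * I1 + ennreal ((1 + x) powr (l - \<mu>) * L * L) * I2)"
    using L by (simp add: ennreal_mult distrib_left mult.assoc mult.commute mult.left_commute)
  also have "\<dots> = 2 * (ennreal ((1 + x) powr (l - \<mu>)) * I1 + ennreal ((1 + x) powr (l + \<mu>)) * I2)"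
    unfolding split(2) ..
  also have "\<dots> \<le> 2 * (ennreal (2 powr \<bar>l - \<mu>\<bar>) * (\<integral>\<^sup>+u. ennreal ((1 + \<bar>u\<bar>) powr (l - \<mu>)) * ennreal ((h u)\<^sup>2) \<partial>lborel) +
      ennreal (2 powr \<bar>l + \<mu>\<bar>) * (\<integral>\<^sup>+u. ennreal ((1 + \<bar>u\<bar>) powr (l + \<mu>)) * ennreal ((h' u)\<^sup>2) \<partial>lborel))"
  proof -
    have wt: "ennreal ((1 + x) powr \<nu>) * (\<integral>\<^sup>+u. ennreal ((k u)\<^sup>2) * indicator J u \<partial>lborel)
      \<le> ennreal (2 powr \<bar>\<nu>\<bar>) * (\<integral>\<^sup>+u. ennreal ((1 + \<bar>u\<bar>) powr \<nu>) * ennreal ((k u)\<^sup>2) \<partial>lborel)"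
      if [measurable]: "k \<in> borel_measurable borel" for \<nu> and k :: "real \<Rightarrow> real"
    proof -
      have "ennreal ((1 + x) powr \<nu>) * (\<integral>\<^sup>+u. ennreal ((k u)\<^sup>2) * indicator J u \<partial>lborel)
        = (\<integral>\<^sup>+u. ennreal ((1 + x) powr \<nu>) * (ennreal ((k u)\<^sup>2) * indicator J u) \<partial>lborel)"
        by (rule nn_integral_cmult[symmetric]) measurable
      also have "\<dots> \<le> (\<integral>\<^sup>+u. ennreal (2 powr \<bar>\<nu>\<bar>) * (ennreal ((1 + \<bar>u\<bar>) powr \<nu>) * ennreal ((k u)\<^sup>2)) \<partial>lborel)"
      proof (rule nn_integral_mono)
        fix u
        show "ennreal ((1 + x) powr \<nu>) * (ennreal ((k u)\<^sup>2) * indicator J u)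
          \<le> ennreal (2 powr \<bar>\<nu>\<bar>) * (ennreal ((1 + \<bar>u\<bar>) powr \<nu>) * ennreal ((k u)\<^sup>2))"
        proof (cases "u \<in> J")
          case True
          then have "(1 + x) powr \<nu> \<le> 2 powr \<bar>\<nu>\<bar> * (1 + \<bar>u\<bar>) powr \<nu>"
            using powr_weight_comparable[of x u \<nu>] x L by (auto simp: J_def)
          then have "ennreal ((1 + x) powr \<nu>) \<le> ennreal (2 powr \<bar>\<nu>\<bar>) * ennreal ((1 + \<bar>u\<bar>) powr \<nu>)"
            by (subst ennreal_mult[symmetric]) (auto intro: ennreal_leI)
          from mult_right_mono[OF this, of "ennreal ((k u)\<^sup>2)"] show ?thesis
            using True by (simp add: mult.assoc)
        qed simp
      qed
      also have "\<dots> = ennreal (2 powr \<bar>\<nu>\<bar>) * (\<integral>\<^sup>+u. ennreal ((1 + \<bar>u\<bar>) powr \<nu>) * ennreal ((k u)\<^sup>2) \<partial>lborel)"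
        by (rule nn_integral_cmult) measurable
      finally show ?thesis .
    qed
    show ?thesis
      unfolding I1_def I2_def by (intro mult_left_mono add_mono wt) auto
  qed
  also have "\<dots> \<le> 2 * (ennreal (2 powr (\<bar>l - \<mu>\<bar> + \<bar>l + \<mu>\<bar>)) * (\<integral>\<^sup>+u. ennreal ((1 + \<bar>u\<bar>) powr (l - \<mu>)) * ennreal ((h u)\<^sup>2) \<partial>lborel) +
      ennreal (2 powr (\<bar>l - \<mu>\<bar> + \<bar>l + \<mu>\<bar>)) * (\<integral>\<^sup>+u. ennreal ((1 + \<bar>u\<bar>) powr (l + \<mu>)) * ennreal ((h' u)\<^sup>2) \<partial>lborel))"
    by (intro mult_left_mono add_mono mult_right_mono ennreal_leI powr_mono) auto
  finally show ?thesis
    by (simp add: ennreal_mult distrib_left[symmetric] mult.assoc)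
qed

text \<open>Negative arguments follow by reflecting the function; the weights are even and the sign
  of the derivative disappears in its square.\<close>

lemma weighted_sup_bound:
  fixes h h' :: "real \<Rightarrow> real" and l \<mu> x :: real
  assumes [measurable]: "h \<in> borel_measurable borel" "h' \<in> borel_measurable borel"
    and h: "\<And>u v. u \<le> v \<Longrightarrow> (h' has_integral (h v - h u)) {u..v}"
    and \<mu>: "\<mu> \<le> 1"
  shows "ennreal ((1 + \<bar>x\<bar>) powr l * (h x)\<^sup>2) \<le> ennreal (2 * 2 powr (\<bar>l - \<mu>\<bar> + \<bar>l + \<mu>\<bar>)) *
    ((\<integral>\<^sup>+u. ennreal ((h u)\<^sup>2) \<partial>weight_measure (l - \<mu>)) + (\<integral>\<^sup>+u. ennreal ((h' u)\<^sup>2) \<partial>weight_measure (l + \<mu>)))"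
proof (cases "0 \<le> x")
  case True
  then show ?thesis
    using weighted_sup_bound_nonneg[OF assms(1-4) True, of l] by (simp add: nn_integral_weight_measure)
next
  case False
  define k where "k u = h (- u)" for u
  define k' where "k' u = - h' (- u)" for u
  have [measurable]: "k \<in> borel_measurable borel" "k' \<in> borel_measurable borel"
    unfolding k_def k'_def by measurable
  have k: "(k' has_integral (k v - k u)) {u..v}" if "u \<le> v" for u v
  proof -
    have "(h' has_integral (h (- u) - h (- v))) {- v..- u}" using h[of "- v" "- u"] that by simp
    then have "((\<lambda>x. h' (- x)) has_integral (h (- u) - h (- v))) {u..v}"
      using has_integral_reflect_real[of h' "h (- u) - h (- v)" "- u" "- v"] by simp
    then have "((\<lambda>x. - h' (- x)) has_integral - (h (- u) - h (- v))) {u..v}" by (rule has_integral_neg)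
    then show ?thesis by (simp add: k_def k'_def[abs_def])
  qed
  have refl: "(\<integral>\<^sup>+u. ennreal ((1 + \<bar>u\<bar>) powr \<nu>) * ennreal ((f (- u))\<^sup>2) \<partial>lborel)
      = (\<integral>\<^sup>+u. ennreal ((f u)\<^sup>2) \<partial>weight_measure \<nu>)"
    if [measurable]: "f \<in> borel_measurable borel" for f :: "real \<Rightarrow> real" and \<nu>
    using nn_integral_real_affine[of "\<lambda>u. ennreal ((1 + \<bar>u\<bar>) powr \<nu>) * ennreal ((f u)\<^sup>2)" "-1" 0]
    by (simp add: nn_integral_weight_measure)
  have "(\<integral>\<^sup>+u. ennreal ((1 + \<bar>u\<bar>) powr (l - \<mu>)) * ennreal ((k u)\<^sup>2) \<partial>lborel) = (\<integral>\<^sup>+u. ennreal ((h u)\<^sup>2) \<partial>weight_measure (l - \<mu>))"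
    unfolding k_def by (rule refl) measurable
  moreover have "(\<integral>\<^sup>+u. ennreal ((1 + \<bar>u\<bar>) powr (l + \<mu>)) * ennreal ((k' u)\<^sup>2) \<partial>lborel) = (\<integral>\<^sup>+u. ennreal ((h' u)\<^sup>2) \<partial>weight_measure (l + \<mu>))"
    unfolding k'_def power2_minus by (rule refl) measurable
  ultimately show ?thesis
    using weighted_sup_bound_nonneg[of k k' \<mu> "- x" l] k \<mu> False by (simp add: k_def)
qed

section \<open>Variance bounds integrated over the argument\<close>

lemma ensqrt_power2: "(ensqrt x)\<^sup>2 = x"
  by (cases x) (auto simp: ensqrt_def ennreal_power top_power_ennreal)

context path_space
begin

lemma CE_measurable_pair:
  assumes \<Phi>: "(\<lambda>(\<theta>, x). \<Phi> \<theta> x) \<in> borel_measurable (borel \<Otimes>\<^sub>M PM)"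
  shows "(\<lambda>(\<theta>, x). CE k (\<lambda>z. \<Phi> \<theta> (seq_shift j z)) x) \<in> borel_measurable (borel \<Otimes>\<^sub>M PM)"
proof -
  have [measurable]: "(\<lambda>p. \<Phi> (fst (fst p)) (seq_shift j (glue k (snd (fst p)) (snd p)))) \<in> borel_measurable ((borel \<Otimes>\<^sub>M PM) \<Otimes>\<^sub>M PM)"
    using measurable_compose[OF _ \<Phi>, of "\<lambda>p. (fst (fst p), seq_shift j (glue k (snd (fst p)) (snd p)))" "(borel \<Otimes>\<^sub>M PM) \<Otimes>\<^sub>M PM"]
    by simp
  show ?thesis
    unfolding CE_def CEn_def case_prod_beta by measurable
qed

text \<open>The weights \<open>t\<close> must not depend on \<open>\<theta>\<close>. With
  \<open>\<sigma> j\<close> the \<open>j\<close>-th term of the dependence sum and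
  \<open>t j \<ge> \<sigma> j\<close>, the integrated squared projection over \<open>t j\<close> is
  at most \<open>(\<sigma> j)\<^sup>2 / t j \<le> \<sigma> j\<close>, which is summable.\<close>

lemma weighted_variance_bound:
  fixes \<Phi> :: "real \<Rightarrow> (int \<Rightarrow> real) \<Rightarrow> real" and l :: real
  assumes \<Phi>: "(\<lambda>(\<theta>, x). \<Phi> \<theta> x) \<in> borel_measurable (borel \<Otimes>\<^sub>M PM)" and dep: "\<And>\<theta>. past_dep 0 (\<Phi> \<theta>)"
    and fin: "(\<Sum>j::nat. ensqrt (\<integral>\<^sup>+\<theta>. (\<integral>\<^sup>+x. ennreal ((CE 0 (\<lambda>z. \<Phi> \<theta> (seq_shift (int j) z)) x
        - CE (-1) (\<lambda>z. \<Phi> \<theta> (seq_shift (int j) z)) x)\<^sup>2) \<partial>PM) \<partial>weight_measure l)) < \<infinity>"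
  obtains K :: real where "0 \<le> K" "AE \<theta> in lborel. integrable PM (\<Phi> \<theta>)"
    "\<And>n. (\<integral>\<^sup>+\<theta>. (\<integral>\<^sup>+x. ennreal ((\<Sum>i<n. \<Phi> \<theta> (seq_shift (int i) x) - (\<integral>x. \<Phi> \<theta> x \<partial>PM))\<^sup>2) \<partial>PM) \<partial>weight_measure l)
       \<le> of_nat n * ennreal K"
proof -
  define \<Psi> where "\<Psi> j \<theta> x = CE 0 (\<lambda>z. \<Phi> \<theta> (seq_shift (int j) z)) x - CE (-1) (\<lambda>z. \<Phi> \<theta> (seq_shift (int j) z)) x" for j :: nat and \<theta> x
  have sW [measurable_cong]: "sets (weight_measure l) = sets borel" by (simp add: weight_measure_def)
  have \<Psi>m: "(\<lambda>(\<theta>, x). \<Psi> j \<theta> x) \<in> borel_measurable (borel \<Otimes>\<^sub>M PM)" for j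
    unfolding \<Psi>_def case_prod_beta
    using CE_measurable_pair[OF \<Phi>, of 0 "int j"] CE_measurable_pair[OF \<Phi>, of "-1" "int j"]
    by (simp add: case_prod_beta)
  have [measurable]: "(\<lambda>p. \<Psi> j (fst p) (snd p)) \<in> borel_measurable (borel \<Otimes>\<^sub>M PM)" for j
    using \<Psi>m[of j] by (simp add: case_prod_beta)
  define A where "A j \<theta> = (\<integral>\<^sup>+x. ennreal ((\<Psi> j \<theta> x)\<^sup>2) \<partial>PM)" for j \<theta>
  have Am [measurable]: "A j \<in> borel_measurable borel" for j
    unfolding A_def by measurable
  define \<sigma> where "\<sigma> j = enn2real (ensqrt (\<integral>\<^sup>+\<theta>. A j \<theta> \<partial>weight_measure l))" for j
  have fin': "(\<Sum>j. ensqrt (\<integral>\<^sup>+\<theta>. A j \<theta> \<partial>weight_measure l)) < \<infinity>"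
    using fin by (simp add: A_def \<Psi>_def)
  have \<sigma>: "ensqrt (\<integral>\<^sup>+\<theta>. A j \<theta> \<partial>weight_measure l) = ennreal (\<sigma> j)" for j
  proof -
    have "ensqrt (\<integral>\<^sup>+\<theta>. A j \<theta> \<partial>weight_measure l) \<le> (\<Sum>j. ensqrt (\<integral>\<^sup>+\<theta>. A j \<theta> \<partial>weight_measure l))"
      using sum_le_suminf[of "\<lambda>j. ensqrt (\<integral>\<^sup>+\<theta>. A j \<theta> \<partial>weight_measure l)" "{j}"] by simp
    then show ?thesis using fin' unfolding \<sigma>_def by (subst ennreal_enn2real) (auto simp: less_top)
  qed
  have \<sigma>0: "0 \<le> \<sigma> j" for j by (simp add: \<sigma>_def)
  have \<sigma>s: "summable \<sigma>"
    using fin' \<sigma>0 by (intro summable_suminf_not_top) (auto simp: \<sigma>)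
  have A: "(\<integral>\<^sup>+\<theta>. A j \<theta> \<partial>weight_measure l) = ennreal ((\<sigma> j)\<^sup>2)" for j
    using \<sigma>[of j] ensqrt_power2[of "\<integral>\<^sup>+\<theta>. A j \<theta> \<partial>weight_measure l"] \<sigma>0[of j] by (simp add: ennreal_power)
  \<comment> \<open>the second summand only keeps \<open>t j\<close> positive\<close>
  define t where "t j = \<sigma> j + (1/2) ^ j" for j
  have t: "\<And>j. 0 < t j" "summable t"
    using \<sigma>0 \<sigma>s by (auto simp: t_def[abs_def] intro!: add_nonneg_pos summable_add summable_geometric)
  define B where "B \<theta> = (\<Sum>j. \<integral>\<^sup>+x. ennreal ((\<Psi> j \<theta> x)\<^sup>2 / t j) \<partial>PM)" for \<theta>
  have Bm [measurable]: "B \<in> borel_measurable borel" unfolding B_def by measurable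
  have "(\<integral>\<^sup>+\<theta>. B \<theta> \<partial>weight_measure l) = (\<Sum>j. \<integral>\<^sup>+\<theta>. (\<integral>\<^sup>+x. ennreal ((\<Psi> j \<theta> x)\<^sup>2 / t j) \<partial>PM) \<partial>weight_measure l)"
    unfolding B_def by (rule nn_integral_suminf) measurable
  also have "\<dots> \<le> (\<Sum>j. ennreal (\<sigma> j))"
  proof (rule suminf_le)
    fix j
    have \<Psi>j: "\<Psi> j \<theta> \<in> borel_measurable PM" for \<theta>
      using measurable_compose[OF measurable_Pair1' \<Psi>m[of j], of \<theta>] by simp
    have "(\<integral>\<^sup>+x. ennreal ((\<Psi> j \<theta> x)\<^sup>2 / t j) \<partial>PM) = ennreal (1 / t j) * A j \<theta>" for \<theta>
    proof -
      note [measurable] = \<Psi>j[of \<theta>]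
      have "(\<integral>\<^sup>+x. ennreal ((\<Psi> j \<theta> x)\<^sup>2 / t j) \<partial>PM) = (\<integral>\<^sup>+x. ennreal (1 / t j) * ennreal ((\<Psi> j \<theta> x)\<^sup>2) \<partial>PM)"
        using t(1)[of j] by (intro nn_integral_cong) (simp flip: ennreal_mult)
      then show ?thesis unfolding A_def by (subst (asm) nn_integral_cmult) auto
    qed
    then have "(\<integral>\<^sup>+\<theta>. (\<integral>\<^sup>+x. ennreal ((\<Psi> j \<theta> x)\<^sup>2 / t j) \<partial>PM) \<partial>weight_measure l) = ennreal (1 / t j) * ennreal ((\<sigma> j)\<^sup>2)"
      by (simp add: nn_integral_cmult A)
    also have "\<dots> = ennreal ((\<sigma> j)\<^sup>2 / t j)" using t(1)[of j] by (simp flip: ennreal_mult)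
    also have "\<dots> \<le> ennreal (\<sigma> j)"
    proof (rule ennreal_leI)
      have "\<sigma> j * \<sigma> j \<le> \<sigma> j * t j" using \<sigma>0[of j] by (intro mult_left_mono) (auto simp: t_def)
      then show "(\<sigma> j)\<^sup>2 / t j \<le> \<sigma> j" using t(1)[of j] by (simp add: divide_le_eq power2_eq_square)
    qed
    finally show "(\<integral>\<^sup>+\<theta>. (\<integral>\<^sup>+x. ennreal ((\<Psi> j \<theta> x)\<^sup>2 / t j) \<partial>PM) \<partial>weight_measure l) \<le> ennreal (\<sigma> j)" .
  qed auto
  also have "\<dots> = ennreal (suminf \<sigma>)" using \<sigma>s \<sigma>0 by (simp add: suminf_ennreal2)
  finally have BI: "(\<integral>\<^sup>+\<theta>. B \<theta> \<partial>weight_measure l) \<le> ennreal (suminf \<sigma>)" .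
  then have "(\<integral>\<^sup>+\<theta>. B \<theta> \<partial>weight_measure l) \<noteq> \<infinity>" by (auto simp: top_unique)
  then have "AE \<theta> in weight_measure l. B \<theta> \<noteq> \<infinity>" by (intro nn_integral_PInf_AE) auto
  \<comment> \<open>The density of the weight measure is positive, so its null sets are Lebesgue
    null.\<close>
  then have AEB: "AE \<theta> in lborel. B \<theta> \<noteq> \<infinity>"
    unfolding weight_measure_def by (subst (asm) AE_density) auto
  have \<Phi>m: "\<Phi> \<theta> \<in> borel_measurable PM" for \<theta>
    using measurable_compose[OF measurable_Pair1' \<Phi>, of \<theta>] by simp
  show thesis
  proof (rule that[of "suminf t * suminf \<sigma>"])
    show "0 \<le> suminf t * suminf \<sigma>" using t \<sigma>0 \<sigma>s by (intro mult_nonneg_nonneg suminf_nonneg) (auto simp: less_imp_le)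
    show "AE \<theta> in lborel. integrable PM (\<Phi> \<theta>)"
      using AEB
    proof eventually_elim
      case (elim \<theta>)
      then show ?case
        using variance_bound(1)[OF \<Phi>m dep t, of \<theta>] by (simp add: B_def \<Psi>_def less_top)
    qed
    fix n
    have "(\<integral>\<^sup>+\<theta>. (\<integral>\<^sup>+x. ennreal ((\<Sum>i<n. \<Phi> \<theta> (seq_shift (int i) x) - (\<integral>x. \<Phi> \<theta> x \<partial>PM))\<^sup>2) \<partial>PM) \<partial>weight_measure l)
      \<le> (\<integral>\<^sup>+\<theta>. of_nat n * (ennreal (suminf t) * B \<theta>) \<partial>weight_measure l)"
    proof (rule nn_integral_mono)
      fix \<theta>
      show "(\<integral>\<^sup>+x. ennreal ((\<Sum>i<n. \<Phi> \<theta> (seq_shift (int i) x) - (\<integral>x. \<Phi> \<theta> x \<partial>PM))\<^sup>2) \<partial>PM) \<le> of_nat n * (ennreal (suminf t) * B \<theta>)"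
      proof (cases "B \<theta> = \<infinity>")
        case True
        \<comment> \<open>With a positive factor the right side is infinite for
          \<open>n > 0\<close>; for \<open>n = 0\<close> the sum on the left is empty.\<close>
        have "0 < suminf t" using t by (intro suminf_pos) auto
        then show ?thesis using True by (cases "n = 0") (auto simp: ennreal_mult_top ennreal_top_mult)
      next
        case False
        then show ?thesis
          using variance_bound(2)[OF \<Phi>m dep t, of \<theta> n] by (simp add: B_def \<Psi>_def less_top)
      qed
    qed
    also have "\<dots> = of_nat n * (ennreal (suminf t) * (\<integral>\<^sup>+\<theta>. B \<theta> \<partial>weight_measure l))"
      by (simp add: nn_integral_cmult)
    also have "\<dots> \<le> of_nat n * (ennreal (suminf t) * ennreal (suminf \<sigma>))"
      by (intro mult_left_mono BI) auto
    also have "\<dots> = of_nat n * ennreal (suminf t * suminf \<sigma>)"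
      using t \<sigma>0 \<sigma>s by (subst ennreal_mult) (auto intro!: suminf_nonneg simp: less_imp_le)
    finally show "(\<integral>\<^sup>+\<theta>. (\<integral>\<^sup>+x. ennreal ((\<Sum>i<n. \<Phi> \<theta> (seq_shift (int i) x) - (\<integral>x. \<Phi> \<theta> x \<partial>PM))\<^sup>2) \<partial>PM) \<partial>weight_measure l)
       \<le> of_nat n * ennreal (suminf t * suminf \<sigma>)" .
  qed
qed

end

section \<open>The smooth part of the empirical process\<close>

text \<open>A derivative written as the limit of one fixed sequence of difference quotients is
  measurable in further parameters.\<close>

lemma has_real_derivative_imp_LIMSEQ:
  fixes g :: "real \<Rightarrow> real"
  assumes "(g has_real_derivative d) (at x)"
  shows "(\<lambda>k. real (Suc k) * (g (x + 1 / real (Suc k)) - g x)) \<longlonglongrightarrow> d"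
proof -
  have "((\<lambda>h. (g (x + h) - g x) / h) \<longlongrightarrow> d) (at 0)"
    using assms by (simp add: DERIV_def)
  moreover have "filterlim (\<lambda>k. 1 / real (Suc k)) (at 0) sequentially"
    using LIMSEQ_inverse_real_of_nat by (auto simp: filterlim_at inverse_eq_divide)
  ultimately have "(\<lambda>k. (g (x + 1 / real (Suc k)) - g x) / (1 / real (Suc k))) \<longlonglongrightarrow> d"
    by (rule filterlim_compose)
  then show ?thesis by (simp add: mult.commute)
qed

context iid_path
begin

text \<open>For fixed \<open>j\<close> and \<open>\<theta>\<close> the variable
  \<open>h j \<theta>\<close> may differ from a path functional on a null set, which conditional
  expectation ignores; the two conditional expectations then become resampling integrals at times 0
  and -1.\<close>

lemma dep_sigma_paths:
  assumes \<Phi>: "\<And>\<theta>. \<Phi> \<theta> \<in> borel_measurable PM"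
    and hm: "\<And>j \<theta>. h j \<theta> \<in> borel_measurable M"
    and h: "\<And>j \<theta>. AE w in M. h j \<theta> w = \<Phi> \<theta> (seq_shift j (paths eps w))"
  shows "dep_sigma M (past_sigma M eps) h m = (\<Sum>j::nat. ensqrt (\<integral>\<^sup>+\<theta>. (\<integral>\<^sup>+x. ennreal
      ((CE 0 (\<lambda>z. \<Phi> \<theta> (seq_shift (int j) z)) x - CE (-1) (\<lambda>z. \<Phi> \<theta> (seq_shift (int j) z)) x)\<^sup>2) \<partial>PM) \<partial>m))"
  unfolding dep_sigma_def
proof (intro suminf_cong arg_cong[where f=ensqrt] nn_integral_cong)
  fix j :: nat and \<theta> :: real
  note [measurable] = \<Phi>[of \<theta>] hm[of "int j" \<theta>]
  let ?f = "\<lambda>z. \<Phi> \<theta> (seq_shift (int j) z)"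
  have ce: "AE w in M. real_cond_exp M (past_sigma M eps k) (h (int j) \<theta>) w = CE k ?f (paths eps w)" for k
  proof -
    interpret finite_measure_subalgebra M "past_sigma M eps k"
      by unfold_locales (rule subalgebra_past_sigma)
    have "AE w in M. real_cond_exp M (past_sigma M eps k) (h (int j) \<theta>) w
        = real_cond_exp M (past_sigma M eps k) (\<lambda>w. ?f (paths eps w)) w"
      by (rule real_cond_exp_cong[OF h]) measurable
    moreover have "AE w in M. real_cond_exp M (past_sigma M eps k) (\<lambda>w. ?f (paths eps w)) w = CE k ?f (paths eps w)"
      by (rule real_cond_exp_paths) measurable
    ultimately show ?thesis by eventually_elim simp
  qed
  have "(\<integral>\<^sup>+w. ennreal ((proj_P M (past_sigma M eps) 0 (h (int j) \<theta>) w)\<^sup>2) \<partial>M)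
      = (\<integral>\<^sup>+w. ennreal ((CE 0 ?f (paths eps w) - CE (-1) ?f (paths eps w))\<^sup>2) \<partial>M)"
  proof (rule nn_integral_cong_AE)
    show "AE w in M. ennreal ((proj_P M (past_sigma M eps) 0 (h (int j) \<theta>) w)\<^sup>2)
      = ennreal ((CE 0 ?f (paths eps w) - CE (-1) ?f (paths eps w))\<^sup>2)"
      using ce[of 0] ce[of "-1"] by eventually_elim (simp add: proj_P_def)
  qed
  also have "\<dots> = (\<integral>\<^sup>+x. ennreal ((CE 0 ?f x - CE (-1) ?f x)\<^sup>2) \<partial>PM)"
    by (rule nn_integral_paths) measurable
  finally show "(\<integral>\<^sup>+w. ennreal ((proj_P M (past_sigma M eps) 0 (h (int j) \<theta>) w)\<^sup>2) \<partial>M) = \<dots>" .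
qed

end

locale smooth_process = iid_path D M eps + bounded_cond_density D Xh \<tau>
  for D :: "real measure" and M :: "'w measure" and eps Xh \<tau> +
  fixes fc fc' :: "int \<Rightarrow> real \<Rightarrow> 'w \<Rightarrow> real"
  assumes fc_deriv: "\<And>n. AE w in M. \<forall>x. ((\<lambda>y. H y (seq_shift n (paths eps w))) has_real_derivative fc n x w) (at x)"
    and fc'_deriv: "\<And>n. AE w in M. \<forall>x. ((\<lambda>y. fc n y w) has_real_derivative fc' n x w) (at x)"
    and fc_bound: "AE w in M. \<forall>u. \<bar>fc 0 u w\<bar> \<le> \<tau>"
begin

text \<open>A version of the conditional density on all of path space, jointly measurable in
  argument and path and dependent on the past at every path. The given \<open>fc\<close> agrees with
  it almost surely, for all arguments at once.\<close>

definition \<Phi> :: "real \<Rightarrow> (int \<Rightarrow> real) \<Rightarrow> real" where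
  "\<Phi> \<theta> x = lim (\<lambda>k. real (Suc k) * (H (\<theta> + 1 / real (Suc k)) x - H \<theta> x))"

definition \<Phi>' :: "real \<Rightarrow> (int \<Rightarrow> real) \<Rightarrow> real" where
  "\<Phi>' \<theta> x = lim (\<lambda>k. real (Suc k) * (\<Phi> (\<theta> + 1 / real (Suc k)) x - \<Phi> \<theta> x))"

definition f :: "real \<Rightarrow> real" where "f \<theta> = (\<integral>x. \<Phi> \<theta> x \<partial>PM)"

text \<open>The candidate for the derivative of \<open>f\<close>. Where
  \<open>\<Phi>' \<theta>\<close> is not integrable the value is 0; the dependence assumption
  confines this to a null set of \<open>\<theta>\<close>.\<close>

definition c :: "real \<Rightarrow> real" where "c \<theta> = (\<integral>x. \<Phi>' \<theta> x \<partial>PM)"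

lemma \<Phi>_measurable [measurable (raw)]:
  assumes [measurable]: "a \<in> borel_measurable N" "b \<in> N \<rightarrow>\<^sub>M Pi\<^sub>M UNIV (\<lambda>_. borel)"
  shows "(\<lambda>w. \<Phi> (a w) (b w)) \<in> borel_measurable N"
  unfolding \<Phi>_def by measurable

lemma \<Phi>'_measurable [measurable (raw)]:
  assumes [measurable]: "a \<in> borel_measurable N" "b \<in> N \<rightarrow>\<^sub>M Pi\<^sub>M UNIV (\<lambda>_. borel)"
  shows "(\<lambda>w. \<Phi>' (a w) (b w)) \<in> borel_measurable N"
  unfolding \<Phi>'_def by measurable

lemma f_measurable [measurable]: "f \<in> borel_measurable borel"
  unfolding f_def by measurable

lemma c_measurable [measurable]: "c \<in> borel_measurable borel"
  unfolding c_def by measurable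

lemma H_past: "past_dep 0 (H r)"
  by (simp add: past_dep_def H_def glue_glue_left)

lemma \<Phi>_past: "past_dep 0 (\<Phi> \<theta>)"
  using past_depD[OF H_past] by (simp add: past_dep_def \<Phi>_def)

lemma \<Phi>'_past: "past_dep 0 (\<Phi>' \<theta>)"
  using past_depD[OF \<Phi>_past] by (simp add: past_dep_def \<Phi>'_def)

lemma AE_\<Phi>: "AE w in M. \<forall>\<theta>. \<Phi> \<theta> (seq_shift n (paths eps w)) = fc n \<theta> w"
  using fc_deriv[of n]
proof eventually_elim
  case (elim w)
  show ?case
    unfolding \<Phi>_def using elim
    by (intro allI limI has_real_derivative_imp_LIMSEQ[where g="\<lambda>y. H y (seq_shift n (paths eps w))"]) simp
qed

lemma AE_\<Phi>': "AE w in M. \<forall>\<theta>. \<Phi>' \<theta> (seq_shift n (paths eps w)) = fc' n \<theta> w"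
  using AE_\<Phi>[of n] fc'_deriv[of n]
proof eventually_elim
  case (elim w)
  then have "((\<lambda>y. \<Phi> y (seq_shift n (paths eps w))) has_real_derivative fc' n \<theta> w) (at \<theta>)" for \<theta>
    by simp
  then show ?case
    unfolding \<Phi>'_def
    by (intro allI limI has_real_derivative_imp_LIMSEQ[where g="\<lambda>y. \<Phi> y (seq_shift n (paths eps w))"])
qed

lemma AE_deriv: "AE w in M. \<forall>i::nat. \<forall>x.
   ((\<lambda>y. H y (seq_shift (int i) (paths eps w))) has_real_derivative \<Phi> x (seq_shift (int i) (paths eps w))) (at x) \<and>
   ((\<lambda>y. \<Phi> y (seq_shift (int i) (paths eps w))) has_real_derivative \<Phi>' x (seq_shift (int i) (paths eps w))) (at x)"
  unfolding AE_all_countable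
proof
  fix i :: nat
  show "AE w in M. \<forall>x.
   ((\<lambda>y. H y (seq_shift (int i) (paths eps w))) has_real_derivative \<Phi> x (seq_shift (int i) (paths eps w))) (at x) \<and>
   ((\<lambda>y. \<Phi> y (seq_shift (int i) (paths eps w))) has_real_derivative \<Phi>' x (seq_shift (int i) (paths eps w))) (at x)"
    using AE_\<Phi>[of "int i"] AE_\<Phi>'[of "int i"] fc_deriv[of "int i"] fc'_deriv[of "int i"]
    by eventually_elim simp
qed

lemma AE_\<Phi>_bound: "AE w in M. \<forall>u. \<bar>\<Phi> u (paths eps w)\<bar> \<le> \<tau>"
  using AE_\<Phi>[of 0] fc_bound by eventually_elim simp

lemma integrable_\<Phi>: "integrable PM (\<Phi> \<theta>)"
proof (rule PP.integrable_const_bound[where B=\<tau>])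
  have "AE w in M. \<bar>\<Phi> \<theta> (paths eps w)\<bar> \<le> \<tau>" using AE_\<Phi>_bound by eventually_elim simp
  then show "AE x in PM. norm (\<Phi> \<theta> x) \<le> \<tau>"
    using AE_paths_iff[of "\<lambda>x. \<bar>\<Phi> \<theta> x\<bar> \<le> \<tau>"] by simp
qed measurable

lemma F_eq: "F y = (\<integral>w. H y (paths eps w) \<partial>M)"
  using integral_paths[of "H y"] integral_H[of y] by simp

lemma f_eq: "f y = (\<integral>w. \<Phi> y (paths eps w) \<partial>M)"
  using integral_paths[of "\<Phi> y"] by (simp add: f_def)

lemma H_le_1: "\<bar>H y x\<bar> \<le> 1"
proof -
  have "0 \<le> H y x" unfolding H_def by (intro integral_nonneg_AE) auto
  moreover have "H y x \<le> (\<integral>y. 1 \<partial>PM)"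
    unfolding H_def by (intro integral_mono integrable_indicator_Xh) (auto simp: indicator_def)
  ultimately show ?thesis by simp
qed

text \<open>Differentiation under the expectation: the difference quotients of \<open>H\<close> are
  dominated by \<open>\<tau>\<close>, by the mean value inequality and the density bound.\<close>

lemma F_deriv: "(F has_real_derivative f x) (at x)"
  unfolding DERIV_def tendsto_at_iff_sequentially
proof (intro allI impI)
  fix X :: "nat \<Rightarrow> real"
  assume X: "\<forall>i. X i \<in> UNIV - {0}" "X \<longlonglongrightarrow> 0"
  have int: "integrable M (\<lambda>w. H y (paths eps w))" for y
    by (rule M.integrable_const_bound[where B=1]) (auto simp: H_le_1)
  have "(\<lambda>i. \<integral>w. (H (x + X i) (paths eps w) - H x (paths eps w)) / X i \<partial>M) \<longlonglongrightarrow> (\<integral>w. \<Phi> x (paths eps w) \<partial>M)"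
  proof (rule integral_dominated_convergence[where w="\<lambda>_. \<tau>"])
    show "AE w in M. (\<lambda>i. (H (x + X i) (paths eps w) - H x (paths eps w)) / X i) \<longlonglongrightarrow> \<Phi> x (paths eps w)"
      using AE_deriv
    proof eventually_elim
      case (elim w)
      then have "((\<lambda>y. H y (paths eps w)) has_real_derivative \<Phi> x (paths eps w)) (at x)"
        by (metis of_nat_0 shift_0)
      then show ?case
        unfolding DERIV_def tendsto_at_iff_sequentially using X by (auto simp: o_def)
    qed
    show "AE w in M. norm ((H (x + X i) (paths eps w) - H x (paths eps w)) / X i) \<le> \<tau>" for i
      using AE_deriv AE_\<Phi>_bound
    proof eventually_elim
      case (elim w)
      have d: "((\<lambda>y. H y (paths eps w)) has_real_derivative \<Phi> z (paths eps w)) (at z)" for z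
        using elim(1) by (metis of_nat_0 shift_0)
      have "norm (H (x + X i) (paths eps w) - H x (paths eps w)) \<le> \<tau> * norm (x + X i - x)"
        by (rule field_differentiable_bound[where S=UNIV and f'="\<lambda>z. \<Phi> z (paths eps w)"])
           (use elim(2) d in \<open>auto intro: has_field_derivative_at_within\<close>)
      then show ?case using X(1) by (simp add: abs_divide divide_le_eq)
    qed
  qed (auto)
  also have "(\<lambda>i. \<integral>w. (H (x + X i) (paths eps w) - H x (paths eps w)) / X i \<partial>M) = ((\<lambda>h. (F (x + h) - F x) / h) \<circ> X)"
    using int by (auto simp: F_eq)
  finally show "((\<lambda>h. (F (x + h) - F x) / h) \<circ> X) \<longlonglongrightarrow> f x" by (simp add: f_eq o_def)
qed

text \<open>Neither \<open>c\<close> nor the paths of \<open>\<Phi>'\<close> are known to be locally Lebesgue integrable.  But the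
  difference \<open>\<Phi>' - c\<close> is, and \<open>\<Phi>'\<close> is a derivative, hence gauge integrable along each path.\<close>
lemma c_has_integral:
  fixes K \<nu> :: real
  assumes AEint: "AE \<theta> in lborel. integrable PM (\<Phi>' \<theta>)"
    and K: "(\<integral>\<^sup>+\<theta>. (\<integral>\<^sup>+x. ennreal ((\<Phi>' \<theta> x - c \<theta>)\<^sup>2) \<partial>PM) \<partial>weight_measure \<nu>) \<le> ennreal K"
    and uv: "u \<le> v"
  shows "(c has_integral (f v - f u)) {u..v}"
proof -
  interpret LP: pair_sigma_finite lborel PM ..
  define g where "g \<theta> x = indicator {u..v} \<theta> * (\<Phi>' \<theta> x - c \<theta>)" for \<theta> :: real and x
  have gm [measurable]: "(\<lambda>(\<theta>, x). g \<theta> x) \<in> borel_measurable (lborel \<Otimes>\<^sub>M PM)"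
    unfolding g_def by measurable
  \<comment> \<open>On the compact interval the weight is bounded below by
    \<open>R powr - \<bar>\<nu>\<bar>\<close>, so the weighted bound controls an unweighted
    integral.\<close>
  define R where "R = 1 + max \<bar>u\<bar> \<bar>v\<bar>"
  have R: "1 \<le> R" by (simp add: R_def)
  have w: "1 \<le> R powr \<bar>\<nu>\<bar> * (1 + \<bar>\<theta>\<bar>) powr \<nu>" if "\<theta> \<in> {u..v}" for \<theta>
  proof -
    have "1 + \<bar>\<theta>\<bar> \<le> R" using that by (auto simp: R_def)
    then have "(1 + \<bar>\<theta>\<bar>) powr \<bar>\<nu>\<bar> \<le> R powr \<bar>\<nu>\<bar>" by (intro powr_mono2) auto
    moreover have "1 \<le> (1 + \<bar>\<theta>\<bar>) powr (\<bar>\<nu>\<bar> + \<nu>)" by (intro ge_one_powr_ge_zero) auto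
    ultimately show ?thesis
      unfolding powr_add by (meson mult_right_mono order_trans powr_ge_zero)
  qed
  have "(\<integral>\<^sup>+\<theta>. (\<integral>\<^sup>+x. ennreal (norm (g \<theta> x)) \<partial>PM) \<partial>lborel)
    \<le> (\<integral>\<^sup>+\<theta>. indicator {u..v} \<theta> + ennreal (R powr \<bar>\<nu>\<bar>) * (ennreal ((1 + \<bar>\<theta>\<bar>) powr \<nu>) * (\<integral>\<^sup>+x. ennreal ((\<Phi>' \<theta> x - c \<theta>)\<^sup>2) \<partial>PM)) \<partial>lborel)"
  proof (rule nn_integral_mono)
    fix \<theta> :: real
    show "(\<integral>\<^sup>+x. ennreal (norm (g \<theta> x)) \<partial>PM) \<le>
      indicator {u..v} \<theta> + ennreal (R powr \<bar>\<nu>\<bar>) * (ennreal ((1 + \<bar>\<theta>\<bar>) powr \<nu>) * (\<integral>\<^sup>+x. ennreal ((\<Phi>' \<theta> x - c \<theta>)\<^sup>2) \<partial>PM))"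
    proof (cases "\<theta> \<in> {u..v}")
      case True
      have "\<bar>a\<bar> \<le> 1 + a\<^sup>2" for a :: real using sum_squares_bound[of 1 "\<bar>a\<bar>"] by simp
      then have "(\<integral>\<^sup>+x. ennreal (norm (g \<theta> x)) \<partial>PM) \<le> (\<integral>\<^sup>+x. ennreal (1 + (\<Phi>' \<theta> x - c \<theta>)\<^sup>2) \<partial>PM)"
        using True by (intro nn_integral_mono ennreal_leI) (simp add: g_def)
      also have "\<dots> = 1 + (\<integral>\<^sup>+x. ennreal ((\<Phi>' \<theta> x - c \<theta>)\<^sup>2) \<partial>PM)"
        by (simp add: ennreal_plus nn_integral_add)
      also have "(\<integral>\<^sup>+x. ennreal ((\<Phi>' \<theta> x - c \<theta>)\<^sup>2) \<partial>PM) = 1 * (\<integral>\<^sup>+x. ennreal ((\<Phi>' \<theta> x - c \<theta>)\<^sup>2) \<partial>PM)" by simp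
      also have "\<dots> \<le> (ennreal (R powr \<bar>\<nu>\<bar>) * ennreal ((1 + \<bar>\<theta>\<bar>) powr \<nu>)) * (\<integral>\<^sup>+x. ennreal ((\<Phi>' \<theta> x - c \<theta>)\<^sup>2) \<partial>PM)"
        using ennreal_leI[OF w[OF True]] by (intro mult_right_mono) (simp_all add: ennreal_mult)
      finally show ?thesis using True by (simp add: mult.assoc add_left_mono)
    qed (simp add: g_def)
  qed
  also have "\<dots> = ennreal (v - u) + ennreal (R powr \<bar>\<nu>\<bar>) * (\<integral>\<^sup>+\<theta>. (\<integral>\<^sup>+x. ennreal ((\<Phi>' \<theta> x - c \<theta>)\<^sup>2) \<partial>PM) \<partial>weight_measure \<nu>)"
    using uv by (simp add: nn_integral_add nn_integral_cmult nn_integral_weight_measure)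
  also have "\<dots> \<le> ennreal (v - u) + ennreal (R powr \<bar>\<nu>\<bar>) * ennreal K"
    by (intro add_left_mono mult_left_mono K) simp
  also have "\<dots> < \<infinity>" by (simp add: ennreal_mult_less_top)
  finally have fin: "(\<integral>\<^sup>+\<theta>. (\<integral>\<^sup>+x. ennreal (norm (g \<theta> x)) \<partial>PM) \<partial>lborel) < \<infinity>" .
  have gint: "integrable (lborel \<Otimes>\<^sub>M PM) (\<lambda>(\<theta>, x). g \<theta> x)"
  proof (rule integrableI_bounded)
    show "(\<integral>\<^sup>+p. ennreal (norm (case p of (\<theta>, x) \<Rightarrow> g \<theta> x)) \<partial>(lborel \<Otimes>\<^sub>M PM)) < \<infinity>"
      using fin by (subst PP.nn_integral_fst[symmetric]) auto
  qed (rule gm)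
  have gsec: "AE x in PM. integrable lborel (\<lambda>\<theta>. g \<theta> x)"
    using LP.AE_integrable_snd[OF gint] by simp
  define r where "r x = (\<integral>\<theta>. g \<theta> x \<partial>lborel)" for x
  have rint: "integrable PM r"
    using LP.integrable_snd[OF gint] by (simp add: r_def[abs_def])
  have "(\<integral>x. r x \<partial>PM) = (\<integral>\<theta>. (\<integral>x. g \<theta> x \<partial>PM) \<partial>lborel)"
    unfolding r_def by (rule LP.Fubini_integral[OF gint])
  also have "\<dots> = (\<integral>\<theta>. 0 \<partial>(lborel :: real measure))"
  proof (rule integral_cong_AE)
    show "AE \<theta> in lborel. (\<integral>x. g \<theta> x \<partial>PM) = 0"
      using AEint by eventually_elim (simp add: g_def c_def)
  qed measurable
  finally have r0: "(\<integral>x. r x \<partial>PM) = 0" by simp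
  \<comment> \<open>Along a good path \<open>c\<close> is \<open>\<Phi>'\<close> minus
    \<open>\<Phi>' - c\<close>: the first is integrated by the fundamental theorem of calculus, the
    second has Lebesgue integral \<open>r\<close>. Averaging over paths then removes
    \<open>r\<close>, which has mean zero.\<close>
  have AEc: "AE w in M. (c has_integral (\<Phi> v (paths eps w) - \<Phi> u (paths eps w) - r (paths eps w))) {u..v}"
    using AE_paths[OF gsec] AE_deriv
  proof eventually_elim
    case (elim w)
    have d: "((\<lambda>y. \<Phi> y (paths eps w)) has_real_derivative \<Phi>' z (paths eps w)) (at z)" for z
      using elim(2) by (metis of_nat_0 shift_0)
    have 1: "((\<lambda>z. \<Phi>' z (paths eps w)) has_integral (\<Phi> v (paths eps w) - \<Phi> u (paths eps w))) {u..v}"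
      using uv d by (intro fundamental_theorem_of_calculus)
        (auto simp: has_real_derivative_iff_has_vector_derivative[symmetric] intro: has_field_derivative_at_within)
    have "set_integrable lborel {u..v} (\<lambda>\<theta>. \<Phi>' \<theta> (paths eps w) - c \<theta>)"
      using elim(1) by (simp add: set_integrable_def g_def)
    from set_borel_integral_eq_integral[OF this]
    have 2: "((\<lambda>\<theta>. \<Phi>' \<theta> (paths eps w) - c \<theta>) has_integral r (paths eps w)) {u..v}"
      by (simp add: r_def g_def set_lebesgue_integral_def has_integral_iff)
    show ?case using has_integral_diff[OF 1 2] by simp
  qed
  have "AE w in M. \<Phi> v (paths eps w) - \<Phi> u (paths eps w) - r (paths eps w) = integral {u..v} c"
    using AEc by eventually_elim (simp add: integral_unique)
  then have "(\<integral>w. \<Phi> v (paths eps w) - \<Phi> u (paths eps w) - r (paths eps w) \<partial>M) = (\<integral>w. integral {u..v} c \<partial>M)"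
    using rint by (intro integral_cong_AE) auto
  also have "\<dots> = integral {u..v} c" by (simp add: M.prob_space)
  also have "(\<integral>w. \<Phi> v (paths eps w) - \<Phi> u (paths eps w) - r (paths eps w) \<partial>M) = f v - f u - (\<integral>w. r (paths eps w) \<partial>M)"
    using integrable_paths[OF integrable_\<Phi>] integrable_paths[OF rint] by (simp add: f_eq)
  also have "(\<integral>w. r (paths eps w) \<partial>M) = 0"
    using integral_paths[of r] rint r0 by simp
  finally have eq: "integral {u..v} c = f v - f u" by simp
  \<comment> \<open>Since \<open>c\<close> is deterministic, a single good path establishes its
    integrability.\<close>
  have "\<exists>w. (c has_integral (\<Phi> v (paths eps w) - \<Phi> u (paths eps w) - r (paths eps w))) {u..v}"
  proof (rule ccontr)
    assume "\<not> ?thesis"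
    then have "AE w in M. False" using AEc by simp
    then show False by (simp add: M.AE_False)
  qed
  then have "c integrable_on {u..v}" by blast
  then show ?thesis using eq by (simp add: has_integral_iff)
qed

text \<open>The shifts \<open>0\<close> to \<open>n - 1\<close> are the conditioning times that
  predict the observations at times \<open>1\<close> to \<open>n\<close>.\<close>

definition emp_comp :: "nat \<Rightarrow> real \<Rightarrow> (int \<Rightarrow> real) \<Rightarrow> real" where
  "emp_comp n s x = (\<Sum>i<n. H s (seq_shift (int i) x) - F s) / sqrt (real n)"

text \<open>The factor \<open>\<delta>\<^sup>2\<close> comes from the mean value theorem, once the
  weighted supremum of the derivative process has a second moment bounded in \<open>n\<close>. The
  exceptional null set is chosen before \<open>t\<close> and \<open>s\<close>.\<close>

lemma sup_emp_comp_moment: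
  fixes l \<mu> :: real
  assumes l: "0 \<le> l" and \<mu>: "\<mu> \<le> 1"
    and fcm: "\<And>j \<theta>. fc j \<theta> \<in> borel_measurable M" "\<And>j \<theta>. fc' j \<theta> \<in> borel_measurable M"
    and dep: "dep_sigma M (past_sigma M eps) fc (weight_measure (l - \<mu>)) < \<infinity>"
      "dep_sigma M (past_sigma M eps) fc' (weight_measure (l + \<mu>)) < \<infinity>"
  obtains C :: real where "0 \<le> C"
    "\<And>(n::nat) \<delta>::real. \<lbrakk>1 \<le> n; 0 < \<delta>; \<delta> \<le> 1\<rbrakk> \<Longrightarrow>
      \<exists>Z\<in>borel_measurable PM.
        (AE w in M. \<forall>t s. \<bar>s\<bar> \<le> \<delta> \<longrightarrow>
          ennreal ((1 + \<bar>t\<bar>) powr l * (emp_comp n (t + s) (paths eps w) - emp_comp n t (paths eps w))\<^sup>2) \<le> Z (paths eps w)) \<and>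
        (\<integral>\<^sup>+z. Z z \<partial>PM) \<le> ennreal (C * \<delta>\<^sup>2)"
proof -
  have pair: "(\<lambda>(\<theta>, x). \<Phi> \<theta> x) \<in> borel_measurable (borel \<Otimes>\<^sub>M PM)" "(\<lambda>(\<theta>, x). \<Phi>' \<theta> x) \<in> borel_measurable (borel \<Otimes>\<^sub>M PM)"
    by measurable
  have AE1: "AE w in M. fc j \<theta> w = \<Phi> \<theta> (seq_shift j (paths eps w))" for j \<theta>
    using AE_\<Phi>[of j] by eventually_elim simp
  have AE2: "AE w in M. fc' j \<theta> w = \<Phi>' \<theta> (seq_shift j (paths eps w))" for j \<theta>
    using AE_\<Phi>'[of j] by eventually_elim simp
  have \<Phi>m: "\<Phi> \<theta> \<in> borel_measurable PM" "\<Phi>' \<theta> \<in> borel_measurable PM" for \<theta> by measurable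
  obtain K1 where K1: "0 \<le> K1"
    "\<And>n. (\<integral>\<^sup>+\<theta>. (\<integral>\<^sup>+x. ennreal ((\<Sum>i<n. \<Phi> \<theta> (seq_shift (int i) x) - f \<theta>)\<^sup>2) \<partial>PM) \<partial>weight_measure (l - \<mu>)) \<le> of_nat n * ennreal K1"
    by (rule weighted_variance_bound[OF pair(1) \<Phi>_past dep(1)[unfolded dep_sigma_paths[OF \<Phi>m(1) fcm(1) AE1]]],
        rule that, assumption, unfold f_def)
  obtain K2 where K2: "0 \<le> K2" "AE \<theta> in lborel. integrable PM (\<Phi>' \<theta>)"
    "\<And>n. (\<integral>\<^sup>+\<theta>. (\<integral>\<^sup>+x. ennreal ((\<Sum>i<n. \<Phi>' \<theta> (seq_shift (int i) x) - c \<theta>)\<^sup>2) \<partial>PM) \<partial>weight_measure (l + \<mu>)) \<le> of_nat n * ennreal K2"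
    by (rule weighted_variance_bound[OF pair(2) \<Phi>'_past dep(2)[unfolded dep_sigma_paths[OF \<Phi>m(2) fcm(2) AE2]]],
        rule that, assumption, assumption, unfold c_def)
  have cint: "(c has_integral (f v - f u)) {u..v}" if "u \<le> v" for u v
    \<comment> \<open>The case \<open>n = 1\<close> is the integrated variance of
      \<open>\<Phi>'\<close> itself.\<close>
    using K2(3)[of 1] that by (intro c_has_integral[OF K2(2), where K=K2 and \<nu>="l + \<mu>"]) simp_all
  define A where "A = 2 * 2 powr (\<bar>l - \<mu>\<bar> + \<bar>l + \<mu>\<bar>)"
  have A0: "0 \<le> A" by (simp add: A_def)
  define C where "C = 2 powr l * (A * (K1 + K2))"
  show thesis
  proof (rule that[of C])
    show "0 \<le> C" using A0 K1 K2 by (simp add: C_def)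
    fix n :: nat and \<delta> :: real
    assume n: "1 \<le> n" and \<delta>: "0 < \<delta>" "\<delta> \<le> 1"
    have n0: "0 < real n" using n by simp
    define g where "g \<theta> x = (\<Sum>i<n. \<Phi> \<theta> (seq_shift (int i) x) - f \<theta>) / sqrt (real n)" for \<theta> x
    define g' where "g' \<theta> x = (\<Sum>i<n. \<Phi>' \<theta> (seq_shift (int i) x) - c \<theta>) / sqrt (real n)" for \<theta> x
    have [simp]: "z \<in> space (Pi\<^sub>M UNIV (\<lambda>_. borel))" for z :: "int \<Rightarrow> real"
      by (simp add: space_PiM)
    have gm: "(\<lambda>\<theta>. g \<theta> x) \<in> borel_measurable borel" "(\<lambda>\<theta>. g' \<theta> x) \<in> borel_measurable borel" for x
      unfolding g_def g'_def by measurable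
    have gpm [measurable]: "(\<lambda>p. g (fst p) (snd p)) \<in> borel_measurable (borel \<Otimes>\<^sub>M PM)"
       "(\<lambda>p. g' (fst p) (snd p)) \<in> borel_measurable (borel \<Otimes>\<^sub>M PM)"
       "(\<lambda>p. g (snd p) (fst p)) \<in> borel_measurable (PM \<Otimes>\<^sub>M borel)"
       "(\<lambda>p. g' (snd p) (fst p)) \<in> borel_measurable (PM \<Otimes>\<^sub>M borel)"
      unfolding g_def g'_def by measurable
    define \<Gamma> where "\<Gamma> x = ennreal A * ((\<integral>\<^sup>+\<theta>. ennreal ((g \<theta> x)\<^sup>2) \<partial>weight_measure (l - \<mu>)) +
      (\<integral>\<^sup>+\<theta>. ennreal ((g' \<theta> x)\<^sup>2) \<partial>weight_measure (l + \<mu>)))" for x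
    have sf: "sigma_finite_measure (weight_measure \<nu>)" for \<nu>
      unfolding weight_measure_def by (subst sigma_finite_measure.sigma_finite_iff_density_finite[OF lborel.sigma_finite_measure_axioms]) auto
    have sW [measurable_cong]: "sets (weight_measure \<nu>) = sets borel" for \<nu> by (simp add: weight_measure_def)
    have mW: "(\<lambda>x. \<integral>\<^sup>+\<theta>. ennreal ((k \<theta> x)\<^sup>2) \<partial>weight_measure \<nu>) \<in> borel_measurable PM"
      if [measurable]: "(\<lambda>p. k (snd p) (fst p)) \<in> borel_measurable (PM \<Otimes>\<^sub>M borel)" for k :: "real \<Rightarrow> (int \<Rightarrow> real) \<Rightarrow> real" and \<nu>
    proof -
      interpret W: sigma_finite_measure "weight_measure \<nu>" by (rule sf)
      show ?thesis by measurable
    qed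
    have \<Gamma>m [measurable]: "\<Gamma> \<in> borel_measurable PM"
      unfolding \<Gamma>_def using mW[OF gpm(3)] mW[OF gpm(4)] by simp
    have swap: "(\<integral>\<^sup>+x. (\<integral>\<^sup>+\<theta>. ennreal ((k \<theta> x)\<^sup>2) \<partial>weight_measure \<nu>) \<partial>PM) = (\<integral>\<^sup>+\<theta>. (\<integral>\<^sup>+x. ennreal ((k \<theta> x)\<^sup>2) \<partial>PM) \<partial>weight_measure \<nu>)"
      if [measurable]: "(\<lambda>p. k (fst p) (snd p)) \<in> borel_measurable (borel \<Otimes>\<^sub>M PM)" for k :: "real \<Rightarrow> (int \<Rightarrow> real) \<Rightarrow> real" and \<nu>
    proof -
      interpret W: sigma_finite_measure "weight_measure \<nu>" by (rule sf)
      interpret WP: pair_sigma_finite "weight_measure \<nu>" PM ..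
      show ?thesis by (rule WP.Fubini') measurable
    qed
    have \<Gamma>I: "(\<integral>\<^sup>+x. \<Gamma> x \<partial>PM) \<le> ennreal (A * (K1 + K2))"
    proof -
      have nK: "ennreal (1 / real n) * (of_nat n * ennreal K) = ennreal K" if "0 \<le> K" for K
        using n0 that by (simp add: ennreal_of_nat_eq_real_of_nat flip: ennreal_mult)
      have sq: "ennreal ((a / sqrt (real n))\<^sup>2) = ennreal (1 / real n) * ennreal (a\<^sup>2)" for a
        using n0 by (simp add: power_divide flip: ennreal_mult)
      have "(\<integral>\<^sup>+x. \<Gamma> x \<partial>PM) = ennreal A * ((\<integral>\<^sup>+\<theta>. (\<integral>\<^sup>+x. ennreal ((g \<theta> x)\<^sup>2) \<partial>PM) \<partial>weight_measure (l - \<mu>)) +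
          (\<integral>\<^sup>+\<theta>. (\<integral>\<^sup>+x. ennreal ((g' \<theta> x)\<^sup>2) \<partial>PM) \<partial>weight_measure (l + \<mu>)))"
        unfolding \<Gamma>_def using mW[OF gpm(3)] mW[OF gpm(4)]
        by (simp add: nn_integral_cmult nn_integral_add swap[OF gpm(1)] swap[OF gpm(2)])
      also have "\<dots> \<le> ennreal A * (ennreal K1 + ennreal K2)"
      proof (intro mult_left_mono add_mono)
        have "(\<integral>\<^sup>+\<theta>. (\<integral>\<^sup>+x. ennreal ((g \<theta> x)\<^sup>2) \<partial>PM) \<partial>weight_measure (l - \<mu>)) = ennreal (1 / real n) *
           (\<integral>\<^sup>+\<theta>. (\<integral>\<^sup>+x. ennreal ((\<Sum>i<n. \<Phi> \<theta> (seq_shift (int i) x) - f \<theta>)\<^sup>2) \<partial>PM) \<partial>weight_measure (l - \<mu>))"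
          unfolding g_def sq by (simp add: nn_integral_cmult)
        also have "\<dots> \<le> ennreal K1"
          using mult_left_mono[OF K1(2)[of n], of "ennreal (1 / real n)"] nK[OF K1(1)] by simp
        finally show "(\<integral>\<^sup>+\<theta>. (\<integral>\<^sup>+x. ennreal ((g \<theta> x)\<^sup>2) \<partial>PM) \<partial>weight_measure (l - \<mu>)) \<le> ennreal K1" .
        have "(\<integral>\<^sup>+\<theta>. (\<integral>\<^sup>+x. ennreal ((g' \<theta> x)\<^sup>2) \<partial>PM) \<partial>weight_measure (l + \<mu>)) = ennreal (1 / real n) *
           (\<integral>\<^sup>+\<theta>. (\<integral>\<^sup>+x. ennreal ((\<Sum>i<n. \<Phi>' \<theta> (seq_shift (int i) x) - c \<theta>)\<^sup>2) \<partial>PM) \<partial>weight_measure (l + \<mu>))"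
          unfolding g'_def sq by (simp add: nn_integral_cmult)
        also have "\<dots> \<le> ennreal K2"
          using mult_left_mono[OF K2(3)[of n], of "ennreal (1 / real n)"] nK[OF K2(1)] by simp
        finally show "(\<integral>\<^sup>+\<theta>. (\<integral>\<^sup>+x. ennreal ((g' \<theta> x)\<^sup>2) \<partial>PM) \<partial>weight_measure (l + \<mu>)) \<le> ennreal K2" .
      qed simp
      also have "\<dots> = ennreal (A * (K1 + K2))"
        using A0 K1 K2 by (simp add: ennreal_mult)
      finally show ?thesis .
    qed
    have key: "AE w in M. \<forall>\<theta>. ennreal ((1 + \<bar>\<theta>\<bar>) powr l * (g \<theta> (paths eps w))\<^sup>2) \<le> \<Gamma> (paths eps w)"
      using AE_deriv
    proof eventually_elim
      case (elim w)
      let ?x = "paths eps w"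
      \<comment> \<open>\<open>g'\<close> is not claimed to be the pointwise derivative of
        \<open>g\<close>: the mean \<open>c\<close> is linked to \<open>f\<close> only through its
        gauge integral, and the Sobolev bound asks for no more.\<close>
      have gi: "((\<lambda>\<theta>. g' \<theta> ?x) has_integral (g v ?x - g u ?x)) {u..v}" if uv: "u \<le> v" for u v
      proof -
        have "((\<lambda>\<theta>. \<Phi>' \<theta> (seq_shift (int i) ?x) - c \<theta>) has_integral
            ((\<Phi> v (seq_shift (int i) ?x) - \<Phi> u (seq_shift (int i) ?x)) - (f v - f u))) {u..v}" for i :: nat
        proof (rule has_integral_diff[OF _ cint[OF uv]])
          show "((\<lambda>\<theta>. \<Phi>' \<theta> (seq_shift (int i) ?x)) has_integral (\<Phi> v (seq_shift (int i) ?x) - \<Phi> u (seq_shift (int i) ?x))) {u..v}"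
            using uv elim by (intro fundamental_theorem_of_calculus)
              (auto simp: has_real_derivative_iff_has_vector_derivative[symmetric] intro: has_field_derivative_at_within)
        qed
        then have "((\<lambda>\<theta>. \<Sum>i<n. \<Phi>' \<theta> (seq_shift (int i) ?x) - c \<theta>) has_integral
            (\<Sum>i<n. (\<Phi> v (seq_shift (int i) ?x) - \<Phi> u (seq_shift (int i) ?x)) - (f v - f u))) {u..v}"
          by (intro has_integral_sum) auto
        from has_integral_divide[OF this, of "sqrt (real n)"]
        show ?thesis
          by (simp add: g_def g'_def diff_divide_distrib[symmetric] sum_subtractf[symmetric] algebra_simps)
      qed
      show ?case
        unfolding \<Gamma>_def A_def by (intro allI weighted_sup_bound gm gi \<mu>)
    qed
    define Z where "Z x = ennreal (2 powr l * \<delta>\<^sup>2) * \<Gamma> x" for x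
    have Zm: "Z \<in> borel_measurable PM" unfolding Z_def by measurable
    have "AE w in M. \<forall>t s. \<bar>s\<bar> \<le> \<delta> \<longrightarrow>
          ennreal ((1 + \<bar>t\<bar>) powr l * (emp_comp n (t + s) (paths eps w) - emp_comp n t (paths eps w))\<^sup>2) \<le> Z (paths eps w)"
      using key AE_deriv
    proof (eventually_elim, intro allI impI)
      fix w t s
      assume key: "\<forall>\<theta>. ennreal ((1 + \<bar>\<theta>\<bar>) powr l * (g \<theta> (paths eps w))\<^sup>2) \<le> \<Gamma> (paths eps w)"
        and d: "\<forall>i::nat. \<forall>x. ((\<lambda>y. H y (seq_shift (int i) (paths eps w))) has_real_derivative \<Phi> x (seq_shift (int i) (paths eps w))) (at x) \<and>
          ((\<lambda>y. \<Phi> y (seq_shift (int i) (paths eps w))) has_real_derivative \<Phi>' x (seq_shift (int i) (paths eps w))) (at x)"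
        and s: "\<bar>s\<bar> \<le> \<delta>"
      let ?x = "paths eps w"
      have dQ: "((\<lambda>y. emp_comp n y ?x) has_real_derivative g y ?x) (at y)" for y
        unfolding emp_comp_def g_def using d
        by (intro DERIV_cdivide DERIV_sum DERIV_diff F_deriv) auto
      \<comment> \<open>The intermediate point lies within \<open>\<delta> \<le> 1\<close> of
        \<open>t\<close>, so moving the weight there costs only \<open>2 powr l\<close>.\<close>
      have "\<exists>\<theta>. \<bar>t - \<theta>\<bar> \<le> 1 \<and> emp_comp n (t + s) ?x - emp_comp n t ?x = s * g \<theta> ?x"
      proof -
        consider "s = 0" | "0 < s" | "s < 0" by linarith
        then show ?thesis
        proof cases
          case 1
          then show ?thesis by (intro exI[of _ t]) simp
        next
          case 2
          obtain z where "t < z" "z < t + s" "emp_comp n (t + s) ?x - emp_comp n t ?x = (t + s - t) * g z ?x"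
            using MVT2[of t "t + s" "\<lambda>y. emp_comp n y ?x" "\<lambda>y. g y ?x"] 2 dQ by auto
          then show ?thesis using s \<delta> by (intro exI[of _ z]) auto
        next
          case 3
          obtain z where "t + s < z" "z < t" "emp_comp n t ?x - emp_comp n (t + s) ?x = (t - (t + s)) * g z ?x"
            using MVT2[of "t + s" t "\<lambda>y. emp_comp n y ?x" "\<lambda>y. g y ?x"] 3 dQ by auto
          then show ?thesis using s \<delta> by (intro exI[of _ z]) (auto simp: algebra_simps)
        qed
      qed
      then obtain \<theta> where \<theta>: "\<bar>t - \<theta>\<bar> \<le> 1" "emp_comp n (t + s) ?x - emp_comp n t ?x = s * g \<theta> ?x" by blast
      have "(1 + \<bar>t\<bar>) powr l * (emp_comp n (t + s) ?x - emp_comp n t ?x)\<^sup>2 = (1 + \<bar>t\<bar>) powr l * (s\<^sup>2 * (g \<theta> ?x)\<^sup>2)"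
        by (simp add: \<theta>(2) power_mult_distrib)
      also have "\<dots> \<le> (2 powr l * (1 + \<bar>\<theta>\<bar>) powr l) * (\<delta>\<^sup>2 * (g \<theta> ?x)\<^sup>2)"
        using s \<delta> powr_weight_le[OF \<theta>(1) l] by (intro mult_mono) (auto simp: abs_le_square_iff[symmetric])
      finally have "ennreal ((1 + \<bar>t\<bar>) powr l * (emp_comp n (t + s) ?x - emp_comp n t ?x)\<^sup>2)
          \<le> ennreal ((2 powr l * \<delta>\<^sup>2) * ((1 + \<bar>\<theta>\<bar>) powr l * (g \<theta> ?x)\<^sup>2))"
        by (intro ennreal_leI) (simp add: mult_ac)
      also have "\<dots> = ennreal (2 powr l * \<delta>\<^sup>2) * ennreal ((1 + \<bar>\<theta>\<bar>) powr l * (g \<theta> ?x)\<^sup>2)"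
        by (rule ennreal_mult) auto
      also have "\<dots> \<le> Z ?x" unfolding Z_def using key by (intro mult_left_mono) auto
      finally show "ennreal ((1 + \<bar>t\<bar>) powr l * (emp_comp n (t + s) ?x - emp_comp n t ?x)\<^sup>2) \<le> Z ?x" .
    qed
    moreover have "(\<integral>\<^sup>+z. Z z \<partial>PM) \<le> ennreal (C * \<delta>\<^sup>2)"
    proof -
      have "(\<integral>\<^sup>+z. Z z \<partial>PM) = ennreal (2 powr l * \<delta>\<^sup>2) * (\<integral>\<^sup>+z. \<Gamma> z \<partial>PM)"
        unfolding Z_def by (rule nn_integral_cmult) measurable
      also have "\<dots> \<le> ennreal (2 powr l * \<delta>\<^sup>2) * ennreal (A * (K1 + K2))"
        by (intro mult_left_mono \<Gamma>I) simp
      also have "\<dots> = ennreal (C * \<delta>\<^sup>2)"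
        using A0 K1 K2 by (subst ennreal_mult[symmetric]) (auto simp: C_def mult_ac)
      finally show ?thesis .
    qed
    ultimately show "\<exists>Z\<in>borel_measurable PM.
        (AE w in M. \<forall>t s. \<bar>s\<bar> \<le> \<delta> \<longrightarrow>
          ennreal ((1 + \<bar>t\<bar>) powr l * (emp_comp n (t + s) (paths eps w) - emp_comp n t (paths eps w))\<^sup>2) \<le> Z (paths eps w)) \<and>
        (\<integral>\<^sup>+z. Z z \<partial>PM) \<le> ennreal (C * \<delta>\<^sup>2)"
      using Zm by blast
  qed
qed

end

section \<open>Increments of the empirical process\<close>

text \<open>Versions of a conditional distribution function are identified almost surely only for
  countably many levels at a time. Monotonicity of one and continuity of the other extend the
  identity to all levels.\<close>

lemma mono_continuous_eq_on_rats:
  fixes g h :: "real \<Rightarrow> real"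
  assumes h: "\<And>a b. a \<le> b \<Longrightarrow> h a \<le> h b" and g: "isCont g x" and eq: "\<And>r. r \<in> \<rat> \<Longrightarrow> g r = h r"
  shows "g x = h x"
proof (rule ccontr)
  assume "g x \<noteq> h x"
  then have "0 < \<bar>g x - h x\<bar>" by simp
  with g obtain d where d: "0 < d" "\<And>y. dist y x < d \<Longrightarrow> dist (g y) (g x) < \<bar>g x - h x\<bar>"
    unfolding continuous_at_eps_delta by (metis dist_commute)
  obtain r where r: "r \<in> \<rat>" "x - d < r" "r < x" using Rats_dense_in_real[of "x - d" x] d by auto
  obtain r' where r': "r' \<in> \<rat>" "x < r'" "r' < x + d" using Rats_dense_in_real[of x "x + d"] d by auto
  have "\<bar>g r - g x\<bar> < \<bar>g x - h x\<bar>" "\<bar>g r' - g x\<bar> < \<bar>g x - h x\<bar>"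
    using d(2)[of r] d(2)[of r'] r r' by (auto simp: dist_real_def)
  moreover have "g r \<le> h x" "h x \<le> g r'" using h[of r x] h[of x r'] r r' eq by auto
  ultimately show False by linarith
qed

text \<open>The depth is \<open>log 2 n\<close> rounded up. As \<open>\<alpha>\<close> is the
  reciprocal of \<open>2 * q / (q - 2)\<close>, the \<open>\<alpha>\<close>-th power of the growth
  assumption bounds \<open>ln n\<close> by a multiple of
  \<open>(n * \<delta> n) powr \<alpha>\<close>.\<close>

lemma dyadic_depth:
  fixes \<delta> :: "nat \<Rightarrow> real" and q :: real
  assumes \<delta>: "\<And>n. 0 < \<delta> n" and q: "2 < q"
    and rate: "(\<lambda>n. ln (real n) powr (2 * q / (q - 2))) \<in> O(\<lambda>n. real n * \<delta> n)"
  obtains K :: real where "\<And>n::nat. 1 \<le> n \<Longrightarrow> \<exists>N. real n \<le> 2 ^ N \<and>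
    real (Suc N) * (1 / real n) powr (1/2 - 1/q) \<le> K * \<delta> n powr (1/2 - 1/q)"
proof -
  define \<alpha> where "\<alpha> = 1/2 - 1/q"
  have \<alpha>: "0 < \<alpha>" "2 * q / (q - 2) * \<alpha> = 1" using q by (auto simp: \<alpha>_def field_simps)
  define N where "N n = nat \<lceil>log 2 (real n)\<rceil>" for n :: nat
  have N: "real n \<le> 2 ^ N n" if "1 \<le> n" for n
  proof -
    have "real n = 2 powr (log 2 (real n))" using that by simp
    also have "\<dots> \<le> 2 powr (real (N n))"
      unfolding N_def by (intro powr_mono) (auto simp: real_nat_ceiling_ge)
    finally show ?thesis by (simp add: powr_realpow)
  qed
  obtain C where C: "0 < C" and ev: "eventually (\<lambda>n. norm (ln (real n) powr (2 * q / (q - 2))) \<le> C * norm (real n * \<delta> n)) at_top"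
    using landau_o.bigE[OF rate] by blast
  from ev obtain n0 where n0: "\<And>n. n0 \<le> n \<Longrightarrow> ln (real n) powr (2 * q / (q - 2)) \<le> C * (real n * \<delta> n)"
    unfolding eventually_at_top_linorder using \<delta> by (auto simp: abs_mult abs_of_pos)
  define r where "r n = real (Suc (N n)) * (1 / real n) powr \<alpha> / \<delta> n powr \<alpha>" for n
  have large: "r n \<le> 4 * C powr \<alpha>" if n: "n0 \<le> n" "3 \<le> n" for n
  proof -
    \<comment> \<open>For \<open>n \<ge> 3\<close> the logarithm is at least 1, so the rounding and
      the successor are absorbed into the constant 4.\<close>
    have "exp 1 \<le> (3::real)" by (rule exp_le)
    then have ln1: "1 \<le> ln (real n)" using n by (subst ln_ge_iff) auto
    have "log 2 (real n) = ln (real n) / ln 2" by (simp add: log_def)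
    also have "\<dots> \<le> ln (real n) / (1/2)"
      using ln1 ln_le_minus_one[of "1/2 :: real"] by (intro divide_left_mono) (auto simp: ln_div)
    finally have "log 2 (real n) \<le> 2 * ln (real n)" by simp
    moreover have "0 \<le> log 2 (real n)" using n by simp
    then have "real (N n) \<le> log 2 (real n) + 1"
      unfolding N_def by (simp add: zero_le_ceiling of_nat_nat)
    ultimately have "real (N n) \<le> 2 * ln (real n) + 1" by linarith
    then have N4: "real (Suc (N n)) \<le> 4 * ln (real n)" using ln1 by simp
    have "ln (real n) = (ln (real n) powr (2 * q / (q - 2))) powr \<alpha>"
      unfolding powr_powr \<alpha>(2) using ln1 by simp
    also have "\<dots> \<le> (C * (real n * \<delta> n)) powr \<alpha>"
      using n0[OF n(1)] \<alpha> by (intro powr_mono2) auto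
    also have "\<dots> = C powr \<alpha> * (real n powr \<alpha> * \<delta> n powr \<alpha>)"
      using C \<delta>[of n] by (simp add: powr_mult)
    finally have "real (Suc (N n)) \<le> 4 * C powr \<alpha> * (real n powr \<alpha> * \<delta> n powr \<alpha>)" using N4 by simp
    moreover have "r n = real (Suc (N n)) / (real n powr \<alpha> * \<delta> n powr \<alpha>)"
      by (simp add: r_def powr_divide)
    ultimately show ?thesis
      using n \<delta>[of n] by (simp add: divide_le_eq)
  qed
  \<comment> \<open>The asymptotic assumption says nothing about the finitely many small
    \<open>n\<close>; their ratios are added to the constant.\<close>
  define K where "K = 4 * C powr \<alpha> + (\<Sum>n<n0 + 3. r n)"
  have r0: "0 \<le> r n" for n by (simp add: r_def)
  have rK: "r n \<le> K" for n
  proof (cases "n < n0 + 3")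
    case True
    then have "r n \<le> (\<Sum>n<n0 + 3. r n)" using r0 by (intro member_le_sum) auto
    moreover have "0 \<le> C powr \<alpha>" by simp
    ultimately show ?thesis unfolding K_def by linarith
  next
    case False
    then have "r n \<le> 4 * C powr \<alpha>" by (intro large) auto
    moreover have "0 \<le> (\<Sum>n<n0 + 3. r n)" using r0 by (intro sum_nonneg) auto
    ultimately show ?thesis unfolding K_def by linarith
  qed
  show thesis
  proof (rule that[of K])
    fix n :: nat assume n: "1 \<le> n"
    have "0 < \<delta> n powr \<alpha>" using \<delta>[of n] by simp
    then have "real (Suc (N n)) * (1 / real n) powr \<alpha> \<le> K * \<delta> n powr \<alpha>"
      using rK[of n] by (simp add: r_def divide_le_eq)
    then show "\<exists>N. real n \<le> 2 ^ N \<and> real (Suc N) * (1 / real n) powr (1/2 - 1/q) \<le> K * \<delta> n powr (1/2 - 1/q)"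
      using N[OF n] unfolding \<alpha>_def by blast
  qed
qed

lemma (in cond_cdf) CE_indicator:
  "CE n (\<lambda>z. indicator {..r} (Xh (seq_shift (n + 1) z))) x = H r (seq_shift n x)"
proof -
  have "CE n (\<lambda>z. indicator {..r} (Xh (seq_shift (n + 1) z))) x
      = CE n (\<lambda>z. indicator {..r} (Xh (seq_shift 1 (seq_shift n z)))) x"
    by (simp add: add.commute)
  also have "\<dots> = CE 0 (\<lambda>z. indicator {..r} (Xh (seq_shift 1 z))) (seq_shift n x)"
    by (subst CE_shift) simp_all
  also have "\<dots> = H r (seq_shift n x)"
    unfolding H_def by (intro CE_eq_integral integrable_indicator_Xh) simp
  finally show ?thesis .
qed

lemma powr_one_plus_le:
  fixes a \<gamma> :: real
  assumes "0 \<le> a" "0 \<le> \<gamma>"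
  shows "(1 + a) powr \<gamma> \<le> 2 powr \<gamma> * (1 + a powr \<gamma>)"
proof -
  have "(1 + a) powr \<gamma> \<le> (2 * max 1 a) powr \<gamma>" using assms by (intro powr_mono2) auto
  also have "\<dots> = 2 powr \<gamma> * max 1 a powr \<gamma>" by (rule powr_mult)
  also have "\<dots> \<le> 2 powr \<gamma> * (1 + a powr \<gamma>)"
    by (intro mult_left_mono) (auto simp: max_def)
  finally show ?thesis .
qed

theorem theorem2:
  fixes M :: "'w measure"
    and eps :: "int \<Rightarrow> 'w \<Rightarrow> real"
    and J :: "(nat \<Rightarrow> real) \<Rightarrow> real"
    and X :: "int \<Rightarrow> 'w \<Rightarrow> real"
    and Fc fc fc' :: "int \<Rightarrow> real \<Rightarrow> 'w \<Rightarrow> real"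
    and \<gamma> \<tau> q \<mu> :: real
    and \<delta> :: "nat \<Rightarrow> real"
  assumes prob: "prob_space M"
    and eps_rv: "\<And>k. eps k \<in> borel_measurable M"
    and eps_indep: "prob_space.indep_vars M (\<lambda>_. borel) eps UNIV"
    and eps_ident: "\<And>k. distr M borel (eps k) = distr M borel (eps 0)"
    and J_meas: "J \<in> borel_measurable (Pi\<^sub>M UNIV (\<lambda>_::nat. borel))"
    and X_def: "\<And>n w. X n w = J (\<lambda>j. eps (n - int j) w)"
    \<comment> \<open>Fc n x is (a version of) F_eps(x | F_n) = P(X_(n+1) <= x | F_n)\<close>
    and Fc_meas: "\<And>n x. Fc n x \<in> borel_measurable (past_sigma M eps n)"
    and Fc_cond: "\<And>n x. AE w in M. Fc n x w =
        real_cond_exp M (past_sigma M eps n) (indicator {w\<in>space M. X (n + 1) w \<le> x}) w"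
    \<comment> \<open>conditional density f_eps and its derivative f'_eps exist almost surely\<close>
    and fc_meas: "\<And>n x. fc n x \<in> borel_measurable (past_sigma M eps n)"
    and fc'_meas: "\<And>n x. fc' n x \<in> borel_measurable (past_sigma M eps n)"
    and fc_deriv: "\<And>n. AE w in M. \<forall>x. ((\<lambda>y. Fc n y w) has_real_derivative fc n x w) (at x)"
    and fc'_deriv: "\<And>n. AE w in M. \<forall>x. ((\<lambda>y. fc n y w) has_real_derivative fc' n x w) (at x)"
    \<comment> \<open>moment and density-bound assumptions\<close>
    and gamma: "\<gamma> \<ge> 0"
    and moment: "(\<integral>\<^sup>+ w. ennreal (\<bar>X 1 w\<bar> powr \<gamma>) \<partial>M) < \<infinity>"
    and dens_bound: "AE w in M. \<forall>u. fc 0 u w \<le> \<tau>"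
    and q: "2 < q" "q < 4"
    and delta: "\<And>n. 0 < \<delta> n" "\<And>n. \<delta> n < 1/2"
    and delta_rate: "(\<lambda>n. ln (real n) powr (2 * q / (q - 2))) \<in> O(\<lambda>n. real n * \<delta> n)"
    and mu: "\<mu> \<le> 1"
    and dep: "dep_sigma M (past_sigma M eps) fc (weight_measure (2 * \<gamma> / q - \<mu>))
              + dep_sigma M (past_sigma M eps) fc' (weight_measure (2 * \<gamma> / q + \<mu>)) < \<infinity>"
  shows "\<exists>C::real. 0 < C \<and> (\<forall>n::nat. n \<ge> 1 \<longrightarrow>
           (\<integral>\<^sup>+ w. (SUP t::real. SUP s\<in>{-\<delta> n..\<delta> n}.
                 ennreal ((1 + \<bar>t\<bar>) powr (2 * \<gamma> / q)
                          * (emp_R M X n (t + s) w - emp_R M X n t w)\<^sup>2)) \<partial>M)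
           \<le> ennreal (C * \<delta> n powr (1 - 2 / q)))"
proof -
  define D where "D = distr M borel (eps 0)"
  \<comment> \<open>\<open>J\<close> reads the innovations backwards from the present, so
    \<open>Xh\<close> reads the coordinates \<open>0, -1, -2, ...\<close> of the path and depends on
    the past up to time 0.\<close>
  define Xh where "Xh x = J (\<lambda>j. x (- int j))" for x :: "int \<Rightarrow> real"
  define T where "T = max 1 \<tau>"
  interpret iid_path D M eps
    unfolding D_def by (rule iid_pathI[OF prob eps_rv eps_indep eps_ident])
  have Xh_meas: "Xh \<in> borel_measurable PM"
    unfolding Xh_def
  proof (rule measurable_compose[OF _ J_meas])
    show "(\<lambda>x j. x (- int j)) \<in> PM \<rightarrow>\<^sub>M Pi\<^sub>M UNIV (\<lambda>_. borel)"
      by (rule measurable_PiM_single') (auto simp: measurable_cong_sets[OF sets_PM refl])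
  qed
  interpret cond_cdf D Xh
    by unfold_locales (auto simp: Xh_meas past_dep_def Xh_def glue_def)
  have X_eq: "X n w = Xh (seq_shift n (paths eps w))" for n w
    by (simp add: X_def Xh_def seq_shift_def paths_def add.commute)
  \<comment> \<open>For each level \<open>Fc\<close> agrees with \<open>H\<close> almost surely; the
    countable set of rational levels gives one null set, and differentiability of \<open>Fc\<close>
    supplies the continuity needed for all levels.\<close>
  have Fc_H: "AE w in M. \<forall>r. Fc n r w = H r (seq_shift n (paths eps w))" for n
  proof -
    interpret S: finite_measure_subalgebra M "past_sigma M eps n"
      by unfold_locales (rule subalgebra_past_sigma)
    have r: "AE w in M. Fc n r w = H r (seq_shift n (paths eps w))" for r
    proof -
      let ?g = "\<lambda>z. indicator {..r} (Xh (seq_shift (n + 1) z)) :: real"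
      have [measurable]: "X (n + 1) \<in> borel_measurable M"
        unfolding X_eq[abs_def] by measurable
      have "AE w in M. real_cond_exp M (past_sigma M eps n) (indicator {w\<in>space M. X (n + 1) w \<le> r}) w
          = real_cond_exp M (past_sigma M eps n) (\<lambda>w. ?g (paths eps w)) w"
        by (rule S.real_cond_exp_cong) (auto simp: X_eq indicator_def)
      moreover have "AE w in M. real_cond_exp M (past_sigma M eps n) (\<lambda>w. ?g (paths eps w)) w = CE n ?g (paths eps w)"
        by (rule real_cond_exp_paths) measurable
      ultimately show ?thesis
        using Fc_cond[of n r] by eventually_elim (simp only: CE_indicator)
    qed
    have "AE w in M. \<forall>r\<in>\<rat>. Fc n r w = H r (seq_shift n (paths eps w))"
      using r by (intro AE_ball_countable' countable_rat)
    then show ?thesis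
      using fc_deriv[of n]
    proof eventually_elim
      case (elim w)
      show ?case
      proof
        fix x
        show "Fc n x w = H x (seq_shift n (paths eps w))"
        proof (rule mono_continuous_eq_on_rats[where g="\<lambda>y. Fc n y w" and h="\<lambda>y. H y (seq_shift n (paths eps w))"])
          show "isCont (\<lambda>y. Fc n y w) x"
            using elim(2) by (blast intro: DERIV_isCont)
        qed (use elim(1) H_mono in auto)
      qed
    qed
  qed
  have H_deriv: "AE w in M. \<forall>x. ((\<lambda>y. H y (seq_shift n (paths eps w))) has_real_derivative fc n x w) (at x)" for n
    using Fc_H[of n] fc_deriv[of n] by eventually_elim simp
  \<comment> \<open>Only an upper bound on the density is assumed. Nonnegativity follows because
    \<open>H\<close> is nondecreasing in its level.\<close>
  have fc_abs: "AE w in M. \<forall>u. \<bar>fc 0 u w\<bar> \<le> T"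
    using H_deriv[of 0] dens_bound
  proof eventually_elim
    case (elim w)
    show ?case
    proof
      fix u
      have "0 \<le> fc 0 u w"
        using elim(1) by (intro mono_on_imp_deriv_nonneg[of UNIV "\<lambda>y. H y (seq_shift 0 (paths eps w))"])
          (auto simp: mono_on_def H_mono)
      moreover have "fc 0 u w \<le> T" using elim(2)[rule_format, of u] by (simp add: T_def)
      ultimately show "\<bar>fc 0 u w\<bar> \<le> T" by simp
    qed
  qed
  interpret smooth_process D M eps Xh T fc fc'
  proof unfold_locales
    show "1 \<le> T" by (simp add: T_def)
    fix a b :: real assume ab: "a \<le> b"
    have "AE w in M. H b (paths eps w) - H a (paths eps w) \<le> T * (b - a)"
      using H_deriv[of 0] fc_abs
    proof eventually_elim
      case (elim w)
      have "norm (H b (paths eps w) - H a (paths eps w)) \<le> T * norm (b - a)"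
        by (rule field_differentiable_bound[where S=UNIV and f'="\<lambda>z. fc 0 z w"])
           (use elim in \<open>auto intro: has_field_derivative_at_within\<close>)
      then show ?case using ab by simp
    qed
    then show "AE x in PM. H b x - H a x \<le> T * (b - a)"
      using AE_paths_iff[of "\<lambda>x. H b x - H a x \<le> T * (b - a)"] by simp
  qed (rule H_deriv fc'_deriv fc_abs)+
  have fcm: "fc n x \<in> borel_measurable M" "fc' n x \<in> borel_measurable M" for n x
    using measurable_from_subalg[OF subalgebra_past_sigma] fc_meas fc'_meas by blast+
  define l where "l = 2 * \<gamma> / q"
  have l: "0 \<le> l" using gamma q by (simp add: l_def)
  have mom: "(\<integral>\<^sup>+x. ennreal ((1 + \<bar>Xh x\<bar>) powr \<gamma>) \<partial>PM) < \<infinity>"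
  proof -
    have "(\<integral>\<^sup>+x. ennreal ((1 + \<bar>Xh x\<bar>) powr \<gamma>) \<partial>PM) \<le> (\<integral>\<^sup>+x. ennreal (2 powr \<gamma>) * (1 + ennreal (\<bar>Xh x\<bar> powr \<gamma>)) \<partial>PM)"
    proof (rule nn_integral_mono)
      fix x
      have "ennreal ((1 + \<bar>Xh x\<bar>) powr \<gamma>) \<le> ennreal (2 powr \<gamma> * (1 + \<bar>Xh x\<bar> powr \<gamma>))"
        using gamma by (intro ennreal_leI powr_one_plus_le) auto
      then show "ennreal ((1 + \<bar>Xh x\<bar>) powr \<gamma>) \<le> ennreal (2 powr \<gamma>) * (1 + ennreal (\<bar>Xh x\<bar> powr \<gamma>))"
        by (simp add: ennreal_mult ennreal_plus)
    qed
    also have "\<dots> = ennreal (2 powr \<gamma>) * (1 + (\<integral>\<^sup>+x. ennreal (\<bar>Xh x\<bar> powr \<gamma>) \<partial>PM))"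
      by (simp add: nn_integral_cmult nn_integral_add)
    also have "(\<integral>\<^sup>+x. ennreal (\<bar>Xh x\<bar> powr \<gamma>) \<partial>PM) = (\<integral>\<^sup>+x. ennreal (\<bar>Xh (seq_shift 1 x)\<bar> powr \<gamma>) \<partial>PM)"
      by (rule nn_integral_shift[symmetric]) measurable
    also have "\<dots> = (\<integral>\<^sup>+w. ennreal (\<bar>X 1 w\<bar> powr \<gamma>) \<partial>M)"
      unfolding X_eq by (rule nn_integral_paths[symmetric]) measurable
    also have "ennreal (2 powr \<gamma>) * (1 + \<dots>) < \<infinity>"
      using moment by (simp add: ennreal_mult_less_top)
    finally show ?thesis .
  qed
  obtain K where K: "\<And>n::nat. 1 \<le> n \<Longrightarrow> \<exists>N. real n \<le> 2 ^ N \<and>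
      real (Suc N) * (1 / real n) powr (1/2 - 1/q) \<le> K * \<delta> n powr (1/2 - 1/q)"
    using dyadic_depth[OF delta(1) q(1) delta_rate] by blast
  obtain C1 where C1: "0 \<le> C1" "\<And>(n::nat) (N::nat) \<delta>::real. \<lbrakk>1 \<le> n; real n \<le> 2 ^ N; 0 < \<delta>; \<delta> < 1/2;
        real (Suc N) * (1 / real n) powr (1/2 - 1/q) \<le> K * \<delta> powr (1/2 - 1/q)\<rbrakk> \<Longrightarrow>
      \<exists>Z\<in>borel_measurable PM.
        (\<forall>z t s. \<bar>s\<bar> \<le> \<delta> \<longrightarrow> ennreal ((1 + \<bar>t\<bar>) powr l * (emp_mart n (t + s) z - emp_mart n t z)\<^sup>2) \<le> Z z) \<and>
        (\<integral>\<^sup>+z. Z z \<partial>PM) \<le> ennreal (C1 * \<delta> powr (1 - 2/q))"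
    by (rule sup_emp_mart_moment[OF q gamma mom, of K, folded l_def], rule that, assumption, blast)
  have dep': "dep_sigma M (past_sigma M eps) fc (weight_measure (l - \<mu>)) < \<infinity>"
    "dep_sigma M (past_sigma M eps) fc' (weight_measure (l + \<mu>)) < \<infinity>"
    using dep by (auto simp: l_def less_top)
  obtain C2 where C2: "0 \<le> C2" "\<And>(n::nat) \<delta>::real. \<lbrakk>1 \<le> n; 0 < \<delta>; \<delta> \<le> 1\<rbrakk> \<Longrightarrow>
      \<exists>Z\<in>borel_measurable PM.
        (AE w in M. \<forall>t s. \<bar>s\<bar> \<le> \<delta> \<longrightarrow>
          ennreal ((1 + \<bar>t\<bar>) powr l * (emp_comp n (t + s) (paths eps w) - emp_comp n t (paths eps w))\<^sup>2) \<le> Z (paths eps w)) \<and>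
        (\<integral>\<^sup>+z. Z z \<partial>PM) \<le> ennreal (C2 * \<delta>\<^sup>2)"
    by (rule sup_emp_comp_moment[OF l mu fcm dep'], rule that, assumption, blast)
  have F_X: "F s = measure M {w\<in>space M. X 0 w \<le> s}" for s
  proof -
    have "F s = (\<integral>w. indicator {..s} (Xh (paths eps w)) \<partial>M)"
      unfolding F_def by (rule integral_paths[symmetric]) measurable
    also have "\<dots> = (\<integral>w. indicator {w\<in>space M. X 0 w \<le> s} w \<partial>M)"
      by (rule Bochner_Integration.integral_cong) (auto simp: X_eq indicator_def)
    also have "\<dots> = measure M {w\<in>space M. X 0 w \<le> s}"
      by (simp add: Int_absorb2 Collect_conj_eq)
    finally show ?thesis .
  qed
  \<comment> \<open>The conditional distribution functions cancel between the two parts. The sum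
    over \<open>i - 1\<close> for \<open>i = 1..n\<close> is reindexed to
    \<open>i < n\<close>.\<close>
  have R_eq: "emp_R M X n s w = emp_mart n s (paths eps w) + emp_comp n s (paths eps w)" if n: "1 \<le> n" for n s w
  proof -
    have sum_eq: "(\<Sum>i=1..n. h (int i - 1)) = (\<Sum>i<n. h (int i))" for h :: "int \<Rightarrow> real"
      by (rule sum.reindex_bij_witness[of _ Suc "\<lambda>i. i - 1"]) auto
    define a where "a = (\<Sum>i=1..n. indicator {..s} (X (int i) w) :: real)"
    define b where "b = (\<Sum>i<n. H s (seq_shift (int i) (paths eps w)))"
    have G: "emp_mart n s (paths eps w) = (a - b) / sqrt (real n)"
      unfolding emp_mart_def a_def b_def X_eq
      using sum_eq[of "\<lambda>k. H s (seq_shift k (paths eps w))"] by (simp add: sum_subtractf)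
    have Q: "emp_comp n s (paths eps w) = (b - real n * F s) / sqrt (real n)"
      by (simp add: emp_comp_def b_def sum_subtractf)
    have "emp_R M X n s w = sqrt (real n) * (a / real n - F s)"
      by (simp add: emp_R_def a_def F_X)
    also have "\<dots> = (a - real n * F s) / sqrt (real n)"
    proof -
      have "sqrt (real n) * sqrt (real n) = real n" by simp
      then show ?thesis using n by (simp add: field_simps)
    qed
    finally show ?thesis by (simp add: G Q diff_divide_distrib)
  qed
  show ?thesis
  \<comment> \<open>The factors 2 come from squaring a sum of two increments; the added 1 makes the
    constant strictly positive.\<close>
  proof (intro exI[of _ "2 * C1 + 2 * C2 + 1"] conjI allI impI)
    show "0 < 2 * C1 + 2 * C2 + 1" using C1 C2 by simp
    fix n :: nat assume n: "1 \<le> n"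
    obtain N where N: "real n \<le> 2 ^ N" "real (Suc N) * (1 / real n) powr (1/2 - 1/q) \<le> K * \<delta> n powr (1/2 - 1/q)"
      using K[OF n] by blast
    obtain Z1 where [measurable]: "Z1 \<in> borel_measurable PM" and Z1:
        "\<And>z t s. \<bar>s\<bar> \<le> \<delta> n \<Longrightarrow> ennreal ((1 + \<bar>t\<bar>) powr l * (emp_mart n (t + s) z - emp_mart n t z)\<^sup>2) \<le> Z1 z"
        "(\<integral>\<^sup>+z. Z1 z \<partial>PM) \<le> ennreal (C1 * \<delta> n powr (1 - 2/q))"
      using C1(2)[OF n N(1) delta(1) delta(2) N(2)] by blast
    have "\<delta> n \<le> 1" using delta(2)[of n] by simp
    then obtain Z2 where [measurable]: "Z2 \<in> borel_measurable PM" and Z2: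
        "AE w in M. \<forall>t s. \<bar>s\<bar> \<le> \<delta> n \<longrightarrow>
          ennreal ((1 + \<bar>t\<bar>) powr l * (emp_comp n (t + s) (paths eps w) - emp_comp n t (paths eps w))\<^sup>2) \<le> Z2 (paths eps w)"
        "(\<integral>\<^sup>+z. Z2 z \<partial>PM) \<le> ennreal (C2 * (\<delta> n)\<^sup>2)"
      using C2(2)[OF n delta(1)] by blast
    have "(\<integral>\<^sup>+ w. (SUP t::real. SUP s\<in>{-\<delta> n..\<delta> n}.
        ennreal ((1 + \<bar>t\<bar>) powr l * (emp_R M X n (t + s) w - emp_R M X n t w)\<^sup>2)) \<partial>M)
      \<le> (\<integral>\<^sup>+w. 2 * Z1 (paths eps w) + 2 * Z2 (paths eps w) \<partial>M)"
    proof (rule nn_integral_mono_AE)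
      show "AE w in M. (SUP t::real. SUP s\<in>{-\<delta> n..\<delta> n}.
        ennreal ((1 + \<bar>t\<bar>) powr l * (emp_R M X n (t + s) w - emp_R M X n t w)\<^sup>2))
        \<le> 2 * Z1 (paths eps w) + 2 * Z2 (paths eps w)"
        using Z2(1)
      proof eventually_elim
        case (elim w)
        show ?case
        proof (intro SUP_least)
          fix t s assume "s \<in> {-\<delta> n..\<delta> n}"
          then have s: "\<bar>s\<bar> \<le> \<delta> n" by auto
          let ?a = "emp_mart n (t + s) (paths eps w) - emp_mart n t (paths eps w)"
          let ?b = "emp_comp n (t + s) (paths eps w) - emp_comp n t (paths eps w)"
          let ?W = "(1 + \<bar>t\<bar>) powr l"
          have "(?a + ?b)\<^sup>2 \<le> 2 * ?a\<^sup>2 + 2 * ?b\<^sup>2"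
            using sum_squares_bound[of ?a ?b] by (simp add: power2_sum)
          then have "?W * (?a + ?b)\<^sup>2 \<le> ?W * (2 * ?a\<^sup>2 + 2 * ?b\<^sup>2)" by (rule mult_left_mono) simp
          also have "\<dots> = 2 * (?W * ?a\<^sup>2) + 2 * (?W * ?b\<^sup>2)"
            by (simp only: distrib_left mult.left_commute[of ?W 2])
          also have "?a + ?b = emp_R M X n (t + s) w - emp_R M X n t w" by (simp add: R_eq[OF n])
          finally have "ennreal (?W * (emp_R M X n (t + s) w - emp_R M X n t w)\<^sup>2)
              \<le> ennreal (2 * (?W * ?a\<^sup>2) + 2 * (?W * ?b\<^sup>2))"
            by (rule ennreal_leI)
          also have "\<dots> = 2 * ennreal (?W * ?a\<^sup>2) + 2 * ennreal (?W * ?b\<^sup>2)"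
            by (subst ennreal_plus) (simp_all add: ennreal_mult)
          also have "\<dots> \<le> 2 * Z1 (paths eps w) + 2 * Z2 (paths eps w)"
            using Z1(1)[OF s] elim s by (intro add_mono mult_left_mono) auto
          finally show "ennreal (?W * (emp_R M X n (t + s) w - emp_R M X n t w)\<^sup>2)
            \<le> 2 * Z1 (paths eps w) + 2 * Z2 (paths eps w)" .
        qed
      qed
    qed
    also have "\<dots> = 2 * (\<integral>\<^sup>+z. Z1 z \<partial>PM) + 2 * (\<integral>\<^sup>+z. Z2 z \<partial>PM)"
      by (simp add: nn_integral_add nn_integral_cmult nn_integral_paths)
    also have "\<dots> \<le> 2 * ennreal (C1 * \<delta> n powr (1 - 2/q)) + 2 * ennreal (C2 * \<delta> n powr (1 - 2/q))"
    proof (intro add_mono mult_left_mono Z1(2) order_trans[OF Z2(2)] ennreal_leI C2(1))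
      \<comment> \<open>The smooth part is of smaller order: its exponent 2 exceeds
        \<open>1 - 2/q\<close>, and \<open>\<delta> n \<le> 1\<close>.\<close>
      have "(\<delta> n)\<^sup>2 = \<delta> n powr 2" using delta(1)[of n] by simp
      also have "\<dots> \<le> \<delta> n powr (1 - 2/q)"
        using delta(1)[of n] \<open>\<delta> n \<le> 1\<close> q divide_nonneg_pos[of 2 q] by (intro powr_mono') linarith+
      finally show "(\<delta> n)\<^sup>2 \<le> \<delta> n powr (1 - 2/q)" .
    qed auto
    also have "\<dots> = ennreal ((2 * C1 + 2 * C2) * \<delta> n powr (1 - 2/q))"
      using C1(1) C2(1) by (simp add: distrib_right ennreal_plus ennreal_mult mult.assoc)
    also have "\<dots> \<le> ennreal ((2 * C1 + 2 * C2 + 1) * \<delta> n powr (1 - 2/q))"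
      by (intro ennreal_leI mult_right_mono) auto
    finally show "(\<integral>\<^sup>+ w. (SUP t::real. SUP s\<in>{-\<delta> n..\<delta> n}.
        ennreal ((1 + \<bar>t\<bar>) powr (2 * \<gamma> / q) * (emp_R M X n (t + s) w - emp_R M X n t w)\<^sup>2)) \<partial>M)
      \<le> ennreal ((2 * C1 + 2 * C2 + 1) * \<delta> n powr (1 - 2/q))"
      by (simp only: l_def)
  qed
qed

end
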